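(* Let $b\ge2$ be an integer and let $Q$ be an (extended) base-$b$ CP-distribution. Then its continuous centering $P=\operatorname{cent}Q$ is a fractal distribution, and the measure-preserving system $(P,S^{*})$ is a factor of the suspension of $(Q,M_b^* )$ by the function with constant height $\log b$.
   Context: Fix $d\ge 1$. $\mathbb{R}^d$ carries the sup-norm; $B_r(x)$ is the closed ball, $B_1=B_1(0)=[-1,1]^d$. $\mathcal{M}$ is the space of Radon measures on $\mathbb{R}^d$ with the weak topology (tested against continuous compactly supported functions). "Distribution" means a Borel probability measure on a space of measures (or of pairs). For $\mu(B_1)>0$ put $\mu^*=\frac{1}{\mu(B_1)}\mu$, $\mu^{\square}=\mu^*|_{B_1}$, $\mathcal{M}^*=\{\mu:\mu(B_1)=1\}$, $\mathcal{M}^{\square}=\mathcal{P}(B_1)$. Let $T_x(y)=y-x$, $S_t(y)=e^t y$, acting on measures by push-forward; $T_x^*\mu=(T_x\mu)^*$, $S_t^*\mu=(S_t\mu)^*$. $S^*=(S^*_t)_{t\in\mathbb{R}}$ acts on $\{\mu\in\mathcal{M}^*:0\in\operatorname{supp}\mu\}$; $S^*$-invariant distributions are understood to be concentrated on this set. Fractal distribution (FD): a probability distribution $P$ on $\mathcal{M}^*$ that is $S^*$-invariant and quasi-Palm, i.e. for every bounded open neighborhood $U$ of $0$, $P\sim\int\int_U\delta_{T_x^*\mu}\,d\mu(x)\,dP(\mu)$ ($\sim$: same null sets). CP-distributions. For $b\ge2$ let $\mathcal{D}_b(\mathbb{R})=\{[\frac kb,\frac{k+2}{b}):k\in\mathbb{Z},\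 k\equiv b \bmod 2\}$, and let $\mathcal{D}_b$ be the partition of $\mathbb{R}^d$ into products $I_1\times\cdots\times I_d$, $I_i\in\mathcal{D}_b(\mathbb{R})$; $\mathcal{D}_b(x)$ is the cell containing $x$. For a cell (cube) $D$ with center $c$ and side $2r$, $T_D(y)=\frac1r(y-c)$. Define $M_b^{\square}(\mu,x)=((T_{\mathcal{D}_b(x)}\mu)^{\square},T_{\mathcal{D}_b(x)}x)$ and $M_b^{*}(\mu,x)=((T_{\mathcal{D}_b(x)}\mu)^{*},T_{\mathcal{D}_b(x)}x)$ for $x\in B_1$, $\mu(\mathcal{D}_b(x))>0$. A distribution $Q$ on $\mathcal{M}^{\square}\times B_1$ is adapted if $\int f(\nu,x)\,dQ(\nu,x)=\int\left(\int f(\nu,x)\,d\nu(x)\right)dQ(\nu)$ for all $f\in C(\mathcal{M}^{\square}\times B_1)$ (conditioned on the first component $\nu$, the second has law $\nu$). A restricted base-$b$ CP-distribution is an $M_b^{\square}$-invariant adapted probability distribution on $\mathcal{M}^{\square}\times B_1$. Extended version: given a restricted CP-distribution $Q_0$, let $(\mu_n,x_n)_{n\in\mathbb{Z}}$ be the two-sided stationary process with marginal $Q_0$ and $(\mu_{n+1},x_{n+1})=M_b^{\square}(\mu_n,x_n)$. For $n\ge0$ let $\nu_n=(T_{\mathcal{D}_{b^n}(x_{-n})}\mu_{-n})^*$; these are increasing in $n$ (each is a restriction of the next), and $\nu(A)=\lim_n\nu_n(A)$ defines a Radon measure. The extended version of $Q_0$ is the law of $(\nu,x_0)$, an $M_b^*$-invariant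 distribution on $\mathcal{M}^*\times B_1$. An extended CP-distribution is one arising in this way. Centering: $\operatorname{cent}_0(\mu,x)=T_x^*\mu$ for $x\in\operatorname{supp}\mu$; for an extended base-$b$ CP-distribution $Q$, $\operatorname{cent}_0Q$ is the push-forward and the continuous centering is $\operatorname{cent}Q=\frac{1}{\log b}\int_0^{\log b}S_t^*\operatorname{cent}_0Q\,dt$. Suspension of a measure-preserving map $s$ of $(\Omega,Q)$ with constant height $c$: the space $\Omega\times[0,c)$ with $Q\times$(normalized Lebesgue measure) and the semiflow $s_t(\omega,r)=(s^{\lfloor (r+t)/c\rfloor}\omega,\ (r+t)-c\lfloor (r+t)/c\rfloor)$, $t\ge0$. A factor map is a measurable measure-preserving map, defined a.e., intertwining the actions (here of $t\ge 0$). *)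

theory Defs
  imports "HOL-Probability.Probability"
begin

section \<open>Partially defined maps on measure spaces\<close>

text \<open>Most maps below are only defined on a conull measurable set. Such a map is given by a
  total function together with its domain; values off the domain are never used.\<close>

definition push_on :: "'a set \<Rightarrow> ('a \<Rightarrow> 'b) \<Rightarrow> 'a measure \<Rightarrow> 'b measure \<Rightarrow> 'b measure" where
  "push_on D f M N = distr (restrict_space M D) N f"

definition invariant_on :: "'a measure \<Rightarrow> 'a set \<Rightarrow> ('a \<Rightarrow> 'a) \<Rightarrow> bool" where
  "invariant_on M D f \<longleftrightarrow>
     D \<inter> space M \<in> sets M \<and> (AE x in M. x \<in> D) \<and>
     f \<in> restrict_space M D \<rightarrow>\<^sub>M M \<and> push_on D f M M = M"

definition borel_of :: "'a topology \<Rightarrow> 'a measure" where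
  "borel_of X = sigma (topspace X) {U. openin X U}"


section \<open>Radon measures and the weak topology\<close>

text \<open>The unit ball of the sup-norm; note that the library norm on \<^typ>\<open>real ^ 'n\<close> is Euclidean.\<close>

definition B1 :: "(real ^ 'n) set" where
  "B1 = {x. \<forall>i. \<bar>x $ i\<bar> \<le> 1}"

text \<open>A Borel measure on a Euclidean space that is finite on compact sets is automatically
  regular, hence Radon.\<close>

definition radon :: "(real ^ 'n) measure set" where
  "radon = {\<mu>. sets \<mu> = sets borel \<and> (\<forall>K. compact K \<longrightarrow> emeasure \<mu> K < \<infinity>)}"

definition Cc :: "(real ^ 'n \<Rightarrow> real) set" where
  "Cc = {f. continuous_on UNIV f \<and> compact (closure {x. f x \<noteq> 0})}"

definition weak_topology :: "(real ^ 'n) measure topology" where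
  "weak_topology = topology_generated_by
     {{\<mu> \<in> radon. (\<integral>x. f x \<partial>\<mu>) \<in> U} |f U. f \<in> Cc \<and> open U}"

definition star_topology :: "(real ^ 'n) measure topology" where
  "star_topology = subtopology weak_topology {\<mu>. emeasure \<mu> B1 = 1}"

text \<open>Probability measures on the cube \<^const>\<open>B1\<close> are identified with the probability measures on
  the whole space that are concentrated on \<^const>\<open>B1\<close>.\<close>

definition square_topology :: "(real ^ 'n) measure topology" where
  "square_topology = subtopology weak_topology {\<mu>. emeasure \<mu> B1 = 1 \<and> emeasure \<mu> (- B1) = 0}"

definition star_pair_topology :: "((real ^ 'n) measure \<times> (real ^ 'n)) topology" where
  "star_pair_topology = prod_topology star_topology (top_of_set B1)"

definition square_pair_topology :: "((real ^ 'n) measure \<times> (real ^ 'n)) topology" where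
  "square_pair_topology = prod_topology square_topology (top_of_set B1)"

definition msupp :: "(real ^ 'n) measure \<Rightarrow> (real ^ 'n) set" where
  "msupp \<mu> = {x. \<forall>U. open U \<and> x \<in> U \<longrightarrow> emeasure \<mu> U > 0}"

definition star :: "(real ^ 'n) measure \<Rightarrow> (real ^ 'n) measure" where
  "star \<mu> = scale_measure (1 / emeasure \<mu> B1) \<mu>"

definition square :: "(real ^ 'n) measure \<Rightarrow> (real ^ 'n) measure" where
  "square \<mu> = density (star \<mu>) (indicator B1)"

definition translate_star :: "real ^ 'n \<Rightarrow> (real ^ 'n) measure \<Rightarrow> (real ^ 'n) measure" where
  "translate_star x \<mu> = star (distr \<mu> borel (\<lambda>y. y - x))"

definition scale_star :: "real \<Rightarrow> (real ^ 'n) measure \<Rightarrow> (real ^ 'n) measure" where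
  "scale_star t \<mu> = star (distr \<mu> borel (\<lambda>y. exp t *\<^sub>R y))"

definition scale_dom :: "(real ^ 'n) measure set" where
  "scale_dom = {\<mu>. 0 \<in> msupp \<mu>}"


section \<open>Fractal distributions\<close>

text \<open>The mass given to \<open>A\<close> by \<open>\<integral>\<integral>\<^sub>U \<delta>(T\<^sub>x\<^sup>*\<mu>) d\<mu>(x) dP(\<mu>)\<close>.\<close>

definition palm_mass ::
  "(real ^ 'n) measure measure \<Rightarrow> (real ^ 'n) set \<Rightarrow> (real ^ 'n) measure set \<Rightarrow> ennreal" where
  "palm_mass P U A = (\<integral>\<^sup>+\<mu>. (\<integral>\<^sup>+x\<in>U. indicator A (translate_star x \<mu>) \<partial>\<mu>) \<partial>P)"

definition quasi_palm :: "(real ^ 'n) measure measure \<Rightarrow> bool" where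
  "quasi_palm P \<longleftrightarrow>
     (\<forall>U. open U \<and> bounded U \<and> 0 \<in> U \<longrightarrow>
        (\<forall>A \<in> sets P. emeasure P A = 0 \<longleftrightarrow> palm_mass P U A = 0))"

definition fractal_distribution :: "(real ^ 'n) measure measure \<Rightarrow> bool" where
  "fractal_distribution P \<longleftrightarrow>
     prob_space P \<and> sets P = sets (borel_of star_topology) \<and>
     (\<forall>t. invariant_on P scale_dom (scale_star t)) \<and> quasi_palm P"


section \<open>The partitions and the magnification maps\<close>

definition intervals :: "nat \<Rightarrow> real set set" where
  "intervals b =
     {{of_int k / of_nat b ..< (of_int k + 2) / of_nat b} |k::int. k mod 2 = int b mod 2}"

definition cells :: "nat \<Rightarrow> (real ^ 'n) set set" where
  "cells b = {{x. \<forall>i. x $ i \<in> I i} |I. \<forall>i. I i \<in> intervals b}"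

definition cell :: "nat \<Rightarrow> real ^ 'n \<Rightarrow> (real ^ 'n) set" where
  "cell b x = (THE D. D \<in> cells b \<and> x \<in> D)"

definition cube :: "real ^ 'n \<Rightarrow> real \<Rightarrow> (real ^ 'n) set" where
  "cube c r = {y. \<forall>i. c $ i - r \<le> y $ i \<and> y $ i < c $ i + r}"

text \<open>The map \<open>T\<^sub>D\<close> for a cube \<open>D\<close>.\<close>

definition rescale :: "(real ^ 'n) set \<Rightarrow> real ^ 'n \<Rightarrow> real ^ 'n" where
  "rescale D = (THE f. \<exists>c r. r > 0 \<and> D = cube c r \<and> f = (\<lambda>y. (1 / r) *\<^sub>R (y - c)))"

definition magnify :: "nat \<Rightarrow> (real ^ 'n) measure \<Rightarrow> real ^ 'n \<Rightarrow> (real ^ 'n) measure" where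
  "magnify b \<mu> x = distr \<mu> borel (rescale (cell b x))"

definition cp_dom :: "nat \<Rightarrow> ((real ^ 'n) measure \<times> (real ^ 'n)) set" where
  "cp_dom b = {(\<mu>, x). emeasure \<mu> (cell b x) > 0}"

definition cp_square ::
  "nat \<Rightarrow> (real ^ 'n) measure \<times> (real ^ 'n) \<Rightarrow> (real ^ 'n) measure \<times> (real ^ 'n)" where
  "cp_square b = (\<lambda>(\<mu>, x). (square (magnify b \<mu> x), rescale (cell b x) x))"

definition cp_star ::
  "nat \<Rightarrow> (real ^ 'n) measure \<times> (real ^ 'n) \<Rightarrow> (real ^ 'n) measure \<times> (real ^ 'n)" where
  "cp_star b = (\<lambda>(\<mu>, x). (star (magnify b \<mu> x), rescale (cell b x) x))"


section \<open>CP-distributions\<close>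

definition adapted :: "((real ^ 'n) measure \<times> (real ^ 'n)) measure \<Rightarrow> bool" where
  "adapted Q \<longleftrightarrow>
     (\<forall>f. continuous_map square_pair_topology euclideanreal f \<longrightarrow>
        (\<integral>p. f p \<partial>Q) = (\<integral>p. (LINT x:B1|fst p. f (fst p, x)) \<partial>Q))"

definition restricted_CP :: "nat \<Rightarrow> ((real ^ 'n) measure \<times> (real ^ 'n)) measure \<Rightarrow> bool" where
  "restricted_CP b Q \<longleftrightarrow>
     prob_space Q \<and> sets Q = sets (borel_of square_pair_topology) \<and>
     adapted Q \<and> invariant_on Q (cp_dom b) (cp_square b)"

text \<open>Realised on the canonical path space: \<open>\<Omega>\<close> is the law of the two-sided process.\<close>

definition two_sided_process ::
  "nat \<Rightarrow> ((real ^ 'n) measure \<times> (real ^ 'n)) measure \<Rightarrow>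
     (int \<Rightarrow> (real ^ 'n) measure \<times> (real ^ 'n)) measure \<Rightarrow> bool" where
  "two_sided_process b Q \<Omega> \<longleftrightarrow>
     prob_space \<Omega> \<and> sets \<Omega> = sets (\<Pi>\<^sub>M n\<in>UNIV. borel_of square_pair_topology) \<and>
     distr \<Omega> \<Omega> (\<lambda>\<omega> n. \<omega> (n + 1)) = \<Omega> \<and>
     distr \<Omega> (borel_of square_pair_topology) (\<lambda>\<omega>. \<omega> 0) = Q \<and>
     (AE \<omega> in \<Omega>. \<forall>n. \<omega> n \<in> cp_dom b \<and> \<omega> (n + 1) = cp_square b (\<omega> n))"

definition approximant ::
  "nat \<Rightarrow> (int \<Rightarrow> (real ^ 'n) measure \<times> (real ^ 'n)) \<Rightarrow> nat \<Rightarrow> (real ^ 'n) measure" where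
  "approximant b \<omega> n = star (magnify (b ^ n) (fst (\<omega> (- int n))) (snd (\<omega> (- int n))))"

text \<open>The limit measure is only determined almost surely, so it enters as a random element
  \<open>\<nu>\<close> that almost surely is the setwise limit; its law does not depend on the choice.\<close>

definition is_extended_version ::
  "nat \<Rightarrow> ((real ^ 'n) measure \<times> (real ^ 'n)) measure \<Rightarrow>
     ((real ^ 'n) measure \<times> (real ^ 'n)) measure \<Rightarrow> bool" where
  "is_extended_version b Q\<^sub>0 Q \<longleftrightarrow>
     (\<exists>\<Omega> \<nu>. two_sided_process b Q\<^sub>0 \<Omega> \<and> \<nu> \<in> \<Omega> \<rightarrow>\<^sub>M borel_of star_topology \<and>
        (AE \<omega> in \<Omega>. \<forall>A \<in> sets borel.
           (\<lambda>n. emeasure (approximant b \<omega> n) A) \<longlonglongrightarrow> emeasure (\<nu> \<omega>) A) \<and>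
        Q = distr \<Omega> (borel_of star_pair_topology) (\<lambda>\<omega>. (\<nu> \<omega>, snd (\<omega> 0))))"

definition extended_CP :: "nat \<Rightarrow> ((real ^ 'n) measure \<times> (real ^ 'n)) measure \<Rightarrow> bool" where
  "extended_CP b Q \<longleftrightarrow> (\<exists>Q\<^sub>0. restricted_CP b Q\<^sub>0 \<and> is_extended_version b Q\<^sub>0 Q)"


section \<open>Centering\<close>

definition cent0 :: "((real ^ 'n) measure \<times> (real ^ 'n)) measure \<Rightarrow> (real ^ 'n) measure measure" where
  "cent0 Q = push_on {(\<mu>, x). x \<in> msupp \<mu>} (\<lambda>(\<mu>, x). translate_star x \<mu>) Q (borel_of star_topology)"

definition cent ::
  "nat \<Rightarrow> ((real ^ 'n) measure \<times> (real ^ 'n)) measure \<Rightarrow> (real ^ 'n) measure measure" where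
  "cent b Q = measure_of (topspace star_topology) (sets (borel_of star_topology))
     (\<lambda>A. (\<integral>\<^sup>+t\<in>{0..ln (real b)}.
              emeasure (push_on scale_dom (scale_star t) (cent0 Q) (borel_of star_topology)) A \<partial>lborel)
            / ennreal (ln (real b)))"


section \<open>Suspensions and factors\<close>

definition suspension_measure :: "real \<Rightarrow> 'a measure \<Rightarrow> ('a \<times> real) measure" where
  "suspension_measure c Q = Q \<Otimes>\<^sub>M uniform_measure (restrict_space lborel {0..<c}) {0..<c}"

text \<open>The points for which the semiflow over the partial map \<open>s\<close> with domain \<open>D\<close> is
  defined at all times.\<close>

definition suspension_dom :: "'a set \<Rightarrow> ('a \<Rightarrow> 'a) \<Rightarrow> ('a \<times> real) set" where
  "suspension_dom D s = {(\<omega>, r). \<forall>k. (s ^^ k) \<omega> \<in> D}"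

definition suspension_flow :: "real \<Rightarrow> ('a \<Rightarrow> 'a) \<Rightarrow> real \<Rightarrow> 'a \<times> real \<Rightarrow> 'a \<times> real" where
  "suspension_flow c s t = (\<lambda>(\<omega>, r).
     ((s ^^ nat \<lfloor>(r + t) / c\<rfloor>) \<omega>, (r + t) - c * of_int \<lfloor>(r + t) / c\<rfloor>))"

text \<open>\<open>\<phi>\<close> and \<open>\<psi>\<close> are semiflows defined on \<open>X\<close> and \<open>Y\<close>; \<open>E\<close> is the conull forward-invariant set
  on which the factor map \<open>\<pi>\<close> is defined.\<close>

definition is_factor ::
  "'b measure \<Rightarrow> 'b set \<Rightarrow> (real \<Rightarrow> 'b \<Rightarrow> 'b) \<Rightarrow>
   'a measure \<Rightarrow> 'a set \<Rightarrow> (real \<Rightarrow> 'a \<Rightarrow> 'a) \<Rightarrow> bool" where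
  "is_factor N Y \<psi> M X \<phi> \<longleftrightarrow>
     (\<exists>E \<pi>. E \<in> sets M \<and> E \<subseteq> X \<and> (AE p in M. p \<in> E) \<and>
        \<pi> \<in> restrict_space M E \<rightarrow>\<^sub>M N \<and> push_on E \<pi> M N = N \<and>
        (\<forall>p \<in> E. \<pi> p \<in> Y \<and> (\<forall>t \<ge> 0. \<phi> t p \<in> E \<and> \<pi> (\<phi> t p) = \<psi> t (\<pi> p))))"

text \<open>A suspension is formed over a measure-preserving map, hence the first conjunct.\<close>

definition is_factor_of_suspension ::
  "'b measure \<Rightarrow> 'b set \<Rightarrow> (real \<Rightarrow> 'b \<Rightarrow> 'b) \<Rightarrow> 'a measure \<Rightarrow> 'a set \<Rightarrow> ('a \<Rightarrow> 'a) \<Rightarrow> real \<Rightarrow> bool" where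
  "is_factor_of_suspension N Y \<psi> Q D s c \<longleftrightarrow>
     invariant_on Q D s \<and>
     is_factor N Y \<psi> (suspension_measure c Q) (suspension_dom D s) (suspension_flow c s)"

end

theory Submission
  imports Defs
begin

text \<open>
  All the maps involved are normalised affine images \<open>aff a z \<mu>\<close> of a measure. Replacing \<open>(\<mu>, x)\<close> by
  \<open>M\<^sub>b\<^sup>* (\<mu>, x)\<close> changes the centered measure \<open>T\<^sub>x\<^sup>* \<mu>\<close> by the scaling \<open>S\<^sub>t\<^sup>*\<close> with \<open>t = log b\<close>. Hence
  \<open>((\<mu>, x), r) \<mapsto> S\<^sub>r\<^sup>* T\<^sub>x\<^sup>* \<mu>\<close> intertwines the suspension flow with \<open>S\<^sup>*\<close>, and the \<open>M\<^sub>b\<^sup>*\<close>-invariance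
  of \<open>Q\<close> makes the image \<open>cent Q\<close> invariant under \<open>S\<^sup>*\<close>.

  Adaptedness passes from \<open>Q\<^sub>0\<close> to \<open>Q\<close> through the approximants \<open>\<nu>\<^sub>n\<close>. By adaptedness a set is null for \<open>cent Q\<close> iff for almost
  every \<open>t\<close> and \<open>\<mu>\<close> almost no point \<open>x\<close> of \<open>B\<^sub>1\<close> is bad, that is, has \<open>S\<^sub>t\<^sup>* T\<^sub>x\<^sup>* \<mu>\<close> in the set. The
  Palm average additionally looks at the bad points in a neighbourhood of \<open>x\<close>. If almost every \<open>x\<close> has no bad
  neighbours, a countable cover shows that almost no point of \<open>B\<^sub>1\<close> is bad. Conversely, invariance at the scales \<open>b\<^sup>n\<close>
  extends the absence of bad points from \<open>B\<^sub>1\<close> to cubes that exhaust \<open>\<mu>\<close>.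

  The weak topology is induced by countably many test functions, which reduces questions of
  measurability to the space of real sequences.
\<close>

section \<open>The weak topology is pulled back from a sequence space\<close>

text \<open>Adaptedness and invariance are assumed for \<open>Q\<^sub>0\<close> only, and the limit
  measure exists merely almost surely. Every property of \<open>Q\<close> is therefore established
  along a path of the two-sided process and then pushed forward. The predicate
  \<open>regular\<close> asks for convergence at all integer shifts at once, so that the origin of
  time can be moved into the past. Two features of the normalisation shape the details. Cells are
  half-open, whereas mass is normalised on the closed cube; the mismatch is harmless because
  adaptedness shows that the closed cells add no mass almost surely. Moreover \<open>aff\<close> is
  meaningless when its window has mass zero, so compositions carry the side condition
  \<open>charged\<close>, which holds at points of the support and for the cells along a path. Both
  implications of the quasi-Palm property are proved at one fixed scale \<open>a\<close>; the
  average over scales enters only at the end.\<close>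

lemma Cc_borel: "f \<in> Cc \<Longrightarrow> f \<in> borel_measurable borel"
  by (auto simp: Cc_def borel_measurable_continuous_onI)

lemma Cc_bounded_support:
  fixes f :: "real ^ 'n \<Rightarrow> real"
  assumes "f \<in> Cc"
  obtains n :: nat where "\<And>x. f x \<noteq> 0 \<Longrightarrow> norm x \<le> real n"
proof -
  have "bounded (closure {x. f x \<noteq> 0})"
    using assms compact_imp_bounded by (auto simp: Cc_def)
  then obtain a where a: "\<And>x. x \<in> closure {x. f x \<noteq> 0} \<Longrightarrow> norm x \<le> a"
    by (auto simp: bounded_iff)
  obtain n :: nat where "a \<le> real n"
    using real_arch_simple by blast
  then show ?thesis
    using a closure_subset[of "{x. f x \<noteq> 0}"] by (intro that[of n]) force
qed

lemma Cc_I: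
  fixes f :: "real ^ 'n \<Rightarrow> real"
  assumes "continuous_on UNIV f" "\<And>x. f x \<noteq> 0 \<Longrightarrow> norm x \<le> a"
  shows "f \<in> Cc"
proof -
  have "{x. f x \<noteq> 0} \<subseteq> cball 0 a"
    using assms(2) by auto
  then show ?thesis
    using assms(1) by (auto simp: Cc_def intro: bounded_subset[OF bounded_cball])
qed

lemma Cc_integrable:
  assumes "f \<in> Cc" "\<mu> \<in> radon"
  shows "integrable \<mu> f"
proof -
  have s[measurable_cong]: "sets \<mu> = sets borel"
    using assms by (auto simp: radon_def)
  let ?K = "closure {x. f x \<noteq> 0}"
  have K: "compact ?K" and c: "continuous_on UNIV f"
    using assms by (auto simp: Cc_def)
  have "compact (f ` ?K)"
    using K c by (meson compact_continuous_image continuous_on_subset subset_UNIV)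
  then obtain B where B: "\<And>x. x \<in> ?K \<Longrightarrow> norm (f x) \<le> B"
    by (meson bounded_iff compact_imp_bounded image_eqI)
  show ?thesis
  proof (rule integrableI_bounded_set[of ?K _ _ B])
    show "f \<in> borel_measurable \<mu>"
      using Cc_borel[OF assms(1)] s by (simp cong: measurable_cong_sets)
    show "emeasure \<mu> ?K < \<infinity>"
      using K assms by (auto simp: radon_def)
    show "AE x in \<mu>. x \<notin> ?K \<longrightarrow> f x = 0"
      using closure_subset[of "{x. f x \<noteq> 0}"] by auto
    show "?K \<in> sets \<mu>" by (simp add: s)
  qed (use B in auto)
qed

section \<open>A countable family of test functions\<close>

definition cutoff :: "nat \<Rightarrow> real ^ 'n \<Rightarrow> real" where
  "cutoff n x = max 0 (min 1 (real n + 1 - norm x))"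

lemma cutoff_Cc: "cutoff n \<in> Cc"
proof (rule Cc_I[of _ "real n + 1"])
  show "continuous_on UNIV (cutoff n)"
    unfolding cutoff_def by (intro continuous_intros)
qed (auto simp: cutoff_def max_def min_def split: if_splits)

lemma cutoff_nonneg: "0 \<le> cutoff n x" and cutoff_le_1: "cutoff n x \<le> 1"
  by (auto simp: cutoff_def)

lemma cutoff_eq_1: "norm x \<le> real n \<Longrightarrow> cutoff n x = 1"
  by (auto simp: cutoff_def)

lemma ball_net:
  fixes r :: real
  assumes "\<delta> > 0"
  obtains F :: "(real ^ 'n) set" where "finite F" "\<And>x. norm x \<le> r \<Longrightarrow> \<exists>q\<in>F. dist x q < \<delta>"
proof -
  have "compact (cball 0 r :: (real ^ 'n) set)" by simp
  moreover have "\<And>q :: real ^ 'n. open (ball q \<delta>)" by simp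
  moreover have "cball 0 r \<subseteq> (\<Union>q::real ^ 'n. ball q \<delta>)"
    using assms centre_in_ball by blast
  ultimately obtain F where "finite F" "cball 0 r \<subseteq> (\<Union>q\<in>F. ball (q :: real ^ 'n) \<delta>)"
    by (rule compactE_image[of "cball 0 r" UNIV "\<lambda>q. ball q \<delta>"])
  then show ?thesis
    by (intro that[of F]) (fastforce simp: dist_commute)+
qed

text \<open>The radius \<open>n + 1\<close> is that of the support of \<open>cutoff n\<close>;
  outside it no approximation is required.\<close>

definition net :: "nat \<Rightarrow> nat \<Rightarrow> (real ^ 'n) set" where
  "net n m = (SOME F. finite F \<and> (\<forall>x. norm x \<le> real n + 1 \<longrightarrow> (\<exists>q\<in>F. dist x q < 1 / (real m + 1))))"

lemma net: "finite (net n m :: (real ^ 'n) set)"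
    "norm (x :: real ^ 'n) \<le> real n + 1 \<Longrightarrow> \<exists>q\<in>net n m. dist x q < 1 / (real m + 1)"
proof -
  have "\<exists>F :: (real ^ 'n) set. finite F \<and>
      (\<forall>x. norm x \<le> real n + 1 \<longrightarrow> (\<exists>q\<in>F. dist x q < 1 / (real m + 1)))"
    by (rule ball_net[of "1 / (real m + 1)" "real n + 1"]) auto
  from someI_ex[OF this]
  show "finite (net n m :: (real ^ 'n) set)"
    "norm (x :: real ^ 'n) \<le> real n + 1 \<Longrightarrow> \<exists>q\<in>net n m. dist x q < 1 / (real m + 1)"
    by (auto simp: net_def)
qed

text \<open>The radius of the hats is twice the mesh of the net. A net point within
  \<open>1 / (m + 1)\<close> of \<open>x\<close> thus contributes at least
  \<open>1 / (m + 1)\<close>, so the denominator of \<open>bump\<close> is the plain sum of the hats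
  wherever \<open>cutoff n\<close> is nonzero.\<close>

definition hat :: "nat \<Rightarrow> real ^ 'n \<Rightarrow> real ^ 'n \<Rightarrow> real" where
  "hat m q x = max 0 (2 / (real m + 1) - dist x q)"

text \<open>A partition of \<open>cutoff n\<close>; the maximum with \<open>1 / (m + 1)\<close> only avoids a zero denominator outside
  the support of \<open>cutoff n\<close>.\<close>

definition bump :: "nat \<Rightarrow> nat \<Rightarrow> real ^ 'n \<Rightarrow> real ^ 'n \<Rightarrow> real" where
  "bump n m q x = cutoff n x * hat m q x / max (1 / (real m + 1)) (\<Sum>p\<in>net n m. hat m p x)"

lemma cutoff_eq_0: "real n + 1 \<le> norm x \<Longrightarrow> cutoff n x = 0"
  by (auto simp: cutoff_def)

lemma bump_Cc: "bump n m q \<in> Cc"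
proof (rule Cc_I[of _ "real n + 1"])
  have "max (1 / (real m + 1)) s \<noteq> 0" for s :: real
    by (smt (verit) divide_pos_pos of_nat_0_le_iff)
  then show "continuous_on UNIV (bump n m q)"
    unfolding bump_def hat_def cutoff_def by (intro continuous_intros) auto
  show "norm x \<le> real n + 1" if "bump n m q x \<noteq> 0" for x
    using that cutoff_eq_0[of n x] by (cases "norm x \<le> real n + 1") (auto simp: bump_def)
qed

lemma bump_nonneg: "0 \<le> bump n m q x"
proof -
  have "0 \<le> max (1 / (real m + 1)) s" for s :: real
    by (simp add: le_max_iff_disj)
  then show ?thesis
    unfolding bump_def by (intro divide_nonneg_nonneg mult_nonneg_nonneg) (auto simp: cutoff_nonneg hat_def)
qed

lemma sum_bump: "(\<Sum>q\<in>net n m. bump n m q x) = cutoff n x"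
proof (cases "norm x \<le> real n + 1")
  case False
  then show ?thesis
    using cutoff_eq_0[of n x] by (simp add: bump_def)
next
  case True
  then obtain q where q: "q \<in> net n m" "dist x q < 1 / (real m + 1)"
    using net(2) by blast
  then have "1 / (real m + 1) \<le> hat m q x"
    by (auto simp: hat_def)
  also have "\<dots> \<le> (\<Sum>p\<in>net n m. hat m p x)"
    using q by (intro member_le_sum) (auto simp: hat_def net(1))
  finally have "1 / (real m + 1) \<le> (\<Sum>p\<in>net n m. hat m p x)" .
  moreover have "1 / (real m + 1) > 0" by simp
  ultimately have "max (1 / (real m + 1)) (\<Sum>p\<in>net n m. hat m p x) = (\<Sum>p\<in>net n m. hat m p x)"
    "(\<Sum>p\<in>net n m. hat m p x) \<noteq> 0"
    by linarith+
  then show ?thesis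
    by (simp add: bump_def flip: sum_divide_distrib sum_distrib_left)
qed

text \<open>The bumps supply the approximation. The cutoffs bound the mass of bounded regions, which
  controls the error of that approximation uniformly over a neighbourhood of measures.\<close>

definition test_functions :: "(real ^ 'n \<Rightarrow> real) set" where
  "test_functions = range cutoff \<union> (\<Union>n m. bump n m ` net n m)"

lemma countable_test_functions: "countable test_functions"
  unfolding test_functions_def
  by (intro countable_Un countable_UN countable_image countable_finite[OF net(1)]) auto

definition test_seq :: "nat \<Rightarrow> real ^ 'n \<Rightarrow> real" where
  "test_seq = from_nat_into test_functions"

lemma range_test_seq: "range test_seq = test_functions"
  unfolding test_seq_def
  by (rule range_from_nat_into[OF _ countable_test_functions]) (simp add: test_functions_def)

lemma test_seq_Cc: "(test_seq k :: real ^ 'n \<Rightarrow> real) \<in> Cc"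
proof -
  have "(test_seq k :: real ^ 'n \<Rightarrow> real) \<in> test_functions"
    using range_test_seq by auto
  then consider n where "test_seq k = (cutoff n :: real ^ 'n \<Rightarrow> real)"
    | n m q where "test_seq k = (bump n m q :: real ^ 'n \<Rightarrow> real)"
    unfolding test_functions_def by blast
  then show ?thesis
    by cases (simp_all only: cutoff_Cc bump_Cc)
qed

definition emb :: "(real ^ 'n) measure \<Rightarrow> nat \<Rightarrow> real" where
  "emb \<mu> = (\<lambda>k. \<integral>x. test_seq k x \<partial>\<mu>)"

text \<open>Uniform continuity lets \<open>f\<close> be frozen at the net points that see
  \<open>x\<close>. The order of quantifiers matters: \<open>n\<close> depends on the support of
  \<open>f\<close> only, so the errors for all accuracies are dominated by multiples of one function
  \<open>cutoff n\<close>, whose integral can be bounded beforehand.\<close>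

lemma Cc_approx:
  fixes f :: "real ^ 'n \<Rightarrow> real"
  assumes "f \<in> Cc"
  obtains n where "\<And>\<epsilon>. \<epsilon> > 0 \<Longrightarrow> \<exists>m. \<forall>x. \<bar>f x - (\<Sum>q\<in>net n m. f q * bump n m q x)\<bar> \<le> \<epsilon> * cutoff n x"
proof -
  obtain n where n: "\<And>x. f x \<noteq> 0 \<Longrightarrow> norm x \<le> real n"
    using Cc_bounded_support[OF assms] by blast
  have c: "continuous_on UNIV f"
    using assms by (auto simp: Cc_def)
  have "\<exists>m. \<forall>x. \<bar>f x - (\<Sum>q\<in>net n m. f q * bump n m q x)\<bar> \<le> \<epsilon> * cutoff n x" if "\<epsilon> > 0" for \<epsilon>
  proof -
    \<comment> \<open>If a bump does not vanish at \<open>x\<close>, then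
      \<open>norm x \<le> n + 1\<close> and its centre is within distance \<open>2\<close>, so both
      points lie in this ball.\<close>
    have "uniformly_continuous_on (cball 0 (real n + 4)) f"
      by (intro compact_uniformly_continuous continuous_on_subset[OF c]) auto
    then obtain d where d: "d > 0" "\<And>x y. x \<in> cball 0 (real n + 4) \<Longrightarrow> y \<in> cball 0 (real n + 4) \<Longrightarrow>
        dist y x < d \<Longrightarrow> dist (f y) (f x) < \<epsilon>"
      using \<open>\<epsilon> > 0\<close> unfolding uniformly_continuous_on_def by metis
    obtain m :: nat where "2 / d < real m"
      using reals_Archimedean2 by blast
    then have m: "2 / (real m + 1) < d"
      using d(1) by (simp add: field_simps)
    have "\<bar>f x - (\<Sum>q\<in>net n m. f q * bump n m q x)\<bar> \<le> \<epsilon> * cutoff n x" for x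
    proof -
      have "f x = f x * cutoff n x"
        using n[of x] cutoff_eq_1[of x n] by fastforce
      also have "\<dots> = (\<Sum>q\<in>net n m. f x * bump n m q x)"
        by (simp add: sum_bump flip: sum_distrib_left)
      finally have "\<bar>f x - (\<Sum>q\<in>net n m. f q * bump n m q x)\<bar>
          = \<bar>\<Sum>q\<in>net n m. (f x - f q) * bump n m q x\<bar>"
        by (simp add: left_diff_distrib sum_subtractf)
      also have "\<dots> \<le> (\<Sum>q\<in>net n m. \<bar>(f x - f q) * bump n m q x\<bar>)"
        by (rule sum_abs)
      also have "\<dots> \<le> (\<Sum>q\<in>net n m. \<epsilon> * bump n m q x)"
      proof (rule sum_mono)
        fix q :: "real ^ 'n" assume "q \<in> net n m"
        show "\<bar>(f x - f q) * bump n m q x\<bar> \<le> \<epsilon> * bump n m q x"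
        proof (cases "bump n m q x = 0")
          case False
          then have "cutoff n x \<noteq> 0" "hat m q x \<noteq> 0"
            by (auto simp: bump_def)
          then have nx: "norm x \<le> real n + 1" and "dist x q < 2 / (real m + 1)"
            using cutoff_eq_0[of n x] by (fastforce, auto simp: hat_def max_def split: if_splits)
          moreover have "2 / (real m + 1) \<le> 2"
            by (simp add: field_simps)
          ultimately have dq: "dist x q < d" "dist x q \<le> 2"
            using m by linarith+
          have "norm q \<le> real n + 4"
            using nx dq norm_triangle_ineq2[of q x] by (simp add: dist_norm norm_minus_commute)
          then have "\<bar>f x - f q\<bar> \<le> \<epsilon>"
            using d(2)[of q x] nx dq by (auto simp: dist_real_def less_imp_le)
          then show ?thesis
            using bump_nonneg[of n m q x] by (auto simp: abs_mult intro: mult_right_mono)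
        qed simp
      qed
      also have "\<dots> = \<epsilon> * cutoff n x"
        by (simp add: sum_bump flip: sum_distrib_left)
      finally show ?thesis .
    qed
    then show ?thesis by blast
  qed
  then show ?thesis using that by blast
qed

text \<open>The error of the approximation by test functions is dominated by a multiple of the test function
  \<open>cutoff n\<close>, whose integral stays bounded near \<open>\<mu>\<^sub>0\<close>.\<close>

lemma integral_Cc_near:
  fixes \<mu>\<^sub>0 :: "(real ^ 'n) measure"
  assumes f: "f \<in> Cc" and \<mu>0: "\<mu>\<^sub>0 \<in> radon" and "\<epsilon> > 0"
  obtains V where "open V" "emb \<mu>\<^sub>0 \<in> V"
    "\<And>\<mu>. \<mu> \<in> radon \<Longrightarrow> emb \<mu> \<in> V \<Longrightarrow> \<bar>(\<integral>x. f x \<partial>\<mu>) - (\<integral>x. f x \<partial>\<mu>\<^sub>0)\<bar> < \<epsilon>"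
proof -
  obtain n where n: "\<And>\<epsilon>. \<epsilon> > 0 \<Longrightarrow>
      \<exists>m. \<forall>x. \<bar>f x - (\<Sum>q\<in>net n m. f q * bump n m q x)\<bar> \<le> \<epsilon> * cutoff n x"
    using Cc_approx[OF f] by blast
  define c where "c = (\<integral>x. cutoff n x \<partial>\<mu>\<^sub>0)"
  have c: "c \<ge> 0"
    unfolding c_def by (simp add: cutoff_nonneg)
  \<comment> \<open>The errors are at most \<open>\<delta> * (c + 1)\<close> at
    \<open>\<mu>\<close>, \<open>\<delta> * c\<close> at \<open>\<mu>\<^sub>0\<close> and
    \<open>\<delta>\<close> between the two values of \<open>L\<close>; the sum
    \<open>\<delta> * (2 * c + 2)\<close> stays strictly below \<open>\<epsilon>\<close>.\<close>
  define \<delta> where "\<delta> = \<epsilon> / (2 * c + 4)"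
  have \<delta>: "\<delta> > 0" "\<delta> * (2 * c + 4) = \<epsilon>"
    using c \<open>\<epsilon> > 0\<close> by (auto simp: \<delta>_def field_simps)
  obtain m where m: "\<And>x. \<bar>f x - (\<Sum>q\<in>net n m. f q * bump n m q x)\<bar> \<le> \<delta> * cutoff n x"
    using n[OF \<delta>(1)] by blast
  define kk where "kk h = (SOME k. test_seq k = h)" for h :: "real ^ 'n \<Rightarrow> real"
  have kk: "test_seq (kk h) = h" if "h \<in> test_functions" for h :: "real ^ 'n \<Rightarrow> real"
  proof -
    have "h \<in> range test_seq"
      using that by (simp add: range_test_seq)
    then show ?thesis
      unfolding kk_def by (intro someI_ex[of "\<lambda>k. test_seq k = h"]) auto
  qed
  define L :: "(nat \<Rightarrow> real) \<Rightarrow> real" where "L y = (\<Sum>q\<in>net n m. f q * y (kk (bump n m q)))" for y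
  have Lc: "continuous_on UNIV L"
    unfolding L_def by (intro continuous_intros continuous_on_product_coordinates)
  have bt: "q \<in> net n m \<Longrightarrow> bump n m q \<in> test_functions" for q :: "real ^ 'n"
    by (auto simp: test_functions_def)
  have ct: "cutoff n \<in> test_functions"
    by (auto simp: test_functions_def)
  have L: "\<bar>(\<integral>x. f x \<partial>\<mu>) - L (emb \<mu>)\<bar> \<le> \<delta> * (\<integral>x. cutoff n x \<partial>\<mu>)" if "\<mu> \<in> radon" for \<mu>
  proof -
    note i = Cc_integrable[OF f that] Cc_integrable[OF bump_Cc that] Cc_integrable[OF cutoff_Cc that]
    have "L (emb \<mu>) = (\<integral>x. (\<Sum>q\<in>net n m. f q * bump n m q x) \<partial>\<mu>)"
      unfolding L_def emb_def by (subst Bochner_Integration.integral_sum) (auto simp: i kk bt)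
    then have "(\<integral>x. f x \<partial>\<mu>) - L (emb \<mu>) = (\<integral>x. f x - (\<Sum>q\<in>net n m. f q * bump n m q x) \<partial>\<mu>)"
      by (simp add: i)
    also have "\<bar>\<dots>\<bar> \<le> (\<integral>x. \<bar>f x - (\<Sum>q\<in>net n m. f q * bump n m q x)\<bar> \<partial>\<mu>)"
      by (rule integral_abs_bound)
    also have "\<dots> \<le> (\<integral>x. \<delta> * cutoff n x \<partial>\<mu>)"
      by (rule integral_mono) (auto simp: i m)
    finally show ?thesis by simp
  qed
  define V where "V = {y. L y < L (emb \<mu>\<^sub>0) + \<delta>} \<inter> {y. L y > L (emb \<mu>\<^sub>0) - \<delta>} \<inter> {y. y (kk (cutoff n)) < c + 1}"
  have "open V"
    unfolding V_def
    by (intro open_Int open_Collect_less continuous_intros Lc continuous_on_product_coordinates)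
  moreover have "emb \<mu>\<^sub>0 \<in> V"
    using \<delta> by (auto simp: V_def emb_def kk[OF ct] c_def)
  moreover have "\<bar>(\<integral>x. f x \<partial>\<mu>) - (\<integral>x. f x \<partial>\<mu>\<^sub>0)\<bar> < \<epsilon>" if \<mu>: "\<mu> \<in> radon" and V: "emb \<mu> \<in> V" for \<mu>
  proof -
    have "(\<integral>x. cutoff n x \<partial>\<mu>) < c + 1"
      using V by (auto simp: V_def emb_def kk[OF ct])
    then have "\<delta> * (\<integral>x. cutoff n x \<partial>\<mu>) \<le> \<delta> * (c + 1)"
      using \<delta> by (intro mult_left_mono) auto
    then have "\<bar>(\<integral>x. f x \<partial>\<mu>) - L (emb \<mu>)\<bar> \<le> \<delta> * (c + 1)"
      using L[OF \<mu>] by linarith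
    moreover have "\<bar>(\<integral>x. f x \<partial>\<mu>\<^sub>0) - L (emb \<mu>\<^sub>0)\<bar> \<le> \<delta> * c"
      using L[OF \<mu>0] by (simp add: c_def)
    moreover have "\<bar>L (emb \<mu>) - L (emb \<mu>\<^sub>0)\<bar> < \<delta>"
      using V by (auto simp: V_def)
    moreover have "\<epsilon> = \<delta> * (c + 1) + \<delta> * c + \<delta> + 2 * \<delta>"
      unfolding \<delta>(2)[symmetric] by (simp add: algebra_simps)
    ultimately show ?thesis
      using \<delta>(1) by linarith
  qed
  ultimately show ?thesis using that by blast
qed

section \<open>The weak open sets as preimages under the embedding\<close>

lemma topspace_weak: "topspace weak_topology = radon"
proof -
  \<comment> \<open>The zero function with the full line as target makes all of \<open>radon\<close>
    a subbasic set.\<close>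
  have "(\<lambda>x. 0) \<in> (Cc :: (real ^ 'n \<Rightarrow> real) set)"
    by (rule Cc_I) auto
  then have "radon \<in> {{\<mu> \<in> radon. (\<integral>x. f x \<partial>\<mu>) \<in> U} |(f :: real ^ 'n \<Rightarrow> real) U. f \<in> Cc \<and> open U}"
    by (auto intro!: exI[of _ "\<lambda>x. 0"] exI[of _ UNIV])
  then show ?thesis
    unfolding weak_topology_def topology_generated_by_topspace by blast
qed

lemma continuous_map_emb: "continuous_map weak_topology euclidean emb"
proof -
  have "continuous_map weak_topology (product_topology (\<lambda>_. euclidean) UNIV) (emb :: (real ^ 'n) measure \<Rightarrow> _)"
    unfolding continuous_map_componentwise_UNIV
  proof
    fix k
    show "continuous_map weak_topology euclideanreal (\<lambda>\<mu> :: (real ^ 'n) measure. emb \<mu> k)"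
      unfolding continuous_map_def topspace_weak
    proof (intro conjI allI impI)
      fix U :: "real set" assume "openin euclideanreal U"
      then show "openin weak_topology {\<mu> \<in> radon. emb \<mu> k \<in> U}"
        unfolding weak_topology_def emb_def
        by (intro topology_generated_by_Basis) (auto intro: test_seq_Cc)
    qed auto
  qed
  then show ?thesis
    by (simp add: euclidean_product_topology)
qed

text \<open>The content is in the subbasic sets: a condition on the integral of an arbitrary
  \<open>f\<close> is recovered as the union of all open \<open>V\<close> that force it, and
  \<open>integral_Cc_near\<close> shows that every measure satisfying the condition lies in one of
  them.\<close>

lemma openin_weak_iff: "openin weak_topology W \<longleftrightarrow> (\<exists>V. open V \<and> W = emb -` V \<inter> radon)"
proof
  assume "\<exists>V. open V \<and> W = emb -` V \<inter> radon"
  then obtain V where V: "open V" "W = emb -` V \<inter> radon"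
    by blast
  then have "openin weak_topology {\<mu> \<in> topspace weak_topology. emb \<mu> \<in> V}"
    using continuous_map_emb by (intro openin_continuous_map_preimage) auto
  also have "{\<mu> \<in> topspace weak_topology. emb \<mu> \<in> V} = W"
    by (auto simp: V topspace_weak)
  finally show "openin weak_topology W" .
next
  assume "openin weak_topology W"
  then have "generate_topology_on {{\<mu> \<in> radon. (\<integral>x. f x \<partial>\<mu>) \<in> U} |f U. f \<in> Cc \<and> open U} W"
    unfolding weak_topology_def by (rule openin_topology_generated_by)
  then show "\<exists>V. open V \<and> W = emb -` V \<inter> radon"
  proof induction
    case Empty
    then show ?case by (intro exI[of _ "{}"]) auto
  next
    case (Int a b)
    then obtain V V' where "open V" "a = emb -` V \<inter> radon" "open V'" "b = emb -` V' \<inter> radon"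
      by blast
    then show ?case by (intro exI[of _ "V \<inter> V'"]) auto
  next
    case (UN K)
    then obtain V where V: "\<And>k. k \<in> K \<Longrightarrow> open (V k) \<and> k = emb -` V k \<inter> radon"
      by metis
    then have "\<Union>K = emb -` (\<Union>k\<in>K. V k) \<inter> radon" by auto
    then show ?case using V by (intro exI[of _ "\<Union>k\<in>K. V k"]) auto
  next
    case (Basis s)
    then obtain f U where f: "f \<in> Cc" and U: "open U" and s: "s = {\<mu> \<in> radon. (\<integral>x. f x \<partial>\<mu>) \<in> U}"
      by blast
    define W where "W = \<Union>{V. open V \<and> (\<forall>\<mu>\<in>radon. emb \<mu> \<in> V \<longrightarrow> (\<integral>x. f x \<partial>\<mu>) \<in> U)}"
    have "open W" by (auto simp: W_def)
    moreover have "s = emb -` W \<inter> radon"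
    proof (intro equalityI subsetI)
      fix \<mu> assume \<mu>: "\<mu> \<in> s"
      then obtain \<epsilon> where e: "\<epsilon> > 0" "\<And>y. \<bar>y - (\<integral>x. f x \<partial>\<mu>)\<bar> < \<epsilon> \<Longrightarrow> y \<in> U"
        using U by (auto simp: s open_dist dist_real_def)
      obtain V where "open V" "emb \<mu> \<in> V"
        "\<And>\<mu>'. \<mu>' \<in> radon \<Longrightarrow> emb \<mu>' \<in> V \<Longrightarrow> \<bar>(\<integral>x. f x \<partial>\<mu>') - (\<integral>x. f x \<partial>\<mu>)\<bar> < \<epsilon>"
        using integral_Cc_near[OF f _ e(1)] \<mu> s by blast
      then show "\<mu> \<in> emb -` W \<inter> radon"
        using \<mu> e(2) by (auto simp: W_def s intro!: exI[of _ V])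
    qed (auto simp: W_def s)
    ultimately show ?case by blast
  qed
qed

section \<open>Borel sets of pulled-back topologies\<close>

text \<open>This is all that is used of an embedding: open sets, hence Borel sets, are exactly the
  preimages under \<open>e\<close>. It suffices to transport measurability and equality of measures
  from a concrete metric space.\<close>

definition pulled_back :: "'a topology \<Rightarrow> ('a \<Rightarrow> 'b::topological_space) \<Rightarrow> bool" where
  "pulled_back X e \<longleftrightarrow> (\<forall>W. openin X W \<longleftrightarrow> (\<exists>V. open V \<and> W = e -` V \<inter> topspace X))"

lemma space_borel_of [simp]: "space (borel_of X) = topspace X"
  unfolding borel_of_def by (rule space_measure_of) (auto dest: openin_subset)

lemma pulled_back_weak: "pulled_back weak_topology emb"
  by (auto simp: pulled_back_def openin_weak_iff topspace_weak)

lemma pulled_back_subtopology: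
  assumes "pulled_back X e"
  shows "pulled_back (subtopology X S) e"
proof -
  have "openin X T \<longleftrightarrow> (\<exists>V. open V \<and> T = e -` V \<inter> topspace X)" for T
    using assms by (simp add: pulled_back_def)
  then show ?thesis
    unfolding pulled_back_def openin_subtopology topspace_subtopology
    by (simp add: Int_assoc) blast
qed

lemma pulled_back_prod:
  fixes S :: "'c::topological_space set"
  assumes "pulled_back X e"
  shows "pulled_back (prod_topology X (top_of_set S)) (\<lambda>(\<mu>, x). (e \<mu>, x))"
  unfolding pulled_back_def
proof (intro allI iffI)
  fix W assume "openin (prod_topology X (top_of_set S)) W"
  then have W: "\<And>\<mu> x. (\<mu>, x) \<in> W \<Longrightarrow> \<exists>U V. openin X U \<and> openin (top_of_set S) V \<and> \<mu> \<in> U \<and> x \<in> V \<and> U \<times> V \<subseteq> W"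
    by (simp add: openin_prod_topology_alt)
  have Wt: "W \<subseteq> topspace X \<times> S"
    using openin_subset[OF \<open>openin (prod_topology X (top_of_set S)) W\<close>] by simp
  \<comment> \<open>Taking every admissible rectangle at once avoids a choice of target sets for the
    points of \<open>W\<close>.\<close>
  define Z where "Z = \<Union>{U \<times> V |U V. open U \<and> open V \<and> (e -` U \<inter> topspace X) \<times> (V \<inter> S) \<subseteq> W}"
  have "open Z" by (auto simp: Z_def intro!: open_Times)
  moreover have "W = (\<lambda>(\<mu>, x). (e \<mu>, x)) -` Z \<inter> topspace (prod_topology X (top_of_set S))"
  proof (intro equalityI subsetI)
    fix p assume p: "p \<in> W"
    obtain \<mu> x where px: "p = (\<mu>, x)" by (cases p)
    obtain U V where UV: "openin X U" "openin (top_of_set S) V" "\<mu> \<in> U" "x \<in> V" "U \<times> V \<subseteq> W"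
      using W[of \<mu> x] p unfolding px by auto
    obtain U' where U': "open U'" "U = e -` U' \<inter> topspace X"
      using assms UV(1) by (auto simp: pulled_back_def)
    obtain V' where V': "open V'" "V = V' \<inter> S"
      using UV(2) by (auto simp: openin_subtopology)
    have "U' \<times> V' \<in> {U \<times> V |U V. open U \<and> open V \<and> (e -` U \<inter> topspace X) \<times> (V \<inter> S) \<subseteq> W}"
      using U' V' UV(5) by auto
    moreover have "(e \<mu>, x) \<in> U' \<times> V'"
      using U' V' UV by auto
    ultimately have "(e \<mu>, x) \<in> Z"
      unfolding Z_def by blast
    then show "p \<in> (\<lambda>(\<mu>, x). (e \<mu>, x)) -` Z \<inter> topspace (prod_topology X (top_of_set S))"
      using p px Wt by auto
  next
    fix p assume "p \<in> (\<lambda>(\<mu>, x). (e \<mu>, x)) -` Z \<inter> topspace (prod_topology X (top_of_set S))"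
    then show "p \<in> W"
      by (cases p) (auto simp: Z_def)
  qed
  ultimately show "\<exists>V. open V \<and> W = (\<lambda>(\<mu>, x). (e \<mu>, x)) -` V \<inter> topspace (prod_topology X (top_of_set S))"
    by blast
next
  fix W assume "\<exists>V. open V \<and> W = (\<lambda>(\<mu>, x). (e \<mu>, x)) -` V \<inter> topspace (prod_topology X (top_of_set S))"
  then obtain V where V: "open V" "W = (\<lambda>(\<mu>, x). (e \<mu>, x)) -` V \<inter> topspace (prod_topology X (top_of_set S))"
    by blast
  show "openin (prod_topology X (top_of_set S)) W"
    unfolding openin_prod_topology_alt
  proof (intro allI impI)
    fix \<mu> x assume "(\<mu>, x) \<in> W"
    then have eV: "(e \<mu>, x) \<in> V" and t: "\<mu> \<in> topspace X" "x \<in> S"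
      by (auto simp: V)
    obtain A B where AB: "open A" "open B" "e \<mu> \<in> A" "x \<in> B" "A \<times> B \<subseteq> V"
      by (rule open_prod_elim[OF V(1) eV]) auto
    let ?A = "e -` A \<inter> topspace X" and ?B = "B \<inter> S"
    have "openin X ?A" "openin (top_of_set S) ?B"
      using assms AB by (auto simp: pulled_back_def openin_subtopology)
    moreover have "\<mu> \<in> ?A" "x \<in> ?B" "?A \<times> ?B \<subseteq> W"
      using AB t by (auto simp: V)
    ultimately show "\<exists>U Va. openin X U \<and> openin (top_of_set S) Va \<and> \<mu> \<in> U \<and> x \<in> Va \<and> U \<times> Va \<subseteq> W"
      by (intro exI[of _ ?A] exI[of _ ?B]) simp
  qed
qed

text \<open>Generating a \<sigma>-algebra commutes with taking preimages.\<close>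

lemma borel_of_pulled_back:
  assumes "pulled_back X e"
  shows "borel_of X = vimage_algebra (topspace X) e borel"
proof -
  have "{U. openin X U} = {e -` A \<inter> topspace X |A. A \<in> {S. open S}}"
    using assms by (auto simp: pulled_back_def)
  then show ?thesis
    unfolding borel_of_def borel_def by (subst vimage_algebra_sigma) auto
qed

lemma measurable_pulled_back:
  assumes "pulled_back X e"
  shows "e \<in> borel_of X \<rightarrow>\<^sub>M borel"
  unfolding borel_of_pulled_back[OF assms] by (rule measurable_vimage_algebra1) auto

lemma measurable_into_pulled_back:
  assumes "pulled_back X e" "g \<in> space N \<rightarrow> topspace X" "(\<lambda>x. e (g x)) \<in> N \<rightarrow>\<^sub>M borel"
  shows "g \<in> N \<rightarrow>\<^sub>M borel_of X"
  unfolding borel_of_pulled_back[OF assms(1)] using assms by (intro measurable_vimage_algebra2) auto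

lemma continuous_map_pulled_back:
  fixes h :: "'b::topological_space \<Rightarrow> real"
  assumes "pulled_back X e" "continuous_on UNIV h"
  shows "continuous_map X euclideanreal (\<lambda>x. h (e x))"
  unfolding continuous_map_def
proof (intro conjI allI impI)
  fix U :: "real set" assume "openin euclideanreal U"
  then have "open (h -` U)"
    using assms(2) by (simp add: continuous_on_open_vimage)
  then have "openin X (e -` (h -` U) \<inter> topspace X)"
    using assms(1) by (auto simp: pulled_back_def)
  also have "e -` (h -` U) \<inter> topspace X = {x \<in> topspace X. h (e x) \<in> U}"
    by auto
  finally show "openin X {x \<in> topspace X. h (e x) \<in> U}" .
qed auto

section \<open>Equality of measures tested on continuous functions\<close>

lemma open_indicator_approx:
  fixes V :: "'b::metric_space set"
  assumes V: "open V"
  obtains h :: "nat \<Rightarrow> 'b \<Rightarrow> real" where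
    "\<And>k. continuous_on UNIV (h k)" "\<And>k x. 0 \<le> h k x" "\<And>k x. h k x \<le> 1"
    "\<And>x. incseq (\<lambda>k. h k x)" "\<And>k x. x \<notin> V \<Longrightarrow> h k x = 0" "\<And>x. x \<in> V \<Longrightarrow> \<exists>k. h k x = 1"
proof -
  \<comment> \<open>The value of \<open>setdist\<close> for the empty set is \<open>0\<close>, so
    the case of the whole space is set apart.\<close>
  define h where "h k x = (if V = UNIV then 1 else min 1 (real k * setdist {x} (- V)))" for k x
  have "continuous_on UNIV (h k)" for k
  proof -
    have "continuous_on UNIV (\<lambda>x. min 1 (real k * setdist {x} (- V)))"
      by (intro continuous_intros continuous_on_setdist)
    then show ?thesis
      by (cases "V = UNIV") (auto simp: h_def)
  qed
  moreover have "0 \<le> h k x" "h k x \<le> 1" for k x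
    by (auto simp: h_def setdist_pos_le)
  moreover have "incseq (\<lambda>k. h k x)" for x
  proof (intro incseq_SucI)
    fix k
    have "real k * setdist {x} (- V) \<le> real (Suc k) * setdist {x} (- V)"
      by (intro mult_right_mono) (auto simp: setdist_pos_le)
    then show "h k x \<le> h (Suc k) x"
      unfolding h_def by (auto intro: min.mono)
  qed
  moreover have "h k x = 0" if "x \<notin> V" for k x
    using that by (auto simp: h_def setdist_sing_in_set)
  moreover have "\<exists>k. h k x = 1" if "x \<in> V" for x
  proof (cases "V = UNIV")
    case False
    have "setdist {x} (- V) > 0"
      using that False V by (subst setdist_gt_0_compact_closed) auto
    then obtain k where "real k * setdist {x} (- V) > 1"
      using reals_Archimedean3 by blast
    then show ?thesis by (auto simp: h_def intro!: exI[of _ k])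
  qed (auto simp: h_def)
  ultimately show ?thesis by (rule that)
qed

lemma SUP_indicator_approx:
  fixes h :: "nat \<Rightarrow> 'b \<Rightarrow> real"
  assumes "\<And>k x. h k x \<le> 1" "\<And>k x. x \<notin> V \<Longrightarrow> h k x = 0" "\<And>x. x \<in> V \<Longrightarrow> \<exists>k. h k x = 1"
  shows "(SUP k. ennreal (h k x)) = indicator V x"
proof (cases "x \<in> V")
  case False
  then show ?thesis using assms(2) by simp
next
  case True
  then obtain k where k: "h k x = 1" using assms(3) by blast
  have "(SUP k. ennreal (h k x)) = 1"
  proof (rule antisym)
    show "(SUP k. ennreal (h k x)) \<le> 1"
      using assms(1) by (intro SUP_least) (simp add: ennreal_le_1)
    show "1 \<le> (SUP k. ennreal (h k x))"
      using k by (metis SUP_upper UNIV_I ennreal_1)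
  qed
  then show ?thesis using True by simp
qed

lemma emeasure_SUP_approx:
  fixes h :: "nat \<Rightarrow> 'b::topological_space \<Rightarrow> real"
  assumes "sets K = sets borel" "V \<in> sets borel"
    and "\<And>k. continuous_on UNIV (h k)" "\<And>k x. h k x \<le> 1" "\<And>x. incseq (\<lambda>k. h k x)"
    "\<And>k x. x \<notin> V \<Longrightarrow> h k x = 0" "\<And>x. x \<in> V \<Longrightarrow> \<exists>k. h k x = 1"
  shows "emeasure K V = (SUP k. \<integral>\<^sup>+x. ennreal (h k x) \<partial>K)"
proof -
  have m: "(\<lambda>x. ennreal (h k x)) \<in> borel_measurable K" for k
    using borel_measurable_continuous_onI[OF assms(3)[of k]]
    by (simp cong: measurable_cong_sets add: assms)
  have "emeasure K V = (\<integral>\<^sup>+x. indicator V x \<partial>K)"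
    using assms by simp
  also have "\<dots> = (\<integral>\<^sup>+x. (SUP k. ennreal (h k x)) \<partial>K)"
    by (subst SUP_indicator_approx[where V=V]) (use assms in auto)
  also have "\<dots> = (SUP k. \<integral>\<^sup>+x. ennreal (h k x) \<partial>K)"
    using assms(5) by (intro nn_integral_monotone_convergence_SUP m)
      (auto simp: incseq_def le_fun_def ennreal_leI)
  finally show ?thesis .
qed

text \<open>Open sets form an intersection-stable generator, and the mass of an open set is the
  supremum of integrals of continuous functions below its indicator.\<close>

lemma measure_eqI_continuous:
  fixes M N :: "'b::metric_space measure"
  assumes sM: "sets M = sets borel" and sN: "sets N = sets borel"
    and fin: "emeasure M UNIV \<noteq> \<infinity>"
    and eq: "\<And>h :: 'b \<Rightarrow> real. continuous_on UNIV h \<Longrightarrow> (\<And>x. 0 \<le> h x) \<Longrightarrow> (\<And>x. h x \<le> 1) \<Longrightarrow>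
      (\<integral>\<^sup>+x. ennreal (h x) \<partial>M) = (\<integral>\<^sup>+x. ennreal (h x) \<partial>N)"
  shows "M = N"
proof (rule measure_eqI_generator_eq[where E="{S. open S}" and \<Omega>=UNIV and A="\<lambda>_. UNIV"])
  show "sets M = sigma_sets UNIV {S. open S}" "sets N = sigma_sets UNIV {S. open S}"
    using sM sN by (simp_all add: borel_def)
  fix V :: "'b set" assume "V \<in> {S. open S}"
  then have V: "open V" by simp
  obtain h :: "nat \<Rightarrow> 'b \<Rightarrow> real" where h: "\<And>k. continuous_on UNIV (h k)" "\<And>k x. 0 \<le> h k x"
    "\<And>k x. h k x \<le> 1" "\<And>x. incseq (\<lambda>k. h k x)" "\<And>k x. x \<notin> V \<Longrightarrow> h k x = 0"
    "\<And>x. x \<in> V \<Longrightarrow> \<exists>k. h k x = 1"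
    by (rule open_indicator_approx[OF V], rule that; assumption)
  have "emeasure K V = (SUP k. \<integral>\<^sup>+x. ennreal (h k x) \<partial>K)" if "sets K = sets borel" for K
    using that V h by (intro emeasure_SUP_approx) auto
  then show "emeasure M V = emeasure N V"
    using sM sN h eq by simp
qed (use fin in \<open>auto simp: Int_stable_def\<close>)

text \<open>Equality is checked for the images under \<open>e\<close> and then pulled back, since
  each measurable set is the preimage of a Borel set.\<close>

lemma measure_eqI_pulled_back:
  fixes e :: "'a \<Rightarrow> 'b::metric_space"
  assumes e: "pulled_back X e" and sM: "sets M = sets (borel_of X)" and sN: "sets N = sets (borel_of X)"
    and fin: "finite_measure M"
    and eq: "\<And>h :: 'b \<Rightarrow> real. continuous_on UNIV h \<Longrightarrow> (\<And>x. 0 \<le> h x) \<Longrightarrow> (\<And>x. h x \<le> 1) \<Longrightarrow>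
      (\<integral>\<^sup>+x. ennreal (h (e x)) \<partial>M) = (\<integral>\<^sup>+x. ennreal (h (e x)) \<partial>N)"
  shows "M = N"
proof -
  have eM: "e \<in> M \<rightarrow>\<^sub>M borel" and eN: "e \<in> N \<rightarrow>\<^sub>M borel"
    using measurable_pulled_back[OF e] sM sN by (auto cong: measurable_cong_sets)
  have "distr M borel e = distr N borel e"
  proof (rule measure_eqI_continuous)
    show "emeasure (distr M borel e) UNIV \<noteq> \<infinity>"
      using finite_measure.emeasure_finite[OF fin] eM by (auto simp: emeasure_distr)
    fix h :: "'b \<Rightarrow> real" assume h: "continuous_on UNIV h" "\<And>x. 0 \<le> h x" "\<And>x. h x \<le> 1"
    have "h \<in> borel_measurable borel"
      using h(1) by (rule borel_measurable_continuous_onI)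
    then have "(\<lambda>x. ennreal (h x)) \<in> borel_measurable borel"
      by simp
    then show "(\<integral>\<^sup>+x. ennreal (h x) \<partial>distr M borel e) = (\<integral>\<^sup>+x. ennreal (h x) \<partial>distr N borel e)"
      using eq[OF h] by (simp add: nn_integral_distr eM eN)
  qed auto
  moreover have sp: "space M = topspace X" "space N = topspace X"
    using sets_eq_imp_space_eq[OF sM] sets_eq_imp_space_eq[OF sN] by simp_all
  ultimately have *: "emeasure M (e -` B \<inter> topspace X) = emeasure N (e -` B \<inter> topspace X)" if "B \<in> sets borel" for B
    using that by (metis emeasure_distr eM eN)
  show ?thesis
  proof (rule measure_eqI)
    fix A assume "A \<in> sets M"
    then obtain B where "B \<in> sets borel" "A = e -` B \<inter> topspace X"
      unfolding sM borel_of_pulled_back[OF e] by (subst (asm) sets_vimage_algebra2) auto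
    then show "emeasure M A = emeasure N A"
      using * by simp
  qed (simp add: sM sN)
qed


section \<open>Kernels of Radon measures\<close>

abbreviation star_borel :: "(real ^ 'n) measure measure" where
  "star_borel \<equiv> borel_of star_topology"

abbreviation star_pair_borel :: "((real ^ 'n) measure \<times> (real ^ 'n)) measure" where
  "star_pair_borel \<equiv> borel_of star_pair_topology"

abbreviation square_pair_borel :: "((real ^ 'n) measure \<times> (real ^ 'n)) measure" where
  "square_pair_borel \<equiv> borel_of square_pair_topology"

lemma B1_eq_cbox: "B1 = cbox (\<chi> i. - 1) (\<chi> i. 1)"
  by (auto simp: B1_def mem_box_cart abs_le_iff minus_le_iff)

lemma compact_B1: "compact B1"
  unfolding B1_eq_cbox by simp

lemma B1_borel [measurable]: "B1 \<in> sets borel"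
  unfolding B1_eq_cbox by simp

lemma topspace_star: "topspace star_topology = {\<mu> \<in> radon. emeasure \<mu> B1 = 1}"
  by (auto simp: star_topology_def topspace_weak)

lemma topspace_square: "topspace square_topology = {\<mu> \<in> radon. emeasure \<mu> B1 = 1 \<and> emeasure \<mu> (- B1) = 0}"
  by (auto simp: square_topology_def topspace_weak)

lemma topspace_star_pair: "topspace star_pair_topology = topspace star_topology \<times> B1"
  by (simp add: star_pair_topology_def)

lemma topspace_square_pair: "topspace square_pair_topology = topspace square_topology \<times> B1"
  by (simp add: square_pair_topology_def)

abbreviation emb_pair :: "(real ^ 'n) measure \<times> (real ^ 'n) \<Rightarrow> (nat \<Rightarrow> real) \<times> (real ^ 'n)" where
  "emb_pair \<equiv> (\<lambda>(\<mu>, x). (emb \<mu>, x))"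

lemma pulled_back_star: "pulled_back star_topology emb"
  unfolding star_topology_def by (rule pulled_back_subtopology[OF pulled_back_weak])

lemma pulled_back_square: "pulled_back square_topology emb"
  unfolding square_topology_def by (rule pulled_back_subtopology[OF pulled_back_weak])

lemma pulled_back_star_pair: "pulled_back star_pair_topology emb_pair"
  unfolding star_pair_topology_def by (rule pulled_back_prod[OF pulled_back_star])

lemma pulled_back_square_pair: "pulled_back square_pair_topology emb_pair"
  unfolding square_pair_topology_def by (rule pulled_back_prod[OF pulled_back_square])

lemma radon_sets: "\<mu> \<in> radon \<Longrightarrow> sets \<mu> = sets borel"
  by (simp add: radon_def)

lemma radon_space: "\<mu> \<in> radon \<Longrightarrow> space \<mu> = UNIV"
  using sets_eq_imp_space_eq[of \<mu> borel] by (simp add: radon_def)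

lemma radon_finite: "\<mu> \<in> radon \<Longrightarrow> bounded A \<Longrightarrow> emeasure \<mu> A < \<infinity>"
proof -
  assume \<mu>: "\<mu> \<in> radon" and "bounded A"
  then have "emeasure \<mu> A \<le> emeasure \<mu> (closure A)"
    by (intro emeasure_mono closure_subset) (simp add: radon_sets)
  moreover have "emeasure \<mu> (closure A) < \<infinity>"
    using \<mu> \<open>bounded A\<close> by (simp add: radon_def)
  ultimately show "emeasure \<mu> A < \<infinity>"
    by (rule le_less_trans)
qed

text \<open>Total masses may be infinite, which rules out a description as a map into subprobability
  measures. Measurability is stated for open sets because this is what the weak topology yields
  directly; all Borel sets follow.\<close>

definition radon_kernel :: "'a measure \<Rightarrow> ('a \<Rightarrow> (real ^ 'n) measure) \<Rightarrow> bool" where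
  "radon_kernel M \<kappa> \<longleftrightarrow> (\<forall>x\<in>space M. \<kappa> x \<in> radon) \<and>
     (\<forall>A. open A \<longrightarrow> (\<lambda>x. emeasure (\<kappa> x) A) \<in> borel_measurable M)"

text \<open>Cut off to the ball of radius \<open>n\<close> and divided by \<open>1 + c n x\<close>,
  the kernel becomes a subprobability kernel, for which measurability of integrals is known.
  Multiplying back and letting \<open>n\<close> grow recovers the integral; the summand
  \<open>1\<close> prevents division by zero.\<close>

lemma radon_kernel_nn_integral:
  fixes \<kappa> :: "'a \<Rightarrow> (real ^ 'n) measure"
  assumes \<kappa>: "radon_kernel M \<kappa>" and F: "(\<lambda>(x, y). F x y) \<in> borel_measurable (M \<Otimes>\<^sub>M borel)"
  shows "(\<lambda>x. \<integral>\<^sup>+y. F x y \<partial>\<kappa> x) \<in> borel_measurable M"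
proof -
  have r: "\<kappa> x \<in> radon" if "x \<in> space M" for x
    using \<kappa> that by (simp add: radon_kernel_def)
  define c where "c n x = emeasure (\<kappa> x) (ball 0 (real n))" for n x
  have c[measurable]: "c n \<in> borel_measurable M" for n
    using \<kappa> by (simp add: c_def[abs_def] radon_kernel_def)
  have cf: "c n x < \<infinity>" if "x \<in> space M" for n x
    unfolding c_def by (rule radon_finite[OF r[OF that]]) simp
  define L where "L n x = scale_measure (1 / (1 + c n x)) (density (\<kappa> x) (indicator (ball 0 (real n))))" for n x
  have eL: "emeasure (L n x) A = 1 / (1 + c n x) * emeasure (\<kappa> x) (A \<inter> ball 0 (real n))"
    if "x \<in> space M" "A \<in> sets borel" for n x A
    using that r[OF that(1)] by (simp add: L_def emeasure_restricted radon_sets Int_commute)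
  have Lm: "L n \<in> M \<rightarrow>\<^sub>M subprob_algebra borel" for n
  proof (rule measurable_subprob_algebra_generated[where \<Omega>=UNIV and G="{S. open S}"])
    show "sets borel = sigma_sets UNIV {S. open S}"
      by (simp add: borel_def)
    fix x assume x: "x \<in> space M"
    show "sets (L n x) = sets borel"
      using r[OF x] by (simp add: L_def radon_sets)
    show "subprob_space (L n x)"
    proof (rule subprob_spaceI)
      have sp: "space (L n x) = UNIV"
        using r[OF x] by (simp add: L_def radon_space space_scale_measure)
      have "emeasure (L n x) UNIV = c n x / (1 + c n x)"
        by (subst eL) (auto simp: x c_def ennreal_divide_times)
      also have "\<dots> \<le> 1"
        using cf[OF x, of n] by (intro divide_le_posI_ennreal) (auto simp: add_pos_nonneg)
      finally show "emeasure (L n x) (space (L n x)) \<le> 1"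
        by (simp add: sp)
      show "space (L n x) \<noteq> {}" by (simp add: sp)
    qed
  next
    have "(\<lambda>x. emeasure (L n x) A) \<in> borel_measurable M" if "open A" for A
    proof -
      have "open (A \<inter> ball 0 (real n))" using that by auto
      then have [measurable]: "(\<lambda>x. emeasure (\<kappa> x) (A \<inter> ball 0 (real n))) \<in> borel_measurable M"
        using \<kappa> by (simp add: radon_kernel_def)
      have "(\<lambda>x. 1 / (1 + c n x) * emeasure (\<kappa> x) (A \<inter> ball 0 (real n))) \<in> borel_measurable M"
        by measurable
      then show ?thesis
        using that by (subst measurable_cong[OF eL]) auto
    qed
    then show "(\<lambda>a. emeasure (L n a) UNIV) \<in> borel_measurable M"
      "A \<in> {S. open S} \<Longrightarrow> (\<lambda>a. emeasure (L n a) A) \<in> borel_measurable M" for A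
      by auto
  qed (auto simp: Int_stable_def)
  have "(\<lambda>x. SUP n. (1 + c n x) * (\<integral>\<^sup>+y. F x y \<partial>L n x)) \<in> borel_measurable M"
    using nn_integral_measurable_subprob_algebra2[OF F Lm] by measurable
  also have "(\<lambda>x. SUP n. (1 + c n x) * (\<integral>\<^sup>+y. F x y \<partial>L n x)) \<in> borel_measurable M \<longleftrightarrow> ?thesis"
  proof (rule measurable_cong)
    fix x assume x: "x \<in> space M"
    note [measurable_cong] = radon_sets[OF r[OF x]]
    have Fx[measurable]: "F x \<in> borel_measurable borel"
      using F x by measurable
    have "(1 + c n x) * (\<integral>\<^sup>+y. F x y \<partial>L n x) = (\<integral>\<^sup>+y. F x y * indicator (ball 0 (real n)) y \<partial>\<kappa> x)" for n
    proof -
      have "(\<integral>\<^sup>+y. F x y \<partial>L n x) = 1 / (1 + c n x) * (\<integral>\<^sup>+y. F x y * indicator (ball 0 (real n)) y \<partial>\<kappa> x)"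
      proof -
        have [measurable]: "ball (0 :: real ^ 'n) (real n) \<in> sets borel"
          by simp
        have 1: "F x \<in> borel_measurable (density (\<kappa> x) (indicator (ball 0 (real n))))"
          by measurable
        have 2: "F x \<in> borel_measurable (\<kappa> x)" "indicator (ball 0 (real n)) \<in> borel_measurable (\<kappa> x)"
          by measurable
        show ?thesis
          unfolding L_def nn_integral_scale_measure[OF 1] nn_integral_density[OF 2(2,1)]
          by (simp add: mult.commute)
      qed
      moreover have "(1 + c n x) * (1 / (1 + c n x)) = 1"
        using cf[OF x, of n] by (auto simp: ennreal_times_divide intro!: ennreal_divide_self)
      ultimately show ?thesis
        by (simp add: mult.assoc[symmetric])
    qed
    then have "(SUP n. (1 + c n x) * (\<integral>\<^sup>+y. F x y \<partial>L n x)) =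
        (SUP n. \<integral>\<^sup>+y. F x y * indicator (ball 0 (real n)) y \<partial>\<kappa> x)"
      by simp
    also have "\<dots> = (\<integral>\<^sup>+y. (SUP n. F x y * indicator (ball 0 (real n)) y) \<partial>\<kappa> x)"
    proof (rule nn_integral_monotone_convergence_SUP[symmetric])
      show "incseq (\<lambda>n y. F x y * indicator (ball 0 (real n)) y)"
        by (auto simp: incseq_def le_fun_def intro!: mult_left_mono split: split_indicator)
      have [measurable]: "ball (0 :: real ^ 'n) (real n) \<in> sets borel" for n
        by simp
      show "(\<lambda>y. F x y * indicator (ball 0 (real n)) y) \<in> borel_measurable (\<kappa> x)" for n
        by measurable
    qed
    also have "\<dots> = (\<integral>\<^sup>+y. F x y \<partial>\<kappa> x)"
    proof (rule nn_integral_cong)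
      fix y :: "real ^ 'n"
      obtain n :: nat where "norm y < real n"
        using reals_Archimedean2 by blast
      then have "F x y \<le> (SUP n. F x y * indicator (ball 0 (real n)) y)"
        by (intro SUP_upper2[of n]) auto
      moreover have "(SUP n. F x y * indicator (ball 0 (real n)) y) \<le> F x y"
        by (intro SUP_least) (auto split: split_indicator)
      ultimately show "(SUP n. F x y * indicator (ball 0 (real n)) y) = F x y"
        by (rule antisym[rotated])
    qed
    finally show "(SUP n. (1 + c n x) * (\<integral>\<^sup>+y. F x y \<partial>L n x)) = (\<integral>\<^sup>+y. F x y \<partial>\<kappa> x)" .
  qed
  finally show ?thesis .
qed

lemma radon_kernel_emeasure:
  assumes "radon_kernel M \<kappa>" and A: "{p \<in> space M \<times> UNIV. P (fst p) (snd p)} \<in> sets (M \<Otimes>\<^sub>M borel)"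
  shows "(\<lambda>x. emeasure (\<kappa> x) {y. P x y}) \<in> borel_measurable M"
proof -
  let ?S = "{p \<in> space M \<times> UNIV. P (fst p) (snd p)}"
  have "(\<lambda>(x, y). indicator ?S (x, y) :: ennreal) \<in> borel_measurable (M \<Otimes>\<^sub>M borel)"
    using A by simp
  then have "(\<lambda>x. \<integral>\<^sup>+y. indicator ?S (x, y) \<partial>\<kappa> x) \<in> borel_measurable M"
    by (rule radon_kernel_nn_integral[OF assms(1), of "\<lambda>x y. indicator ?S (x, y)"])
  also have "?this \<longleftrightarrow> ?thesis"
  proof (rule measurable_cong)
    fix x assume x: "x \<in> space M"
    have "{y. P x y} = Pair x -` ?S"
      using x by auto
    also have "\<dots> \<in> sets borel"
      by (rule sets_Pair1[OF A])
    finally have "{y. P x y} \<in> sets (\<kappa> x)"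
      using assms(1) x by (simp add: radon_kernel_def radon_sets)
    then have "emeasure (\<kappa> x) {y. P x y} = (\<integral>\<^sup>+y. indicator {y. P x y} y \<partial>\<kappa> x)"
      by simp
    also have "\<dots> = (\<integral>\<^sup>+y. indicator ?S (x, y) \<partial>\<kappa> x)"
      using x by (intro nn_integral_cong) (auto split: split_indicator)
    finally show "(\<integral>\<^sup>+y. indicator ?S (x, y) \<partial>\<kappa> x) = emeasure (\<kappa> x) {y. P x y}" ..
  qed
  finally show ?thesis .
qed

lemma radon_kernel_emeasure_const:
  assumes "radon_kernel M \<kappa>" and A: "A \<in> sets borel"
  shows "(\<lambda>x. emeasure (\<kappa> x) A) \<in> borel_measurable M"
proof -
  have "{p \<in> space M \<times> UNIV. snd p \<in> A} = space M \<times> A"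
    by auto
  then show ?thesis
    using radon_kernel_emeasure[OF assms(1), of "\<lambda>x y. y \<in> A"] A by simp
qed

text \<open>By monotone convergence the mass of an open set is a supremum of integrals of compactly
  supported continuous functions, each of which is continuous in the weak topology.\<close>

lemma emeasure_open_weak_measurable:
  fixes A :: "(real ^ 'n) set"
  assumes A: "open A"
  shows "(\<lambda>\<mu>. emeasure \<mu> A) \<in> borel_measurable star_borel"
proof -
  obtain h :: "nat \<Rightarrow> real ^ 'n \<Rightarrow> real" where h: "\<And>k. continuous_on UNIV (h k)" "\<And>k x. 0 \<le> h k x"
    "\<And>k x. h k x \<le> 1" "\<And>x. incseq (\<lambda>k. h k x)" "\<And>k x. x \<notin> A \<Longrightarrow> h k x = 0"
    "\<And>x. x \<in> A \<Longrightarrow> \<exists>k. h k x = 1"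
    by (rule open_indicator_approx[OF A], rule that; assumption)
  define g where "g k x = cutoff k x * h k x" for k x
  have gC: "g k \<in> Cc" for k
  proof (rule Cc_I[of _ "real k + 1"])
    show "continuous_on UNIV (g k)"
      unfolding g_def cutoff_def by (intro continuous_intros h)
    show "norm x \<le> real k + 1" if "g k x \<noteq> 0" for x
      using that cutoff_eq_0[of k x] by (cases "norm x \<le> real k + 1") (auto simp: g_def)
  qed
  have g0: "0 \<le> g k x" for k x
    by (simp add: g_def cutoff_nonneg h)
  have "emeasure \<mu> A = (SUP k. ennreal (\<integral>x. g k x \<partial>\<mu>))" if \<mu>: "\<mu> \<in> radon" for \<mu>
  proof -
    have "emeasure \<mu> A = (SUP k. \<integral>\<^sup>+x. ennreal (g k x) \<partial>\<mu>)"
    proof (rule emeasure_SUP_approx)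
      show "continuous_on UNIV (g k)" for k
        using gC[of k] by (simp add: Cc_def)
      show "g k x \<le> 1" for k x
        by (simp add: g_def mult_le_one cutoff_le_1 h)
      show "incseq (\<lambda>k. g k x)" for x
        unfolding g_def using h(4)[of x]
        by (auto simp: incseq_def cutoff_nonneg h intro!: mult_mono) (auto simp: cutoff_def)
      show "\<exists>k. g k x = 1" if x: "x \<in> A" for x
      proof -
        obtain k where k: "h k x = 1" using h(6)[OF x] by blast
        obtain n :: nat where n: "norm x \<le> real n" using real_arch_simple by blast
        have "h (max k n) x = 1"
          using k h(3)[of "max k n" x] incseqD[OF h(4), of k "max k n" x] by simp
        moreover have "cutoff (max k n) x = 1"
          using n by (intro cutoff_eq_1) auto
        ultimately show ?thesis
          by (intro exI[of _ "max k n"]) (simp add: g_def)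
      qed
    qed (use \<mu> A h in \<open>auto simp: radon_sets g_def\<close>)
    also have "\<dots> = (SUP k. ennreal (\<integral>x. g k x \<partial>\<mu>))"
      using Cc_integrable[OF gC \<mu>] g0 by (subst nn_integral_eq_integral) auto
    finally show ?thesis .
  qed
  moreover have "(\<lambda>\<mu>. \<integral>x. g k x \<partial>\<mu>) \<in> borel_measurable star_borel" for k
  proof (rule borel_measurableI)
    fix S :: "real set" assume S: "open S"
    have "openin weak_topology {\<mu> \<in> radon. (\<integral>x. g k x \<partial>\<mu>) \<in> S}"
      unfolding weak_topology_def using gC[of k] S by (intro topology_generated_by_Basis) blast
    then have "openin star_topology ({\<mu> \<in> radon. (\<integral>x. g k x \<partial>\<mu>) \<in> S} \<inter> {\<mu>. emeasure \<mu> B1 = 1})"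
      unfolding star_topology_def by (auto simp: openin_subtopology)
    also have "{\<mu> \<in> radon. (\<integral>x. g k x \<partial>\<mu>) \<in> S} \<inter> {\<mu>. emeasure \<mu> B1 = 1} =
        (\<lambda>\<mu>. \<integral>x. g k x \<partial>\<mu>) -` S \<inter> space star_borel"
      by (auto simp: topspace_star)
    finally show "(\<lambda>\<mu>. \<integral>x. g k x \<partial>\<mu>) -` S \<inter> space star_borel \<in> sets star_borel"
      unfolding borel_of_def by (intro in_measure_of) (auto dest: openin_subset)
  qed
  ultimately show ?thesis
    by (subst measurable_cong[of _ _ "\<lambda>\<mu>. SUP k. ennreal (\<integral>x. g k x \<partial>\<mu>)"]) (auto simp: topspace_star)
qed

lemma radon_kernel_measurable:
  fixes \<kappa> :: "'a \<Rightarrow> (real ^ 'n) measure"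
  assumes "\<kappa> \<in> M \<rightarrow>\<^sub>M star_borel"
  shows "radon_kernel M \<kappa>"
  unfolding radon_kernel_def
proof (intro conjI ballI allI impI)
  fix x assume "x \<in> space M"
  then show "\<kappa> x \<in> radon"
    using measurable_space[OF assms] by (auto simp: topspace_star)
next
  fix A :: "(real ^ 'n) set" assume "open A"
  then show "(\<lambda>x. emeasure (\<kappa> x) A) \<in> borel_measurable M"
    by (rule measurable_compose[OF assms emeasure_open_weak_measurable])
qed

text \<open>The coordinates of \<open>emb\<close> are integrals of test functions against the
  kernel. Together with \<open>radon_kernel_measurable\<close> this makes measurability into
  \<open>star_borel\<close> and the kernel property interchangeable for normalised measures.\<close>

lemma measurable_star_borelI:
  fixes \<kappa> :: "'a \<Rightarrow> (real ^ 'n) measure"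
  assumes \<kappa>: "radon_kernel M \<kappa>" and 1: "\<And>x. x \<in> space M \<Longrightarrow> emeasure (\<kappa> x) B1 = 1"
  shows "\<kappa> \<in> M \<rightarrow>\<^sub>M star_borel"
proof (rule measurable_into_pulled_back[OF pulled_back_star])
  have r: "\<kappa> x \<in> radon" if "x \<in> space M" for x
    using \<kappa> that by (simp add: radon_kernel_def)
  then show "\<kappa> \<in> space M \<rightarrow> topspace star_topology"
    using 1 by (auto simp: topspace_star)
  show "(\<lambda>x. emb (\<kappa> x)) \<in> M \<rightarrow>\<^sub>M borel"
  proof (rule measurable_coordinatewise_then_product)
    fix k
    have nn: "(\<lambda>x. \<integral>\<^sup>+y. ennreal (f y) \<partial>\<kappa> x) \<in> borel_measurable M" if "f \<in> borel_measurable borel" for f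
    proof (intro radon_kernel_nn_integral[OF \<kappa>])
      note that[measurable]
      show "(\<lambda>(x, y). ennreal (f y)) \<in> borel_measurable (M \<Otimes>\<^sub>M borel)"
        by measurable
    qed
    have "(\<lambda>x. enn2real (\<integral>\<^sup>+y. ennreal (test_seq k y) \<partial>\<kappa> x)
        - enn2real (\<integral>\<^sup>+y. ennreal (- test_seq k y) \<partial>\<kappa> x)) \<in> borel_measurable M"
    proof -
      have "test_seq k \<in> borel_measurable borel" "(\<lambda>y. - test_seq k y) \<in> borel_measurable borel"
        using Cc_borel[OF test_seq_Cc[of k]] by auto
      note nn[OF this(1), measurable] nn[OF this(2), measurable]
      show ?thesis by measurable
    qed
    also have "?this \<longleftrightarrow> (\<lambda>x. emb (\<kappa> x) k) \<in> borel_measurable M"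
      by (rule measurable_cong)
        (simp add: emb_def real_lebesgue_integral_def[OF Cc_integrable[OF test_seq_Cc r]])
    finally show "(\<lambda>x. emb (\<kappa> x) k) \<in> borel_measurable M" .
  qed
qed

section \<open>Affine images of measures\<close>

definition amap :: "real \<Rightarrow> real ^ 'n \<Rightarrow> real ^ 'n \<Rightarrow> real ^ 'n" where
  "amap a z y = a *\<^sub>R (y - z)"

definition aff :: "real \<Rightarrow> real ^ 'n \<Rightarrow> (real ^ 'n) measure \<Rightarrow> (real ^ 'n) measure" where
  "aff a z \<mu> = star (distr \<mu> borel (amap a z))"

text \<open>If \<open>\<mu>\<close> is not charged, then \<^const>\<open>aff\<close> divides by \<open>0\<close> and its value is meaningless.\<close>

definition charged :: "real \<Rightarrow> real ^ 'n \<Rightarrow> (real ^ 'n) measure \<Rightarrow> bool" where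
  "charged a z \<mu> \<longleftrightarrow> emeasure \<mu> (amap a z -` B1) > 0"

lemma amap_borel [measurable]: "amap a z \<in> borel_measurable borel"
  unfolding amap_def[abs_def] by measurable

lemma borel_measurable_amap [measurable (raw)]:
  fixes z y :: "'a \<Rightarrow> real ^ 'n"
  assumes "a \<in> borel_measurable M" "z \<in> borel_measurable M" "y \<in> borel_measurable M"
  shows "(\<lambda>x. amap (a x) (z x) (y x)) \<in> borel_measurable M"
  unfolding amap_def using assms by measurable

lemma translate_star_eq_aff: "translate_star x \<mu> = aff 1 x \<mu>"
  by (simp add: translate_star_def aff_def amap_def[abs_def])

lemma scale_star_eq_aff: "scale_star t \<mu> = aff (exp t) 0 \<mu>"
  by (simp add: scale_star_def aff_def amap_def[abs_def])

lemma vimage_amap: "a \<noteq> 0 \<Longrightarrow> amap a z -` A = (\<lambda>y. z + (1 / a) *\<^sub>R y) ` A"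
  by (auto simp: amap_def image_iff intro!: bexI[of _ "amap a z _"])

lemma compact_vimage_amap: "a \<noteq> 0 \<Longrightarrow> compact K \<Longrightarrow> compact (amap a z -` K)"
  unfolding vimage_amap by (intro compact_continuous_image continuous_intros) auto

lemma radon_distr_amap:
  assumes "\<mu> \<in> radon" "a \<noteq> 0"
  shows "distr \<mu> borel (amap a z) \<in> radon"
  using assms compact_vimage_amap[OF assms(2)]
  by (auto simp: radon_def emeasure_distr compact_imp_closed radon_space[OF assms(1)]
      sets_eq_imp_space_eq[of \<mu> borel] cong: measurable_cong_sets)

lemma emeasure_distr_amap:
  assumes "\<mu> \<in> radon" "A \<in> sets borel"
  shows "emeasure (distr \<mu> borel (amap a z)) A = emeasure \<mu> (amap a z -` A)"
  using assms by (subst emeasure_distr) (auto simp: radon_space radon_sets cong: measurable_cong_sets)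

lemma emeasure_aff:
  assumes "\<mu> \<in> radon" "A \<in> sets borel"
  shows "emeasure (aff a z \<mu>) A = 1 / emeasure \<mu> (amap a z -` B1) * emeasure \<mu> (amap a z -` A)"
  using assms by (simp add: aff_def star_def emeasure_distr_amap)

lemma emeasure_vimage_B1_finite:
  "\<mu> \<in> radon \<Longrightarrow> a \<noteq> 0 \<Longrightarrow> emeasure \<mu> (amap a z -` B1) < \<infinity>"
  by (rule radon_finite) (auto intro!: compact_imp_bounded compact_vimage_amap compact_B1)

lemma star_in_star:
  assumes "\<mu> \<in> radon" "emeasure \<mu> B1 > 0"
  shows "star \<mu> \<in> topspace star_topology"
proof -
  have "emeasure \<mu> B1 < \<infinity>"
    by (rule radon_finite[OF assms(1)]) (simp add: compact_imp_bounded compact_B1)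
  then have "1 / emeasure \<mu> B1 * emeasure \<mu> B1 = 1" "1 / emeasure \<mu> B1 < \<infinity>"
    using assms(2) by (auto simp: ennreal_divide_times intro!: ennreal_divide_self)
      (metis divide_less_0_iff ennreal_divide_eq_top_iff ennreal_one_neq_top less_irrefl top.not_eq_extremum)
  then show ?thesis
    using assms(1) by (auto simp: topspace_star star_def radon_def ennreal_mult_less_top)
qed

lemma sets_aff: "sets (aff a z \<mu>) = sets borel"
  by (simp add: aff_def star_def)

lemma aff_in_star:
  assumes "\<mu> \<in> radon" "a \<noteq> 0" "charged a z \<mu>"
  shows "aff a z \<mu> \<in> topspace star_topology"
  unfolding aff_def using assms
  by (intro star_in_star radon_distr_amap) (auto simp: charged_def emeasure_distr_amap)

lemma nn_integral_aff:
  assumes "\<mu> \<in> radon" "f \<in> borel_measurable borel"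
  shows "(\<integral>\<^sup>+y. f y \<partial>aff a z \<mu>) = 1 / emeasure \<mu> (amap a z -` B1) * (\<integral>\<^sup>+y. f (amap a z y) \<partial>\<mu>)"
proof -
  note [measurable_cong] = radon_sets[OF assms(1)]
  show ?thesis
    unfolding aff_def star_def using assms
    by (simp add: nn_integral_scale_measure nn_integral_distr emeasure_distr_amap)
qed

lemma star_scale_measure:
  assumes "c \<noteq> 0" "c \<noteq> \<infinity>"
  shows "star (scale_measure c \<mu>) = star \<mu>"
proof -
  have "1 / (c * m) * c = 1 / m" for m :: ennreal
  proof -
    have "1 / (c * m) * c = inverse (c * m) * c"
      by (simp add: divide_ennreal_def)
    also have "inverse (c * m) = inverse c * inverse m"
      using assms by (intro ennreal_inverse_mult') (auto simp: zero_less_iff_neq_zero less_top)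
    also have "inverse c * inverse m * c = (c * inverse c) * inverse m"
      by (simp add: ac_simps)
    also have "c * inverse c = 1"
      using assms ennreal_divide_self[of c] by (simp add: divide_ennreal_def less_top)
    also have "1 * inverse m = 1 / m"
      by (simp add: divide_ennreal_def)
    finally show ?thesis .
  qed
  then show ?thesis
    by (simp add: star_def)
qed

lemma distr_scale_measure:
  assumes "f \<in> M \<rightarrow>\<^sub>M N"
  shows "distr (scale_measure c M) N f = scale_measure c (distr M N f)"
  using assms by (intro measure_eqI) (auto simp: emeasure_distr space_scale_measure)

lemma amap_amap: "a' \<noteq> 0 \<Longrightarrow> amap a z (amap a' z' y) = amap (a * a') (z' + (1 / a') *\<^sub>R z) y"
  by (simp add: amap_def algebra_simps)

lemma amap_star_pos:
  assumes "\<mu> \<in> radon" "a \<noteq> 0" "charged a z \<mu>"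
  shows "1 / emeasure \<mu> (amap a z -` B1) \<noteq> 0" "1 / emeasure \<mu> (amap a z -` B1) \<noteq> \<infinity>"
  using assms emeasure_vimage_B1_finite[OF assms(1,2), of z]
  by (auto simp: charged_def ennreal_divide_eq_0_iff ennreal_divide_eq_top_iff)

text \<open>The inner normalisation multiplies by a constant that the outer one removes. Chargedness
  keeps this constant finite, and the Radon property keeps it nonzero.\<close>

lemma aff_aff:
  assumes "\<mu> \<in> radon" "a' \<noteq> 0" "charged a' z' \<mu>"
  shows "aff a z (aff a' z' \<mu>) = aff (a * a') (z' + (1 / a') *\<^sub>R z) \<mu>"
proof -
  note [measurable_cong] = radon_sets[OF assms(1)]
  let ?c = "1 / emeasure \<mu> (amap a' z' -` B1)"
  have "distr (aff a' z' \<mu>) borel (amap a z) =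
      scale_measure ?c (distr (distr \<mu> borel (amap a' z')) borel (amap a z))"
    unfolding aff_def star_def using assms(1)
    by (subst distr_scale_measure) (auto simp: emeasure_distr_amap)
  also have "distr (distr \<mu> borel (amap a' z')) borel (amap a z) =
      distr \<mu> borel (amap (a * a') (z' + (1 / a') *\<^sub>R z))"
    by (subst distr_distr) (auto simp: comp_def amap_amap assms(2) cong: measurable_cong_sets)
  finally show ?thesis
    unfolding aff_def using star_scale_measure[OF amap_star_pos[OF assms]] by simp
qed

lemma charged_aff:
  assumes "\<mu> \<in> radon" "a' \<noteq> 0" "charged a' z' \<mu>"
  shows "charged a z (aff a' z' \<mu>) \<longleftrightarrow> charged (a * a') (z' + (1 / a') *\<^sub>R z) \<mu>"
proof -
  have "amap a z -` B1 \<in> sets borel"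
    using measurable_sets[OF amap_borel B1_borel] by simp
  moreover have "amap a' z' -` amap a z -` B1 = amap (a * a') (z' + (1 / a') *\<^sub>R z) -` B1"
    using assms(2) by (auto simp: amap_amap)
  ultimately show ?thesis
    using amap_star_pos[OF assms] assms(1) unfolding charged_def
    by (simp add: emeasure_aff zero_less_iff_neq_zero)
qed

lemma radon_kernel_distr_amap:
  fixes \<kappa> :: "'a \<Rightarrow> (real ^ 'n) measure"
  assumes \<kappa>: "radon_kernel M \<kappa>" and a[measurable]: "a \<in> borel_measurable M" and z[measurable]: "z \<in> borel_measurable M"
    and a0: "\<And>x. x \<in> space M \<Longrightarrow> a x \<noteq> 0"
  shows "radon_kernel M (\<lambda>x. distr (\<kappa> x) borel (amap (a x) (z x)))"
  unfolding radon_kernel_def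
proof (intro conjI ballI allI impI)
  fix x assume x: "x \<in> space M"
  then show "distr (\<kappa> x) borel (amap (a x) (z x)) \<in> radon"
    using \<kappa> a0 by (auto simp: radon_kernel_def intro: radon_distr_amap)
next
  fix A :: "(real ^ 'n) set" assume "open A"
  then have [measurable]: "A \<in> sets borel" by simp
  have "{p \<in> space (M \<Otimes>\<^sub>M borel). amap (a (fst p)) (z (fst p)) (snd p) \<in> A} \<in> sets (M \<Otimes>\<^sub>M borel)"
    by measurable
  then have "(\<lambda>x. emeasure (\<kappa> x) {y. amap (a x) (z x) y \<in> A}) \<in> borel_measurable M"
    by (intro radon_kernel_emeasure[OF \<kappa>]) (simp add: space_pair_measure)
  also have "?this \<longleftrightarrow> (\<lambda>x. emeasure (distr (\<kappa> x) borel (amap (a x) (z x))) A) \<in> borel_measurable M"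
    using \<kappa> by (intro measurable_cong) (simp add: emeasure_distr_amap radon_kernel_def vimage_def)
  finally show "(\<lambda>x. emeasure (distr (\<kappa> x) borel (amap (a x) (z x))) A) \<in> borel_measurable M" .
qed

lemma measurable_star:
  fixes \<kappa> :: "'a \<Rightarrow> (real ^ 'n) measure"
  assumes \<kappa>: "radon_kernel M \<kappa>" and pos: "\<And>x. x \<in> space M \<Longrightarrow> emeasure (\<kappa> x) B1 > 0"
  shows "(\<lambda>x. star (\<kappa> x)) \<in> M \<rightarrow>\<^sub>M star_borel"
proof (rule measurable_star_borelI)
  have *: "star (\<kappa> x) \<in> topspace star_topology" if "x \<in> space M" for x
    using \<kappa> pos that by (intro star_in_star) (auto simp: radon_kernel_def)
  then show "emeasure (star (\<kappa> x)) B1 = 1" if "x \<in> space M" for x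
    using that by (auto simp: topspace_star)
  have e[measurable]: "(\<lambda>x. emeasure (\<kappa> x) A) \<in> borel_measurable M" if "A \<in> sets borel" for A
    by (rule radon_kernel_emeasure_const[OF \<kappa> that])
  show "radon_kernel M (\<lambda>x. star (\<kappa> x))"
    unfolding radon_kernel_def
  proof (intro conjI ballI allI impI)
    fix A :: "(real ^ 'n) set" assume "open A"
    then have [measurable]: "A \<in> sets borel" by simp
    have "(\<lambda>x. 1 / emeasure (\<kappa> x) B1 * emeasure (\<kappa> x) A) \<in> borel_measurable M"
      by measurable
    then show "(\<lambda>x. emeasure (star (\<kappa> x)) A) \<in> borel_measurable M"
      by (simp add: star_def)
  qed (use * in \<open>auto simp: topspace_star\<close>)
qed

lemma measurable_aff:
  assumes \<kappa>: "radon_kernel M \<kappa>" and a: "a \<in> borel_measurable M" and z: "z \<in> borel_measurable M"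
    and a0: "\<And>x. x \<in> space M \<Longrightarrow> a x \<noteq> 0"
    and ch: "\<And>x. x \<in> space M \<Longrightarrow> charged (a x) (z x) (\<kappa> x)"
  shows "(\<lambda>x. aff (a x) (z x) (\<kappa> x)) \<in> M \<rightarrow>\<^sub>M star_borel"
  unfolding aff_def
proof (rule measurable_star)
  fix x assume "x \<in> space M"
  then show "emeasure (distr (\<kappa> x) borel (amap (a x) (z x))) B1 > 0"
    using \<kappa> ch by (simp add: emeasure_distr_amap charged_def radon_kernel_def)
qed (rule radon_kernel_distr_amap[OF \<kappa> a z a0])


section \<open>Supports\<close>

lemma vimage_amap_borel [measurable]: "A \<in> sets borel \<Longrightarrow> amap a z -` A \<in> sets borel"
  using measurable_sets[OF amap_borel, of A a z] by simp

lemma continuous_on_amap: "continuous_on S (amap a z)"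
  unfolding amap_def[abs_def] by (intro continuous_intros)

lemma open_vimage_amap: "open A \<Longrightarrow> open (amap a z -` A)"
  using continuous_on_open_vimage[OF open_UNIV, of "amap a z"] continuous_on_amap by fastforce

lemma charged_msupp:
  assumes "\<mu> \<in> radon" "z \<in> msupp \<mu>"
  shows "charged a z \<mu>"
proof -
  let ?V = "amap a z -` (box (\<chi> i. - 1) (\<chi> i. 1))"
  have "open ?V"
    by (rule open_vimage_amap[OF open_box])
  moreover have "z \<in> ?V"
    by (auto simp: amap_def mem_box_cart)
  ultimately have "0 < emeasure \<mu> ?V"
    using assms(2) by (auto simp: msupp_def)
  also have "?V \<subseteq> amap a z -` B1"
    unfolding B1_eq_cbox using box_subset_cbox by blast
  then have "emeasure \<mu> ?V \<le> emeasure \<mu> (amap a z -` B1)"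
    by (intro emeasure_mono) (auto simp: radon_sets[OF assms(1)])
  finally show ?thesis
    by (simp add: charged_def)
qed

lemma small_cube:
  assumes "open U" "x \<in> U"
  obtains k :: nat where "amap (real k + 1) x -` B1 \<subseteq> (U :: (real ^ 'n) set)"
proof -
  obtain d where d: "d > 0" "ball x d \<subseteq> U"
    using assms open_contains_ball by blast
  \<comment> \<open>The cube is measured coordinatewise and the ball in the Euclidean norm; the
    dimension comes from bounding that norm by the sum of the coordinates.\<close>
  obtain k :: nat where "real CARD('n) / d < real k"
    using reals_Archimedean2 by blast
  then have k: "real CARD('n) < d * (real k + 1)"
    using d(1) by (simp add: field_simps)
  have "amap (real k + 1) x -` B1 \<subseteq> U"
  proof
    fix y assume "y \<in> amap (real k + 1) x -` B1"
    then have "\<bar>(real k + 1) * (y - x) $ i\<bar> \<le> 1" for i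
      by (simp only: amap_def B1_def vimage_eq mem_Collect_eq vector_scaleR_component real_scaleR_def)
    moreover have "\<bar>(real k + 1) * (y - x) $ i\<bar> = (real k + 1) * \<bar>(y - x) $ i\<bar>" for i
      by (simp add: abs_mult)
    ultimately have *: "\<bar>(y - x) $ i\<bar> \<le> 1 / (real k + 1)" for i
      by (metis (no_types, lifting) add.commute le_divide_eq mult.commute of_nat_0_le_iff add_pos_nonneg zero_less_one)
    have "norm (y - x) \<le> (\<Sum>i\<in>UNIV. \<bar>(y - x) $ i\<bar>)"
      by (rule norm_le_l1_cart)
    also have "\<dots> \<le> (\<Sum>i\<in>(UNIV :: 'n set). 1 / (real k + 1))"
      by (rule sum_mono) (use * in auto)
    also have "\<dots> < d"
      using k by (simp add: field_simps)
    finally show "y \<in> U"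
      using d(2) by (auto simp: dist_norm norm_minus_commute)
  qed
  then show ?thesis by (rule that)
qed

text \<open>Cubes of shrinking side form a neighbourhood base, so membership in the support is a
  countable condition. Its measurability rests on this.\<close>

lemma msupp_iff_charged:
  assumes "\<mu> \<in> radon"
  shows "x \<in> msupp \<mu> \<longleftrightarrow> (\<forall>k::nat. charged (real k + 1) x \<mu>)"
proof
  assume "\<forall>k::nat. charged (real k + 1) x \<mu>"
  show "x \<in> msupp \<mu>"
    unfolding msupp_def
  proof (intro CollectI allI impI)
    fix U assume U: "open U \<and> x \<in> U"
    then obtain k where k: "amap (real k + 1) x -` B1 \<subseteq> U"
      using small_cube by blast
    have "0 < emeasure \<mu> (amap (real k + 1) x -` B1)"
      using \<open>\<forall>k::nat. charged (real k + 1) x \<mu>\<close> by (auto simp: charged_def)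
    also have "\<dots> \<le> emeasure \<mu> U"
      using k U by (intro emeasure_mono) (auto simp: radon_sets[OF assms])
    finally show "0 < emeasure \<mu> U" .
  qed
qed (use charged_msupp[OF assms] in auto)

text \<open>The complement of the support is the union of all open null sets, and countably many of
  them suffice.\<close>

lemma AE_msupp:
  assumes \<mu>: "\<mu> \<in> radon"
  shows "AE x in \<mu>. x \<in> msupp \<mu>"
proof -
  let ?F = "{U. open U \<and> emeasure \<mu> U = 0}"
  obtain F' where F': "F' \<subseteq> ?F" "countable F'" "\<Union>F' = \<Union>?F"
    by (rule Lindelof[of ?F]) auto
  have "\<Union>F' \<in> null_sets \<mu>"
    using F' by (intro null_sets_UN'[of F' "\<lambda>U. U", simplified]) (auto simp: null_sets_def radon_sets[OF \<mu>])
  moreover have "{x \<in> space \<mu>. \<not> x \<in> msupp \<mu>} \<subseteq> \<Union>F'"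
    unfolding F'(3) by (auto simp: msupp_def zero_less_iff_neq_zero)
  ultimately show ?thesis
    by (rule AE_I')
qed

lemma msupp_aff:
  assumes \<mu>: "\<mu> \<in> radon" and a: "a \<noteq> 0" and ch: "charged a z \<mu>"
  shows "w \<in> msupp (aff a z \<mu>) \<longleftrightarrow> z + (1 / a) *\<^sub>R w \<in> msupp \<mu>"
proof -
  have pos: "0 < emeasure (aff a z \<mu>) U \<longleftrightarrow> 0 < emeasure \<mu> (amap a z -` U)" if "open U" for U
    using amap_star_pos[OF assms] that by (simp add: emeasure_aff[OF \<mu>] zero_less_iff_neq_zero)
  show ?thesis
  proof
    assume w: "w \<in> msupp (aff a z \<mu>)"
    show "z + (1 / a) *\<^sub>R w \<in> msupp \<mu>"
      unfolding msupp_def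
    proof (intro CollectI allI impI)
      fix V assume V: "open V \<and> z + (1 / a) *\<^sub>R w \<in> V"
      let ?U = "(\<lambda>w. z + (1 / a) *\<^sub>R w) -` V"
      have "open ?U"
        using V by (intro open_vimage continuous_intros) auto
      then have "0 < emeasure \<mu> (amap a z -` ?U)"
        using w V pos by (auto simp: msupp_def)
      also have "amap a z -` ?U = V"
        using a by (auto simp: amap_def)
      finally show "0 < emeasure \<mu> V" .
    qed
  next
    assume *: "z + (1 / a) *\<^sub>R w \<in> msupp \<mu>"
    show "w \<in> msupp (aff a z \<mu>)"
      unfolding msupp_def
    proof (intro CollectI allI impI)
      fix U assume U: "open U \<and> w \<in> U"
      then have "open (amap a z -` U)" "z + (1 / a) *\<^sub>R w \<in> amap a z -` U"
        using a by (auto simp: open_vimage_amap amap_def)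
      then show "0 < emeasure (aff a z \<mu>) U"
        using * U pos by (auto simp: msupp_def)
    qed
  qed
qed

section \<open>Cells\<close>

definition half :: "(real ^ 'n) set" where
  "half = {x. \<forall>i. - 1 \<le> x $ i \<and> x $ i < 1}"

text \<open>With \<open>j\<close> the floor, the integer \<open>k = 2 * j - m\<close> has the parity
  of \<open>m\<close> and satisfies \<open>k \<le> m * x $ i < k + 2\<close>. Hence this is the
  centre of the cell of level \<open>m\<close> that contains \<open>x\<close>.\<close>

definition ctr :: "nat \<Rightarrow> real ^ 'n \<Rightarrow> real ^ 'n" where
  "ctr m x = (\<chi> i. (2 * of_int \<lfloor>(real m * x $ i + real m) / 2\<rfloor> - real m + 1) / real m)"

lemma half_subset_B1: "half \<subseteq> B1"
  by (auto simp: half_def B1_def abs_le_iff less_imp_le minus_le_iff)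

lemma half_borel [measurable]: "half \<in> sets borel"
  unfolding half_def by measurable

lemma ctr_borel [measurable]: "(ctr m :: real ^ 'n \<Rightarrow> _) \<in> borel_measurable borel"
proof (subst borel_measurable_euclidean_space, intro ballI)
  fix j :: "real ^ 'n" assume "j \<in> Basis"
  then obtain i where j: "j = axis i 1"
    by (auto simp: Basis_vec_def)
  show "(\<lambda>x. ctr m x \<bullet> j) \<in> borel_measurable borel"
    unfolding j inner_axis ctr_def by simp
qed

lemma amap_ctr_mem_half:
  assumes "m \<ge> 1"
  shows "amap (real m) (ctr m x) y \<in> half \<longleftrightarrow> ctr m y = ctr m x"
proof -
  have "amap (real m) (ctr m x) y \<in> half \<longleftrightarrow>
      (\<forall>i. \<lfloor>(real m * y $ i + real m) / 2\<rfloor> = \<lfloor>(real m * x $ i + real m) / 2\<rfloor>)"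
  proof -
    have "- 1 \<le> amap (real m) (ctr m x) y $ i \<and> amap (real m) (ctr m x) y $ i < 1 \<longleftrightarrow>
      \<lfloor>(real m * y $ i + real m) / 2\<rfloor> = \<lfloor>(real m * x $ i + real m) / 2\<rfloor>" for i
    proof -
      have "amap (real m) (ctr m x) y $ i =
          real m * y $ i - (2 * of_int \<lfloor>(real m * x $ i + real m) / 2\<rfloor> - real m + 1)"
        using assms by (simp add: amap_def ctr_def right_diff_distrib)
      then show ?thesis
        unfolding floor_eq_iff by (simp add: field_simps) linarith
    qed
    then show ?thesis by (simp add: half_def)
  qed
  also have "\<dots> \<longleftrightarrow> ctr m y = ctr m x"
    using assms by (simp add: ctr_def vec_eq_iff)
  finally show ?thesis .
qed

lemma amap_ctr_self: "m \<ge> 1 \<Longrightarrow> amap (real m) (ctr m x) x \<in> half"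
  by (simp add: amap_ctr_mem_half)

text \<open>Needed for \<open>rescale\<close>, whose definite description presupposes that a cube
  determines its centre and radius. The lower corner fixes \<open>c - r\<close>; if the radii
  differed, the excluded upper corner of the smaller cube would lie in the larger one.\<close>

lemma cube_inject:
  fixes c c' :: "real ^ 'n"
  assumes eq: "cube c r = cube c' r'" and "r > 0" "r' > 0"
  shows "c = c' \<and> r = r'"
proof -
  have low: "c $ i - r = c' $ i - r'" for i
  proof -
    have "(\<chi> i. c $ i - r) \<in> cube c r" "(\<chi> i. c' $ i - r') \<in> cube c' r'"
      using assms(2,3) by (auto simp: cube_def)
    then have "(\<chi> i. c $ i - r) \<in> cube c' r'" "(\<chi> i. c' $ i - r') \<in> cube c r"
      using eq by auto
    then have "c' $ i - r' \<le> c $ i - r" "c $ i - r \<le> c' $ i - r'"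
      by (auto simp: cube_def)
    then show ?thesis by simp
  qed
  have "\<not> r < r'"
  proof
    assume "r < r'"
    then have "(\<chi> i. c $ i + r) \<in> cube c' r'"
      using low \<open>r > 0\<close> by (auto simp: cube_def) (smt (verit))+
    then have "(\<chi> i. c $ i + r) \<in> cube c r"
      by (simp add: eq)
    then show False
      by (simp add: cube_def)
  qed
  moreover have "\<not> r' < r"
  proof
    assume "r' < r"
    then have "(\<chi> i. c' $ i + r') \<in> cube c r"
      using low \<open>r' > 0\<close> by (auto simp: cube_def) (smt (verit))+
    then have "(\<chi> i. c' $ i + r') \<in> cube c' r'"
      by (simp flip: eq)
    then show False
      by (simp add: cube_def)
  qed
  ultimately have "r = r'" by simp
  then show ?thesis
    using low by (simp add: vec_eq_iff)
qed

lemma rescale_cube: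
  assumes "r > 0"
  shows "rescale (cube c r) = amap (1 / r) c"
  unfolding rescale_def
proof (rule the_equality)
  show "\<exists>c' r'. 0 < r' \<and> cube c r = cube c' r' \<and> amap (1 / r) c = (\<lambda>y. (1 / r') *\<^sub>R (y - c'))"
    using assms by (intro exI[of _ c] exI[of _ r]) (auto simp: amap_def)
  fix f assume "\<exists>c' r'. 0 < r' \<and> cube c r = cube c' r' \<and> f = (\<lambda>y. (1 / r') *\<^sub>R (y - c'))"
  then show "f = amap (1 / r) c"
    using cube_inject[of c r] assms by (auto simp: amap_def)
qed

lemma vimage_amap_half:
  assumes "m \<ge> 1"
  shows "amap (real m) c -` half = cube c (1 / real m)"
  using assms by (auto simp: amap_def half_def cube_def field_simps)

lemma intervals_mem:
  assumes m: "m \<ge> 1" and "J \<in> intervals m" "t \<in> J"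
  defines "k \<equiv> 2 * \<lfloor>(real m * t + real m) / 2\<rfloor> - int m"
  shows "J = {of_int k / real m ..< (of_int k + 2) / real m}"
proof -
  obtain l where J: "J = {of_int l / real m ..< (of_int l + 2) / real m}" and l: "l mod 2 = int m mod 2"
    using assms by (auto simp: intervals_def)
  have "(l + int m) mod 2 = 0"
    using l by presburger
  then obtain j where j: "l + int m = 2 * j"
    by auto
  then have l': "of_int l = 2 * of_int j - real m"
    by (metis add_diff_cancel_right' of_int_diff of_int_mult of_int_numeral of_int_of_nat_eq)
  have "\<lfloor>(real m * t + real m) / 2\<rfloor> = j"
    using \<open>t \<in> J\<close> m unfolding J l' floor_eq_iff by (auto simp: field_simps)
  then have "k = l"
    using j by (simp add: k_def)
  then show ?thesis by (simp add: J)
qed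

lemma cell_eq:
  assumes "m \<ge> 1"
  shows "cell m x = cube (ctr m x) (1 / real m)"
proof -
  define k where "k i = 2 * \<lfloor>(real m * x $ i + real m) / 2\<rfloor> - int m" for i
  define J where "J i = {of_int (k i) / real m ..< (of_int (k i) + 2) / real m}" for i
  have c: "cube (ctr m x) (1 / real m) = {y. \<forall>i. y $ i \<in> J i}"
  proof -
    have "ctr m x $ i - 1 / real m = of_int (k i) / real m"
      "ctr m x $ i + 1 / real m = (of_int (k i) + 2) / real m" for i
      by (simp_all add: ctr_def k_def diff_divide_distrib add_divide_distrib)
    then show ?thesis
      by (simp add: cube_def J_def)
  qed
  have "J i \<in> intervals m" for i
    unfolding intervals_def J_def k_def by (auto intro!: exI[of _ "k i"] simp: k_def) presburger
  then have K: "{y. \<forall>i. y $ i \<in> J i} \<in> cells m"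
    unfolding cells_def by blast
  have xK: "x \<in> cube (ctr m x) (1 / real m)"
    using amap_ctr_self[OF assms, of x] vimage_amap_half[OF assms, of "ctr m x"] by blast
  have uniq: "D = {y. \<forall>i. y $ i \<in> J i}" if D: "D \<in> cells m" "x \<in> D" for D
  proof -
    obtain I where I: "D = {y. \<forall>i. y $ i \<in> I i}" "\<And>i. I i \<in> intervals m"
      using D by (auto simp: cells_def)
    then have "I i = J i" for i
      using intervals_mem[OF assms I(2), of "x $ i" i] D by (auto simp: J_def k_def)
    then show ?thesis by (simp add: I)
  qed
  show ?thesis
    unfolding cell_def c
  proof (rule the_equality)
    show "{y. \<forall>i. y $ i \<in> J i} \<in> cells m \<and> x \<in> {y. \<forall>i. y $ i \<in> J i}"
      using K xK unfolding c by (rule conjI)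
  qed (use uniq in simp)
qed

lemma rescale_cell: "m \<ge> 1 \<Longrightarrow> rescale (cell m x) = amap (real m) (ctr m x)"
  by (simp add: cell_eq rescale_cube)

lemma cell_vimage: "m \<ge> 1 \<Longrightarrow> cell m x = amap (real m) (ctr m x) -` half"
  by (simp add: cell_eq vimage_amap_half)

lemma star_magnify: "m \<ge> 1 \<Longrightarrow> star (magnify m \<mu> x) = aff (real m) (ctr m x) \<mu>"
  by (simp add: magnify_def rescale_cell aff_def)

lemma cp_star_eq: "b \<ge> 1 \<Longrightarrow> cp_star b (\<mu>, x) = (aff (real b) (ctr b x) \<mu>, amap (real b) (ctr b x) x)"
  by (simp add: cp_star_def star_magnify rescale_cell)

lemma cp_square_eq: "b \<ge> 1 \<Longrightarrow> cp_square b (\<mu>, x) =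
    (density (aff (real b) (ctr b x) \<mu>) (indicator B1), amap (real b) (ctr b x) x)"
  by (simp add: cp_square_def square_def star_magnify rescale_cell)

lemma approximant_eq: "b \<ge> 1 \<Longrightarrow> approximant b \<omega> n =
    aff (real (b ^ n)) (ctr (b ^ n) (snd (\<omega> (- int n)))) (fst (\<omega> (- int n)))"
  unfolding approximant_def by (rule star_magnify) simp

text \<open>The partition \<open>\<D>\<^bsub>km\<^esub>\<close> is obtained by subdividing the cells of \<open>\<D>\<^bsub>m\<^esub>\<close> as \<open>\<D>\<^bsub>k\<^esub>\<close> subdivides \<open>[-1,1)\<^sup>d\<close>.\<close>

lemma ctr_mult:
  assumes "k \<ge> 1" "m \<ge> 1"
  shows "ctr m x + (1 / real m) *\<^sub>R ctr k (amap (real m) (ctr m x) x) = ctr (k * m) x"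
proof (subst vec_eq_iff, intro allI)
  fix i
  define A where "A = \<lfloor>(real m * x $ i + real m) / 2\<rfloor>"
  define B where "B = \<lfloor>(real (k * m) * x $ i + real (k * m)) / 2\<rfloor>"
  define x' where "x' = amap (real m) (ctr m x) x $ i"
  have x': "x' = real m * x $ i - (2 * of_int A - real m + 1)"
    using assms by (simp add: x'_def A_def amap_def ctr_def right_diff_distrib)
  have "(real k * x' + real k) / 2 = (real (k * m) * x $ i + real (k * m)) / 2 - of_int (int k * A)"
    unfolding x' by (simp add: field_simps)
  then have "\<lfloor>(real k * x' + real k) / 2\<rfloor> = B - int k * A"
    by (simp only: B_def floor_diff_of_int)
  then have ck: "ctr k (amap (real m) (ctr m x) x) $ i = (2 * (of_int B - real k * of_int A) - real k + 1) / real k"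
    unfolding x'_def by (subst ctr_def) simp
  have c: "ctr m x $ i = (2 * of_int A - real m + 1) / real m"
    "ctr (k * m) x $ i = (2 * of_int B - real (k * m) + 1) / real (k * m)"
    by (simp_all add: ctr_def A_def B_def)
  show "(ctr m x + (1 / real m) *\<^sub>R ctr k (amap (real m) (ctr m x) x)) $ i = ctr (k * m) x $ i"
    unfolding vector_add_component vector_scaleR_component real_scaleR_def ck c
    using assms by (simp add: field_simps)
qed

lemma aff_ctr_mult:
  assumes "\<mu> \<in> radon" "k \<ge> 1" "m \<ge> 1" "charged (real m) (ctr m x) \<mu>"
  shows "aff (real k) (ctr k (amap (real m) (ctr m x) x)) (aff (real m) (ctr m x) \<mu>) =
    aff (real (k * m)) (ctr (k * m) x) \<mu>"
  using assms by (subst aff_aff) (auto simp: ctr_mult)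

lemma amap_ctr_mult:
  assumes "k \<ge> 1" "m \<ge> 1"
  shows "amap (real k) (ctr k (amap (real m) (ctr m x) x)) (amap (real m) (ctr m x) y) =
    amap (real (k * m)) (ctr (k * m) x) y"
  using assms by (subst amap_amap) (auto simp: ctr_mult)

text \<open>For a point of \<open>half\<close> the cell index \<open>j\<close> lies between
  \<open>0\<close> and \<open>m - 1\<close> in each coordinate. A point on an upper face of
  \<open>B1\<close> would belong to a cell that sticks out.\<close>

lemma closed_cell_subset_B1:
  assumes "m \<ge> 1" "x \<in> half"
  shows "amap (real m) (ctr m x) -` B1 \<subseteq> B1"
proof
  fix y assume y: "y \<in> amap (real m) (ctr m x) -` B1"
  have "\<bar>y $ i\<bar> \<le> 1" for i
  proof -
    define j where "j = \<lfloor>(real m * x $ i + real m) / 2\<rfloor>"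
    have x: "- 1 \<le> x $ i" "x $ i < 1"
      using assms(2) by (auto simp: half_def)
    have "0 \<le> x $ i + 1"
      using x by linarith
    then have "0 \<le> real m * (x $ i + 1)"
      by simp
    moreover have "real m * x $ i < real m * 1"
      using assms(1) x by (intro mult_strict_left_mono) auto
    ultimately
    have "0 \<le> j" "j < int m"
      by (auto simp: j_def floor_less_iff algebra_simps)
    then have j: "0 \<le> j" "real_of_int j \<le> real m - 1"
      by linarith+
    have "amap (real m) (ctr m x) y $ i = real m * y $ i - (2 * of_int j - real m + 1)"
      using assms by (simp add: j_def amap_def ctr_def right_diff_distrib)
    then have "\<bar>real m * y $ i - (2 * of_int j - real m + 1)\<bar> \<le> 1"
      using y by (simp add: B1_def) (metis)
    then have "\<bar>real m * y $ i\<bar> \<le> real m"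
      using j by linarith
    then show ?thesis
      using assms(1) by (simp add: abs_mult)
  qed
  then show "y \<in> B1" by (simp add: B1_def)
qed

lemma ctr_1: "x \<in> half \<Longrightarrow> ctr 1 x = (0 :: real ^ 'n)"
proof (subst vec_eq_iff, intro allI)
  fix i :: 'n assume "x \<in> half"
  then have "- 1 \<le> x $ i" "x $ i < 1"
    by (auto simp: half_def)
  then have "\<lfloor>(x $ i + 1) / 2\<rfloor> = 0"
    unfolding floor_eq_iff by simp
  then show "ctr 1 x $ i = (0 :: real ^ 'n) $ i"
    by (simp add: ctr_def)
qed

lemma charged_cell:
  assumes "\<mu> \<in> radon" "m \<ge> 1" "emeasure \<mu> (cell m x) > 0"
  shows "charged (real m) (ctr m x) \<mu>"
proof -
  have "emeasure \<mu> (cell m x) \<le> emeasure \<mu> (amap (real m) (ctr m x) -` B1)"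
    using half_subset_B1 by (intro emeasure_mono) (auto simp: cell_vimage[OF assms(2)] radon_sets[OF assms(1)])
  then show ?thesis
    using assms(3) by (auto simp: charged_def)
qed

section \<open>Paths of the two-sided process\<close>

definition shift_path :: "int \<Rightarrow> (int \<Rightarrow> 'a) \<Rightarrow> int \<Rightarrow> 'a" where
  "shift_path k \<omega> = (\<lambda>n. \<omega> (n + k))"

text \<open>Membership of the points in \<open>half\<close> comes from the dynamics and is what
  keeps the closed cells along the path inside \<open>B1\<close>.\<close>

definition path :: "nat \<Rightarrow> (int \<Rightarrow> (real ^ 'n) measure \<times> (real ^ 'n)) \<Rightarrow> bool" where
  "path b \<omega> \<longleftrightarrow> (\<forall>n. fst (\<omega> n) \<in> topspace square_topology \<and> snd (\<omega> n) \<in> half \<and> \<omega> n \<in> cp_dom b \<and>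
     \<omega> (n + 1) = cp_square b (\<omega> n))"

text \<open>Only countably many shifts occur, so the property holds almost surely. Negative shifts
  are included for arguments that start in the past.\<close>

definition regular :: "nat \<Rightarrow> ((int \<Rightarrow> (real ^ 'n) measure \<times> (real ^ 'n)) \<Rightarrow> (real ^ 'n) measure) \<Rightarrow>
    (int \<Rightarrow> (real ^ 'n) measure \<times> (real ^ 'n)) \<Rightarrow> bool" where
  "regular b \<nu> \<omega> \<longleftrightarrow> path b \<omega> \<and> (\<forall>k. \<nu> (shift_path k \<omega>) \<in> topspace star_topology \<and>
     (\<forall>A \<in> sets borel. (\<lambda>n. emeasure (approximant b (shift_path k \<omega>) n) A) \<longlonglongrightarrow> emeasure (\<nu> (shift_path k \<omega>)) A))"

lemma shift_path_add: "shift_path k (shift_path l \<omega>) = shift_path (k + l) \<omega>"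
  by (simp add: shift_path_def add.assoc)

lemma shift_path_0 [simp]: "shift_path 0 \<omega> = \<omega>"
  by (simp add: shift_path_def)

lemma regular_shift: "regular b \<nu> \<omega> \<Longrightarrow> regular b \<nu> (shift_path k \<omega>)"
proof -
  assume r: "regular b \<nu> \<omega>"
  have "path b (shift_path k \<omega>)"
    unfolding path_def shift_path_def
  proof
    fix n
    show "fst (\<omega> (n + k)) \<in> topspace square_topology \<and> snd (\<omega> (n + k)) \<in> half \<and> \<omega> (n + k) \<in> cp_dom b \<and>
        \<omega> (n + 1 + k) = cp_square b (\<omega> (n + k))"
      using r unfolding regular_def path_def
      by (metis (no_types, opaque_lifting) add.assoc add.commute)
  qed
  then show ?thesis
    using r by (simp add: regular_def shift_path_add)
qed

context
  fixes b :: nat and \<omega> :: "int \<Rightarrow> (real ^ 'n) measure \<times> (real ^ 'n)"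
  assumes b: "b \<ge> 1" and path: "path b \<omega>"
begin

lemma path_radon: "fst (\<omega> k) \<in> radon"
  using path by (auto simp: path_def topspace_square)

lemma path_snd: "snd (\<omega> (k + int n)) = amap (real (b ^ n)) (ctr (b ^ n) (snd (\<omega> k))) (snd (\<omega> k))"
proof (induction n)
  case 0
  \<comment> \<open>At level \<open>1\<close> the cell of a point of \<open>half\<close> is
    \<open>half\<close> itself, so the magnification is the identity.\<close>
  have "snd (\<omega> k) \<in> half" using path by (simp add: path_def)
  then show ?case by (simp add: ctr_1 amap_def del: One_nat_def)
next
  case (Suc n)
  have "\<omega> (k + int n + 1) = cp_square b (\<omega> (k + int n))"
    using path by (simp add: path_def)
  then have "snd (\<omega> (k + int (Suc n))) = snd (cp_square b (\<omega> (k + int n)))"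
    by (simp add: ac_simps)
  also have "\<dots> = amap (real b) (ctr b (snd (\<omega> (k + int n)))) (snd (\<omega> (k + int n)))"
    by (cases "\<omega> (k + int n)") (simp add: cp_square_eq[OF b])
  also have "\<dots> = amap (real (b * b ^ n)) (ctr (b * b ^ n) (snd (\<omega> k))) (snd (\<omega> k))"
    unfolding Suc.IH using b by (intro amap_ctr_mult) auto
  finally show ?case by simp
qed

text \<open>Each step restricts to the cube after magnifying, yet nothing relevant is lost, since
  the next closed cell lies within the cube. Chargedness is part of the induction because it
  licenses the composition of the magnifications.\<close>

lemma path_aff:
  "charged (real (b ^ n)) (ctr (b ^ n) (snd (\<omega> k))) (fst (\<omega> k)) \<and>
   (\<forall>A. A \<in> sets borel \<longrightarrow> A \<subseteq> B1 \<longrightarrow>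
     emeasure (aff (real (b ^ n)) (ctr (b ^ n) (snd (\<omega> k))) (fst (\<omega> k))) A = emeasure (fst (\<omega> (k + int n))) A)"
proof (induction n)
  case 0
  have *: "amap 1 0 -` A = A" for A :: "(real ^ 'n) set"
    by (auto simp: amap_def)
  have "snd (\<omega> k) \<in> half" "emeasure (fst (\<omega> k)) B1 = 1"
    using path by (auto simp: path_def topspace_square)
  then show ?case
    using path_radon[of k] by (simp add: ctr_1 charged_def * emeasure_aff del: One_nat_def)
next
  case (Suc n)
  define \<mu> where "\<mu> = fst (\<omega> k)"
  define \<mu>' where "\<mu>' = fst (\<omega> (k + int n))"
  define x where "x = snd (\<omega> (k + int n))"
  define \<theta> where "\<theta> = aff (real (b ^ n)) (ctr (b ^ n) (snd (\<omega> k))) \<mu>"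
  have ch: "charged (real (b ^ n)) (ctr (b ^ n) (snd (\<omega> k))) \<mu>"
    and IH: "\<And>A. A \<in> sets borel \<Longrightarrow> A \<subseteq> B1 \<Longrightarrow> emeasure \<theta> A = emeasure \<mu>' A"
    using Suc.IH by (auto simp: \<mu>_def \<mu>'_def \<theta>_def)
  have r: "\<mu> \<in> radon" "\<mu>' \<in> radon"
    by (simp_all add: \<mu>_def \<mu>'_def path_radon)
  have "\<theta> \<in> radon"
    using aff_in_star[OF r(1) _ ch] b by (simp add: \<theta>_def topspace_star)
  have xh: "x \<in> half"
    using path by (simp add: path_def x_def)
  have x: "x = amap (real (b ^ n)) (ctr (b ^ n) (snd (\<omega> k))) (snd (\<omega> k))"
    by (simp add: x_def path_snd)
  have comp: "aff (real b) (ctr b x) \<theta> = aff (real (b ^ Suc n)) (ctr (b ^ Suc n) (snd (\<omega> k))) \<mu>"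
    unfolding \<theta>_def x using aff_ctr_mult[OF r(1) b _ ch] b by simp
  have sub: "amap (real b) (ctr b x) -` A \<subseteq> B1" if "A \<subseteq> B1" for A
    using closed_cell_subset_B1[OF b xh] that by auto
  have "emeasure \<mu>' (cell b x) > 0"
    using path by (auto simp: path_def cp_dom_def \<mu>'_def x_def case_prod_beta)
  then have ch': "charged (real b) (ctr b x) \<mu>'"
    by (rule charged_cell[OF r(2) b])
  then have "charged (real b) (ctr b x) \<theta>"
    using IH[OF _ sub[of B1]] by (simp add: charged_def)
  then have "charged (real (b ^ Suc n)) (ctr (b ^ Suc n) (snd (\<omega> k))) \<mu>"
    unfolding \<theta>_def x using charged_aff[OF r(1) _ ch, of "real b"] ctr_mult[OF b, of "b ^ n" "snd (\<omega> k)"] b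
    by simp
  moreover have "emeasure (aff (real (b ^ Suc n)) (ctr (b ^ Suc n) (snd (\<omega> k))) \<mu>) A = emeasure (fst (\<omega> (k + int (Suc n)))) A"
    if A: "A \<in> sets borel" "A \<subseteq> B1" for A
  proof -
    have "emeasure (aff (real (b ^ Suc n)) (ctr (b ^ Suc n) (snd (\<omega> k))) \<mu>) A = emeasure (aff (real b) (ctr b x) \<theta>) A"
      by (simp only: comp)
    also have "\<dots> = emeasure (aff (real b) (ctr b x) \<mu>') A"
      using A IH[OF _ sub[of B1]] IH[OF _ sub[of A]]
      by (simp add: emeasure_aff[OF \<open>\<theta> \<in> radon\<close>] emeasure_aff[OF r(2)])
    also have "\<dots> = emeasure (density (aff (real b) (ctr b x) \<mu>') (indicator B1)) A"
      using A by (simp add: emeasure_restricted sets_aff Int_absorb1)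
    also have "density (aff (real b) (ctr b x) \<mu>') (indicator B1) = fst (cp_square b (\<omega> (k + int n)))"
      by (cases "\<omega> (k + int n)") (simp add: cp_square_eq[OF b] \<mu>'_def x_def)
    also have "cp_square b (\<omega> (k + int n)) = \<omega> (k + int (Suc n))"
      using path by (simp add: path_def) (metis add.assoc add.commute)
    finally show ?thesis .
  qed
  ultimately show ?case by (simp add: \<mu>_def)
qed

end

context
  fixes b :: nat and \<nu> :: "(int \<Rightarrow> (real ^ 'n) measure \<times> (real ^ 'n)) \<Rightarrow> (real ^ 'n) measure"
  assumes b: "b \<ge> 1"
begin

lemma regular_path: "regular b \<nu> \<omega> \<Longrightarrow> path b \<omega>"
  by (simp add: regular_def)

lemma regular_lim: "regular b \<nu> \<omega> \<Longrightarrow> A \<in> sets borel \<Longrightarrow>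
    (\<lambda>n. emeasure (approximant b \<omega> n) A) \<longlonglongrightarrow> emeasure (\<nu> \<omega>) A"
  unfolding regular_def by (metis shift_path_0)

lemma regular_star: "regular b \<nu> \<omega> \<Longrightarrow> \<nu> \<omega> \<in> topspace star_topology"
  unfolding regular_def by (metis shift_path_0)

lemma regular_radon: "regular b \<nu> \<omega> \<Longrightarrow> \<nu> \<omega> \<in> radon"
  using regular_star by (auto simp: topspace_star)

text \<open>Consistency of the approximants: looking further into the past changes nothing on the
  central cube. The values of the limit on \<open>B1\<close> follow.\<close>

lemma approximant_on_B1:
  assumes "path b \<omega>" "A \<in> sets borel" "A \<subseteq> B1"
  shows "emeasure (approximant b \<omega> n) A = emeasure (fst (\<omega> 0)) A"
  using path_aff[OF b assms(1), of n "- int n"] assms by (simp add: approximant_eq[OF b])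

lemma regular_on_B1:
  assumes "regular b \<nu> \<omega>" "A \<in> sets borel" "A \<subseteq> B1"
  shows "emeasure (\<nu> \<omega>) A = emeasure (fst (\<omega> 0)) A"
  using regular_lim[OF assms(1,2)] approximant_on_B1[OF regular_path[OF assms(1)] assms(2,3)]
  by (simp add: LIMSEQ_const_iff)

lemma regular_charged:
  assumes "regular b \<nu> \<omega>"
  shows "charged (real (b ^ n)) (ctr (b ^ n) (snd (\<omega> 0))) (\<nu> \<omega>)"
proof -
  have "snd (\<omega> 0) \<in> half"
    using regular_path[OF assms] by (simp add: path_def)
  then have "amap (real (b ^ n)) (ctr (b ^ n) (snd (\<omega> 0))) -` B1 \<subseteq> B1"
    using b by (intro closed_cell_subset_B1) auto
  then show ?thesis
    using path_aff[OF b regular_path[OF assms], of n 0] regular_on_B1[OF assms]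
    by (simp add: charged_def)
qed

lemma regular_cp_dom:
  assumes "regular b \<nu> \<omega>"
  shows "(\<nu> \<omega>, snd (\<omega> 0)) \<in> cp_dom b"
proof -
  have p: "snd (\<omega> 0) \<in> half" "emeasure (fst (\<omega> 0)) (cell b (snd (\<omega> 0))) > 0"
    using regular_path[OF assms] by (auto simp: path_def cp_dom_def case_prod_beta)
  have "cell b (snd (\<omega> 0)) \<subseteq> B1"
    using closed_cell_subset_B1[OF b p(1)] half_subset_B1 by (auto simp: cell_vimage[OF b])
  then show ?thesis
    using p regular_on_B1[OF assms, of "cell b (snd (\<omega> 0))"] by (simp add: cp_dom_def cell_vimage[OF b])
qed

text \<open>Both sides are limits of magnifications of the same past measures: the approximant of
  order \<open>Suc n\<close> at time \<open>1\<close> starts from \<open>\<omega> (- int n)\<close>,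
  as does that of order \<open>n\<close> at time \<open>0\<close>. The normalising constants do not
  depend on \<open>n\<close>, because the closed cell lies in \<open>B1\<close>, where all
  approximants agree.\<close>

lemma regular_step:
  assumes r: "regular b \<nu> \<omega>"
  shows "cp_star b (\<nu> \<omega>, snd (\<omega> 0)) = (\<nu> (shift_path 1 \<omega>), snd (\<omega> 1))"
proof -
  note p = regular_path[OF r]
  let ?x = "snd (\<omega> 0)"
  let ?T = "amap (real b) (ctr b ?x)"
  have r1: "regular b \<nu> (shift_path 1 \<omega>)"
    by (rule regular_shift[OF r])
  have xh: "?x \<in> half"
    using p by (simp add: path_def)
  have ch: "charged (real b) (ctr b ?x) (\<nu> \<omega>)"
    using regular_charged[OF r, of 1] by simp
  have sub: "?T -` B1 \<subseteq> B1"
    by (rule closed_cell_subset_B1[OF b xh])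
  have "aff (real b) (ctr b ?x) (\<nu> \<omega>) = \<nu> (shift_path 1 \<omega>)"
  proof (rule measure_eqI)
    show "sets (aff (real b) (ctr b ?x) (\<nu> \<omega>)) = sets (\<nu> (shift_path 1 \<omega>))"
      using regular_radon[OF r1] by (simp add: sets_aff radon_sets)
    fix A assume "A \<in> sets (aff (real b) (ctr b ?x) (\<nu> \<omega>))"
    then have A: "A \<in> sets borel" by (simp add: sets_aff)
    have ap: "approximant b (shift_path 1 \<omega>) (Suc n) = aff (real b) (ctr b ?x) (approximant b \<omega> n)" for n
    proof -
      have x: "?x = amap (real (b ^ n)) (ctr (b ^ n) (snd (\<omega> (- int n)))) (snd (\<omega> (- int n)))"
        using path_snd[OF b p, of "- int n" n] by simp
      have "charged (real (b ^ n)) (ctr (b ^ n) (snd (\<omega> (- int n)))) (fst (\<omega> (- int n)))"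
        using path_aff[OF b p, of n "- int n"] by simp
      from aff_ctr_mult[OF path_radon[OF b p] b _ this] show ?thesis
        using b by (simp add: approximant_eq[OF b] shift_path_def x)
    qed
    have rn: "approximant b \<omega> n \<in> radon" for n
      using aff_in_star[OF path_radon[OF b p], of "real (b ^ n)" "ctr (b ^ n) (snd (\<omega> (- int n)))" "- int n"]
        path_aff[OF b p, of n "- int n"] b by (simp add: approximant_eq[OF b] topspace_star)
    let ?c = "1 / emeasure (\<nu> \<omega>) (?T -` B1)"
    have "emeasure (approximant b (shift_path 1 \<omega>) (Suc n)) A = ?c * emeasure (approximant b \<omega> n) (?T -` A)" for n
      unfolding ap emeasure_aff[OF rn A] using sub
      by (simp add: approximant_on_B1[OF p] regular_on_B1[OF r])
    moreover have "?c < top"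
      using amap_star_pos[OF regular_radon[OF r] _ ch] b by (simp add: less_top)
    ultimately have "(\<lambda>n. emeasure (approximant b (shift_path 1 \<omega>) (Suc n)) A) \<longlonglongrightarrow> ?c * emeasure (\<nu> \<omega>) (?T -` A)"
      using A by (simp add: ennreal_tendsto_cmult regular_lim[OF r])
    moreover have "(\<lambda>n. emeasure (approximant b (shift_path 1 \<omega>) (Suc n)) A) \<longlonglongrightarrow> emeasure (\<nu> (shift_path 1 \<omega>)) A"
      using regular_lim[OF r1 A] by (rule LIMSEQ_Suc)
    ultimately show "emeasure (aff (real b) (ctr b ?x) (\<nu> \<omega>)) A = emeasure (\<nu> (shift_path 1 \<omega>)) A"
      using LIMSEQ_unique by (auto simp: emeasure_aff[OF regular_radon[OF r] A])
  qed
  moreover have "?T ?x = snd (\<omega> 1)"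
    using path_snd[OF b p, of 0 1] by simp
  ultimately show ?thesis
    by (simp add: cp_star_eq[OF b])
qed

text \<open>Applied to a path shifted by \<open>- int n\<close>, this presents
  \<open>\<nu> \<omega>\<close> as a magnification of the limit measure \<open>n\<close> steps in
  the past.\<close>

lemma regular_steps:
  assumes r: "regular b \<nu> \<omega>"
  shows "aff (real (b ^ n)) (ctr (b ^ n) (snd (\<omega> 0))) (\<nu> \<omega>) = \<nu> (shift_path (int n) \<omega>)"
proof (induction n)
  case 0
  have "snd (\<omega> 0) \<in> half" "emeasure (\<nu> \<omega>) B1 = 1"
    using regular_path[OF r] regular_star[OF r] by (auto simp: path_def topspace_star)
  then show ?case
    using regular_radon[OF r]
    by (intro measure_eqI) (auto simp: sets_aff radon_sets emeasure_aff ctr_1 amap_def[abs_def] simp del: One_nat_def)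
next
  case (Suc n)
  note p = regular_path[OF r]
  have "(aff (real b) (ctr b (snd (\<omega> (int n)))) (\<nu> (shift_path (int n) \<omega>)), amap (real b) (ctr b (snd (\<omega> (int n)))) (snd (\<omega> (int n))))
      = (\<nu> (shift_path (int (Suc n)) \<omega>), snd (\<omega> (int (Suc n))))"
    using regular_step[OF regular_shift[OF r, of "int n"]] unfolding shift_path_add
    by (simp add: shift_path_def cp_star_eq[OF b])
  then have "\<nu> (shift_path (int (Suc n)) \<omega>) = aff (real b) (ctr b (snd (\<omega> (int n)))) (\<nu> (shift_path (int n) \<omega>))"
    by simp
  also have "\<dots> = aff (real (b ^ Suc n)) (ctr (b ^ Suc n) (snd (\<omega> 0))) (\<nu> \<omega>)"
    unfolding Suc.IH[symmetric]
    using aff_ctr_mult[OF regular_radon[OF r] b _ regular_charged[OF r, of n]] path_snd[OF b p, of 0 n] b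
    by simp
  finally show ?case ..
qed

text \<open>Each approximant is a normalised image of a measure carried by \<open>B1\<close>, so it
  gives no mass to the complement of the union; setwise convergence passes this to the
  limit.\<close>

lemma regular_union:
  assumes r: "regular b \<nu> \<omega>"
  shows "AE w in \<nu> \<omega>. \<exists>n. w \<in> amap (real (b ^ n)) (ctr (b ^ n) (snd (\<omega> (- int n)))) ` B1"
proof -
  note p = regular_path[OF r]
  let ?T = "\<lambda>n. amap (real (b ^ n)) (ctr (b ^ n) (snd (\<omega> (- int n))))"
  define C where "C = (\<Union>n. ?T n ` B1)"
  have "compact (?T n ` B1)" for n
    by (intro compact_continuous_image continuous_on_amap compact_B1)
  then have C: "C \<in> sets borel"
    unfolding C_def by (intro sets.countable_UN) (auto simp: compact_imp_closed)
  have "emeasure (approximant b \<omega> n) (- C) = 0" for n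
  proof -
    have "?T n -` (- C) \<subseteq> - B1"
      by (auto simp: C_def)
    then have "emeasure (fst (\<omega> (- int n))) (?T n -` (- C)) \<le> emeasure (fst (\<omega> (- int n))) (- B1)"
      using path_radon[OF b p, of "- int n"] by (intro emeasure_mono) (auto simp: radon_sets)
    also have "\<dots> = 0"
      using p by (simp add: path_def topspace_square)
    finally show ?thesis
      using C path_radon[OF b p, of "- int n"] by (simp add: approximant_eq[OF b] emeasure_aff)
  qed
  then have "emeasure (\<nu> \<omega>) (- C) = 0"
    using regular_lim[OF r, of "- C"] C by (simp add: LIMSEQ_const_iff)
  then have "- C \<in> null_sets (\<nu> \<omega>)"
    using C regular_radon[OF r] by (simp add: null_sets_def radon_sets)
  then show ?thesis
    by (rule AE_I') (auto simp: C_def)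
qed

end


section \<open>Adaptedness for measurable functions\<close>

lemma measurable_emb_pair: "(\<lambda>p. emb (fst p)) \<in> borel_of X \<rightarrow>\<^sub>M borel" "snd \<in> borel_of X \<rightarrow>\<^sub>M borel"
  if "pulled_back X emb_pair"
proof -
  have m: "emb_pair \<in> borel_of X \<rightarrow>\<^sub>M borel \<Otimes>\<^sub>M borel"
    unfolding borel_prod by (rule measurable_pulled_back[OF that])
  have "(\<lambda>p. emb (fst p)) = fst \<circ> emb_pair" "snd = snd \<circ> emb_pair"
    by (auto simp: fun_eq_iff)
  then show "(\<lambda>p. emb (fst p)) \<in> borel_of X \<rightarrow>\<^sub>M borel" "snd \<in> borel_of X \<rightarrow>\<^sub>M borel"
    using measurable_comp[OF m measurable_fst] measurable_comp[OF m measurable_snd] by metis+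
qed

lemma measurable_fst_pair:
  assumes "pulled_back X emb_pair" "topspace X \<subseteq> topspace star_topology \<times> B1"
  shows "fst \<in> borel_of X \<rightarrow>\<^sub>M star_borel"
  using assms measurable_emb_pair(1)[OF assms(1)]
  by (intro measurable_into_pulled_back[OF pulled_back_star]) auto

lemma measurable_into_pair:
  fixes X :: "((real ^ 'n) measure \<times> (real ^ 'n)) topology"
  assumes "pulled_back X emb_pair" "(\<lambda>x. emb (f x)) \<in> M \<rightarrow>\<^sub>M borel" "g \<in> M \<rightarrow>\<^sub>M borel"
    "\<And>x. x \<in> space M \<Longrightarrow> (f x, g x) \<in> topspace X"
  shows "(\<lambda>x. (f x, g x)) \<in> M \<rightarrow>\<^sub>M borel_of X"
proof (rule measurable_into_pulled_back[OF assms(1)])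
  note [measurable] = assms(2,3)
  have "(\<lambda>x. (emb (f x), g x)) \<in> M \<rightarrow>\<^sub>M borel"
    by measurable
  then show "(\<lambda>x. case (f x, g x) of (\<mu>, x) \<Rightarrow> (emb \<mu>, x)) \<in> M \<rightarrow>\<^sub>M borel"
    by simp
qed (use assms(4) in auto)

lemma emb_measurable [measurable]: "emb \<in> star_borel \<rightarrow>\<^sub>M borel"
  by (rule measurable_pulled_back[OF pulled_back_star])

lemma measurable_star_pair [measurable]:
  "fst \<in> star_pair_borel \<rightarrow>\<^sub>M star_borel" "snd \<in> star_pair_borel \<rightarrow>\<^sub>M borel"
  by (rule measurable_fst_pair[OF pulled_back_star_pair] measurable_emb_pair(2)[OF pulled_back_star_pair];
      simp add: topspace_star_pair)+

lemma measurable_square_pair [measurable]: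
  "fst \<in> square_pair_borel \<rightarrow>\<^sub>M star_borel" "snd \<in> square_pair_borel \<rightarrow>\<^sub>M borel"
  by (rule measurable_fst_pair[OF pulled_back_square_pair] measurable_emb_pair(2)[OF pulled_back_square_pair];
      auto simp: topspace_square_pair topspace_square topspace_star)+

lemma measurable_into_star_pair:
  assumes "f \<in> M \<rightarrow>\<^sub>M star_borel" "g \<in> M \<rightarrow>\<^sub>M borel" "\<And>x. x \<in> space M \<Longrightarrow> g x \<in> B1"
  shows "(\<lambda>x. (f x, g x)) \<in> M \<rightarrow>\<^sub>M star_pair_borel"
  using assms measurable_space[OF assms(1)]
  by (intro measurable_into_pair[OF pulled_back_star_pair] measurable_compose[OF assms(1) emb_measurable])
    (auto simp: topspace_star_pair)

text \<open>The identity is recast as \<open>Q = Q \<bind> K\<close>, where \<open>K\<close> keeps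
  the measure and redraws the point from its restriction to \<open>B1\<close>. Bounded continuous
  functions determine a finite measure, so the equality extends to measurable functions.\<close>

lemma adapted_extend:
  fixes X :: "((real ^ 'n) measure \<times> (real ^ 'n)) topology"
  assumes pb: "pulled_back X emb_pair" and ts: "topspace X = T \<times> B1" and T: "T \<subseteq> topspace star_topology"
    and "prob_space Q" and sQ: "sets Q = sets (borel_of X)"
    and eq: "\<And>h :: (nat \<Rightarrow> real) \<times> (real ^ 'n) \<Rightarrow> real. continuous_on UNIV h \<Longrightarrow> (\<And>x. 0 \<le> h x) \<Longrightarrow> (\<And>x. h x \<le> 1) \<Longrightarrow>
      (\<integral>\<^sup>+p. ennreal (h (emb (fst p), snd p)) \<partial>Q) =
      (\<integral>\<^sup>+p. (\<integral>\<^sup>+x. ennreal (h (emb (fst p), x)) * indicator B1 x \<partial>fst p) \<partial>Q)"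
    and F: "F \<in> borel_measurable (borel_of X)"
  shows "(\<integral>\<^sup>+p. F p \<partial>Q) = (\<integral>\<^sup>+p. (\<integral>\<^sup>+x. F (fst p, x) * indicator B1 x \<partial>fst p) \<partial>Q)"
proof -
  interpret prob_space Q by fact
  note [measurable_cong] = sQ
  have spQ: "space Q = T \<times> B1"
    using sets_eq_imp_space_eq[OF sQ] ts by simp
  have fst_m[measurable]: "fst \<in> Q \<rightarrow>\<^sub>M star_borel"
    using measurable_fst_pair[OF pb] ts T by (auto cong: measurable_cong_sets[OF sQ])
  have B0: "(0 :: real ^ 'n) \<in> B1"
    by (simp add: B1_def)
  \<comment> \<open>Points outside \<open>B1\<close> would leave the space of pairs. They carry no
    weight in \<open>K\<close>, and moving them to \<open>0\<close> makes the map total.\<close>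
  define clamp :: "real ^ 'n \<Rightarrow> real ^ 'n" where "clamp x = (if x \<in> B1 then x else 0)" for x
  have clamp_m[measurable]: "clamp \<in> borel_measurable borel"
    unfolding clamp_def by measurable
  have joint: "(\<lambda>q. (fst (fst q), clamp (snd q))) \<in> Q \<Otimes>\<^sub>M borel \<rightarrow>\<^sub>M borel_of X"
  proof (rule measurable_into_pair[OF pb])
    show "(\<lambda>q. emb (fst (fst q))) \<in> Q \<Otimes>\<^sub>M borel \<rightarrow>\<^sub>M borel" "(\<lambda>q. clamp (snd q)) \<in> Q \<Otimes>\<^sub>M borel \<rightarrow>\<^sub>M borel"
      by measurable
  qed (use B0 in \<open>auto simp: space_pair_measure spQ ts clamp_def\<close>)
  have slice: "(\<lambda>x. (fst p, clamp x)) \<in> borel \<rightarrow>\<^sub>M borel_of X" if "p \<in> space Q" for p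
    using measurable_compose[OF measurable_Pair1'[OF that] joint] by simp
  have rk: "radon_kernel Q fst"
    by (rule radon_kernel_measurable[OF fst_m])
  have rad: "fst p \<in> radon" "emeasure (fst p) B1 = 1" if "p \<in> space Q" for p
    using that T spQ by (auto simp: topspace_star)
  define K :: "(real ^ 'n) measure \<times> (real ^ 'n) \<Rightarrow> ((real ^ 'n) measure \<times> (real ^ 'n)) measure"
    where "K p = distr (density (fst p) (indicator B1)) (borel_of X) (\<lambda>x. (fst p, clamp x))" for p
  have nnK: "(\<integral>\<^sup>+q. G q \<partial>K p) = (\<integral>\<^sup>+x. G (fst p, x) * indicator B1 x \<partial>fst p)"
    if p: "p \<in> space Q" and G: "G \<in> borel_measurable (borel_of X)" for G p
  proof -
    note [measurable_cong] = radon_sets[OF rad(1)[OF p]]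
    note [measurable] = slice[OF p] G
    have "(\<integral>\<^sup>+q. G q \<partial>K p) = (\<integral>\<^sup>+x. G (fst p, clamp x) \<partial>density (fst p) (indicator B1))"
      unfolding K_def by (rule nn_integral_distr) measurable
    also have "\<dots> = (\<integral>\<^sup>+x. indicator B1 x * G (fst p, clamp x) \<partial>fst p)"
      by (rule nn_integral_density) measurable
    also have "\<dots> = (\<integral>\<^sup>+x. G (fst p, x) * indicator B1 x \<partial>fst p)"
      by (intro nn_integral_cong) (auto simp: clamp_def split: split_indicator)
    finally show ?thesis .
  qed
  have Km: "K \<in> Q \<rightarrow>\<^sub>M subprob_algebra (borel_of X)"
  proof (rule measurable_subprob_algebra)
    fix p assume p: "p \<in> space Q"
    note [measurable_cong] = radon_sets[OF rad(1)[OF p]]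
    show "sets (K p) = sets (borel_of X)"
      by (simp add: K_def)
    have "prob_space (density (fst p) (indicator B1))"
      using rad[OF p] by (intro prob_spaceI) (simp add: emeasure_restricted radon_sets radon_space)
    then have "prob_space (K p)"
      unfolding K_def using slice[OF p] by (intro prob_space.prob_space_distr) (auto cong: measurable_cong_sets)
    then show "subprob_space (K p)"
      by (rule prob_space_imp_subprob_space)
  next
    fix A :: "((real ^ 'n) measure \<times> (real ^ 'n)) set" assume A: "A \<in> sets (borel_of X)"
    have "(\<lambda>(p, x). indicator A (fst p, clamp x) * indicator B1 x :: ennreal) \<in> borel_measurable (Q \<Otimes>\<^sub>M borel)"
    proof -
      have [measurable]: "(\<lambda>q. indicator A (fst (fst q), clamp (snd q)) :: ennreal) \<in> borel_measurable (Q \<Otimes>\<^sub>M borel)"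
        using A by (intro measurable_compose[OF joint]) simp
      show ?thesis unfolding case_prod_beta by measurable
    qed
    then have "(\<lambda>p. \<integral>\<^sup>+x. indicator A (fst p, clamp x) * indicator B1 x \<partial>fst p) \<in> borel_measurable Q"
      by (rule radon_kernel_nn_integral[OF rk])
    also have "?this \<longleftrightarrow> (\<lambda>p. emeasure (K p) A) \<in> borel_measurable Q"
    proof (rule measurable_cong)
      fix p assume p: "p \<in> space Q"
      have "emeasure (K p) A = (\<integral>\<^sup>+q. indicator A q \<partial>K p)"
        using A by (simp add: K_def)
      also have "\<dots> = (\<integral>\<^sup>+x. indicator A (fst p, x) * indicator B1 x \<partial>fst p)"
        using A by (intro nnK[OF p]) simp
      also have "\<dots> = (\<integral>\<^sup>+x. indicator A (fst p, clamp x) * indicator B1 x \<partial>fst p)"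
        by (intro nn_integral_cong) (auto simp: clamp_def split: split_indicator)
      finally show "(\<integral>\<^sup>+x. indicator A (fst p, clamp x) * indicator B1 x \<partial>fst p) = emeasure (K p) A" ..
    qed
    finally show "(\<lambda>p. emeasure (K p) A) \<in> borel_measurable Q" .
  qed
  have bind: "(\<integral>\<^sup>+q. G q \<partial>(Q \<bind> K)) = (\<integral>\<^sup>+p. (\<integral>\<^sup>+x. G (fst p, x) * indicator B1 x \<partial>fst p) \<partial>Q)"
    if "G \<in> borel_measurable (borel_of X)" for G
    unfolding nn_integral_bind[OF that Km] using that by (intro nn_integral_cong nnK)
  have "Q = Q \<bind> K"
  proof (rule measure_eqI_pulled_back[OF pb sQ])
    show "sets (Q \<bind> K) = sets (borel_of X)"
      using subprob_space.subprob_not_empty prob_space.not_empty[OF \<open>prob_space Q\<close>]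
      by (intro sets_bind[OF sets_kernel[OF Km]])
    show "finite_measure Q" by unfold_locales
    fix h :: "(nat \<Rightarrow> real) \<times> (real ^ 'n) \<Rightarrow> real"
    assume h: "continuous_on UNIV h" "\<And>x. 0 \<le> h x" "\<And>x. h x \<le> 1"
    have "(\<lambda>x. ennreal (h x)) \<in> borel_measurable borel"
      using borel_measurable_continuous_onI[OF h(1)] by simp
    then have "(\<lambda>p. ennreal (h (emb_pair p))) \<in> borel_measurable (borel_of X)"
      by (rule measurable_compose[OF measurable_pulled_back[OF pb]])
    from bind[OF this] eq[OF h]
    show "(\<integral>\<^sup>+x. ennreal (h (emb_pair x)) \<partial>Q) = (\<integral>\<^sup>+x. ennreal (h (emb_pair x)) \<partial>(Q \<bind> K))"
      by (simp add: case_prod_beta)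
  qed
  then show ?thesis
    using bind[OF F] by simp
qed

text \<open>\<open>adapted\<close> speaks of Bochner integrals; for functions with values between
  \<open>0\<close> and \<open>1\<close> these can be exchanged for nonnegative integrals. Since the
  measures are concentrated on \<open>B1\<close>, the indicator can then be dropped.\<close>

lemma adapted_nn_integral:
  fixes Q :: "((real ^ 'n) measure \<times> (real ^ 'n)) measure"
  assumes Q: "restricted_CP b Q" and F: "F \<in> borel_measurable square_pair_borel"
  shows "(\<integral>\<^sup>+p. F p \<partial>Q) = (\<integral>\<^sup>+p. (\<integral>\<^sup>+x. F (fst p, x) \<partial>fst p) \<partial>Q)"
proof -
  have pQ: "prob_space Q" and sQ[measurable_cong]: "sets Q = sets square_pair_borel" and ad: "adapted Q"
    using Q by (auto simp: restricted_CP_def)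
  interpret prob_space Q by fact
  have spQ: "space Q = topspace square_topology \<times> B1"
    using sets_eq_imp_space_eq[OF sQ] by (simp add: topspace_square_pair)
  have rk: "radon_kernel Q fst"
    by (rule radon_kernel_measurable) measurable
  have "(\<integral>\<^sup>+p. F p \<partial>Q) = (\<integral>\<^sup>+p. (\<integral>\<^sup>+x. F (fst p, x) * indicator B1 x \<partial>fst p) \<partial>Q)"
  proof (rule adapted_extend[OF pulled_back_square_pair topspace_square_pair _ pQ sQ _ F])
    show "topspace square_topology \<subseteq> topspace (star_topology :: (real ^ 'n) measure topology)"
      by (auto simp: topspace_square topspace_star)
    fix h :: "(nat \<Rightarrow> real) \<times> (real ^ 'n) \<Rightarrow> real"
    assume h: "continuous_on UNIV h" "\<And>x. 0 \<le> h x" "\<And>x. h x \<le> 1"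
    have hm[measurable]: "h \<in> borel_measurable borel"
      by (rule borel_measurable_continuous_onI[OF h(1)])
    have hl[measurable]: "(\<lambda>p. h (emb (fst p), snd p)) \<in> borel_measurable Q"
      by measurable
    define N :: "(real ^ 'n) measure \<times> (real ^ 'n) \<Rightarrow> ennreal" where "N p = (\<integral>\<^sup>+x. ennreal (h (emb (fst p), x)) * indicator B1 x \<partial>fst p)" for p
    have Nm[measurable]: "N \<in> borel_measurable Q"
      unfolding N_def by (rule radon_kernel_nn_integral[OF rk]) measurable
    have N1: "N p \<le> 1" if "p \<in> space Q" for p
    proof -
      have "fst p \<in> radon" "emeasure (fst p) B1 = 1"
        using that by (auto simp: spQ topspace_square)
      moreover have "N p \<le> (\<integral>\<^sup>+x. indicator B1 x \<partial>fst p)"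
        unfolding N_def using h by (intro nn_integral_mono) (auto split: split_indicator)
      ultimately show ?thesis
        by (simp add: radon_sets)
    qed
    have inner: "(LINT x:B1|fst p. h (emb (fst p), x)) = enn2real (N p)" if "p \<in> space Q" for p
    proof -
      have "fst p \<in> radon"
        using that by (auto simp: spQ topspace_square)
      note [measurable_cong] = radon_sets[OF this]
      have "(LINT x:B1|fst p. h (emb (fst p), x)) = enn2real (\<integral>\<^sup>+x. ennreal (indicator B1 x *\<^sub>R h (emb (fst p), x)) \<partial>fst p)"
        unfolding set_lebesgue_integral_def
        by (rule integral_eq_nn_integral) (measurable, use h in auto)
      also have "(\<integral>\<^sup>+x. ennreal (indicator B1 x *\<^sub>R h (emb (fst p), x)) \<partial>fst p) = N p"
        unfolding N_def by (intro nn_integral_cong) (auto split: split_indicator)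
      finally show ?thesis .
    qed
    have "continuous_map square_pair_topology euclideanreal (\<lambda>p. h (emb_pair p))"
      by (rule continuous_map_pulled_back[OF pulled_back_square_pair h(1)])
    then have "(\<integral>p. h (emb_pair p) \<partial>Q) = (\<integral>p. (LINT x:B1|fst p. h (emb_pair (fst p, x))) \<partial>Q)"
      using ad by (auto simp: adapted_def)
    then have "(\<integral>p. h (emb (fst p), snd p) \<partial>Q) = (\<integral>p. enn2real (N p) \<partial>Q)"
      using inner by (simp add: case_prod_beta cong: Bochner_Integration.integral_cong)
    moreover have "(\<integral>p. h (emb (fst p), snd p) \<partial>Q) = enn2real (\<integral>\<^sup>+p. ennreal (h (emb (fst p), snd p)) \<partial>Q)"
      by (rule integral_eq_nn_integral) (use h in auto)
    moreover have "(\<integral>p. enn2real (N p) \<partial>Q) = enn2real (\<integral>\<^sup>+p. ennreal (enn2real (N p)) \<partial>Q)"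
      by (rule integral_eq_nn_integral) auto
    moreover have "(\<integral>\<^sup>+p. ennreal (enn2real (N p)) \<partial>Q) = (\<integral>\<^sup>+p. N p \<partial>Q)"
      using N1 by (intro nn_integral_cong ennreal_enn2real) (metis ennreal_one_less_top le_less_trans)
    ultimately have e: "enn2real (\<integral>\<^sup>+p. ennreal (h (emb (fst p), snd p)) \<partial>Q) = enn2real (\<integral>\<^sup>+p. N p \<partial>Q)"
      by simp
    have "(\<integral>\<^sup>+p. N p \<partial>Q) \<le> 1"
      using nn_integral_mono[of Q N "\<lambda>_. 1"] N1 emeasure_space_1 by simp
    moreover have "(\<integral>\<^sup>+p. ennreal (h (emb (fst p), snd p)) \<partial>Q) \<le> 1"
      using nn_integral_mono[of Q "\<lambda>p. ennreal (h (emb (fst p), snd p))" "\<lambda>_. 1"] h(3) emeasure_space_1 by simp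
    ultimately have top: "(\<integral>\<^sup>+p. N p \<partial>Q) < top" "(\<integral>\<^sup>+p. ennreal (h (emb (fst p), snd p)) \<partial>Q) < top"
      by - (erule le_less_trans[OF _ ennreal_one_less_top])+
    have "(\<integral>\<^sup>+p. ennreal (h (emb (fst p), snd p)) \<partial>Q) = (\<integral>\<^sup>+p. N p \<partial>Q)"
      by (rule trans[OF ennreal_enn2real[OF top(2), symmetric]]) (simp only: e ennreal_enn2real[OF top(1)])
    then show "(\<integral>\<^sup>+p. ennreal (h (emb (fst p), snd p)) \<partial>Q) =
        (\<integral>\<^sup>+p. (\<integral>\<^sup>+x. ennreal (h (emb (fst p), x)) * indicator B1 x \<partial>fst p) \<partial>Q)"
      by (simp add: N_def)
  qed
  also have "\<dots> = (\<integral>\<^sup>+p. (\<integral>\<^sup>+x. F (fst p, x) \<partial>fst p) \<partial>Q)"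
  proof (rule nn_integral_cong, rule nn_integral_cong_AE)
    fix p assume "p \<in> space Q"
    then have "emeasure (fst p) (- B1) = 0" "fst p \<in> radon"
      by (auto simp: spQ topspace_square)
    then have "- B1 \<in> null_sets (fst p)"
      by (auto simp: null_sets_def radon_sets)
    then have "AE x in fst p. x \<in> B1"
      by (rule AE_I') auto
    then show "AE x in fst p. F (fst p, x) * indicator B1 x = F (fst p, x)"
      by eventually_elim simp
  qed
  finally show ?thesis .
qed

section \<open>Magnification along the partition\<close>

lemma countable_range_ctr: "countable (range (ctr m :: real ^ 'n \<Rightarrow> _))"
proof -
  let ?G = "\<lambda>j :: 'n \<Rightarrow> int. (\<chi> i. (2 * of_int (j i) - real m + 1) / real m) :: real ^ 'n"
  have "range (ctr m :: real ^ 'n \<Rightarrow> _) \<subseteq> range ?G"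
    unfolding ctr_def by (intro image_subsetI) (auto intro!: image_eqI)
  then show ?thesis
    by (rule countable_subset) (rule countable_image, simp)
qed

lemma ctr_eq_borel: "{x. ctr m x = c} \<in> sets borel"
  by measurable

lemma ctr_count_space: "ctr m \<in> borel \<rightarrow>\<^sub>M count_space (range (ctr m))"
proof (subst measurable_count_space_eq_countable[OF countable_range_ctr], intro conjI ballI)
  fix c
  have "ctr m -` {c} = {x. ctr m x = c}" by auto
  then show "ctr m -` {c} \<inter> space borel \<in> sets borel"
    using ctr_eq_borel by simp
qed auto

lemma nn_integral_eq_partition:
  assumes C: "countable (range g)" and [measurable]: "f \<in> borel_measurable M" "f' \<in> borel_measurable M"
    and sets: "\<And>c. c \<in> range g \<Longrightarrow> {x \<in> space M. g x = c} \<in> sets M"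
    and eq: "\<And>c. c \<in> range g \<Longrightarrow> (\<integral>\<^sup>+x. f x * indicator {x \<in> space M. g x = c} x \<partial>M) =
      (\<integral>\<^sup>+x. f' x * indicator {x \<in> space M. g x = c} x \<partial>M)"
  shows "(\<integral>\<^sup>+x. f x \<partial>M) = (\<integral>\<^sup>+x. f' x \<partial>M)"
proof -
  have *: "(\<integral>\<^sup>+x. u x \<partial>M) = (\<integral>\<^sup>+c. (\<integral>\<^sup>+x. u x * indicator {x \<in> space M. g x = c} x \<partial>M) \<partial>count_space (range g))"
    if [measurable]: "u \<in> borel_measurable M" for u
  proof -
    have "(\<integral>\<^sup>+c. (\<integral>\<^sup>+x. u x * indicator {x \<in> space M. g x = c} x \<partial>M) \<partial>count_space (range g)) =
        (\<integral>\<^sup>+x. (\<integral>\<^sup>+c. u x * indicator {x \<in> space M. g x = c} x \<partial>count_space (range g)) \<partial>M)"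
      using sets by (intro nn_integral_count_space_nn_integral[OF C, symmetric] borel_measurable_times_ennreal) auto
    also have "\<dots> = (\<integral>\<^sup>+x. u x \<partial>M)"
    proof (rule nn_integral_cong)
      fix x assume x: "x \<in> space M"
      have "(\<integral>\<^sup>+c. u x * indicator {x \<in> space M. g x = c} x \<partial>count_space (range g)) =
          (\<integral>\<^sup>+c. u x * indicator {g x} c \<partial>count_space (range g))"
        using x by (intro nn_integral_cong) (auto split: split_indicator)
      also have "\<dots> = u x"
        by (simp add: nn_integral_cmult_indicator)
      finally show "(\<integral>\<^sup>+c. u x * indicator {x \<in> space M. g x = c} x \<partial>count_space (range g)) = u x" .
    qed
    finally show ?thesis ..
  qed
  show ?thesis
    unfolding *[OF assms(2)] *[OF assms(3)] by (rule nn_integral_cong) (rule eq, simp)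
qed

text \<open>The hypothesis \<open>faces\<close> is needed because \<^const>\<open>aff\<close> is normalised on the closed cube \<^const>\<open>B1\<close>, while
  cells are half-open.\<close>

lemma magnify_split:
  fixes \<Phi> :: "real ^ 'n \<Rightarrow> real ^ 'n \<Rightarrow> ennreal"
  assumes \<mu>: "\<mu> \<in> radon" and m: "m \<ge> 1" and [measurable]: "\<And>c. \<Phi> c \<in> borel_measurable borel"
    and faces: "AE x in \<mu>. emeasure \<mu> (amap (real m) (ctr m x) -` (B1 - half)) = 0"
  shows "(\<integral>\<^sup>+x. \<Phi> (ctr m x) (amap (real m) (ctr m x) x) \<partial>\<mu>) =
    (\<integral>\<^sup>+x. (\<integral>\<^sup>+y. \<Phi> (ctr m x) y * indicator B1 y \<partial>aff (real m) (ctr m x) \<mu>) \<partial>\<mu>)"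
proof (rule nn_integral_eq_partition[OF countable_range_ctr[of m]])
  note [measurable_cong] = radon_sets[OF \<mu>]
  have sp: "space \<mu> = UNIV" by (rule radon_space[OF \<mu>])
  have ctr_\<mu>: "ctr m \<in> \<mu> \<rightarrow>\<^sub>M count_space (range (ctr m))"
    using ctr_count_space[of m] unfolding measurable_cong_sets[OF radon_sets[OF \<mu>] refl] .
  show "(\<lambda>x. \<Phi> (ctr m x) (amap (real m) (ctr m x) x)) \<in> borel_measurable \<mu>"
    by (rule measurable_compose_countable'[OF _ ctr_\<mu> countable_range_ctr]) measurable
  show "(\<lambda>x. \<integral>\<^sup>+y. \<Phi> (ctr m x) y * indicator B1 y \<partial>aff (real m) (ctr m x) \<mu>) \<in> borel_measurable \<mu>"
    by (rule measurable_compose_countable'[OF _ ctr_\<mu> countable_range_ctr]) measurable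
  show "{x \<in> space \<mu>. ctr m x = c} \<in> sets \<mu>" for c :: "real ^ 'n"
    by measurable
  fix c :: "real ^ 'n" assume "c \<in> range (ctr m)"
  then obtain x0 where c: "c = ctr m x0" by auto
  let ?D = "{x \<in> space \<mu>. ctr m x = c}"
  let ?T = "amap (real m) c"
  have D: "?D = ?T -` half"
    using amap_ctr_mem_half[OF m] by (auto simp: sp c)
  have Ds: "?D \<in> sets \<mu>" by measurable
  show "(\<integral>\<^sup>+x. \<Phi> (ctr m x) (amap (real m) (ctr m x) x) * indicator ?D x \<partial>\<mu>) =
      (\<integral>\<^sup>+x. (\<integral>\<^sup>+y. \<Phi> (ctr m x) y * indicator B1 y \<partial>aff (real m) (ctr m x) \<mu>) * indicator ?D x \<partial>\<mu>)"
    (is "?L = ?R")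
  \<comment> \<open>On a null cell both sides vanish, and there \<open>faces\<close> gives no
    information.\<close>
  proof (cases "emeasure \<mu> ?D = 0")
    case True
    then have "AE x in \<mu>. x \<notin> ?D"
      using Ds by (intro AE_not_in) (auto simp: null_sets_def)
    then have "?L = (\<integral>\<^sup>+x. 0 \<partial>\<mu>)" "?R = (\<integral>\<^sup>+x. 0 \<partial>\<mu>)"
      by (intro nn_integral_cong_AE; eventually_elim; simp)+
    then show ?thesis by simp
  next
    case False
    have z: "emeasure \<mu> (?T -` (B1 - half)) = 0"
    proof (rule ccontr)
      assume nz: "emeasure \<mu> (?T -` (B1 - half)) \<noteq> 0"
      have "AE x in \<mu>. x \<notin> ?D"
        using faces by eventually_elim (use nz in auto)
      then have "?D \<in> null_sets \<mu>"
        using Ds by (simp add: AE_iff_null_sets)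
      then show False
        using False by auto
    qed
    have split: "?T -` B1 = ?D \<union> ?T -` (B1 - half)"
      using half_subset_B1 by (auto simp: D)
    \<comment> \<open>The normalising mass of the closed cube equals the mass of the half-open cell,
      so it cancels against the mass that the outer integral gives to the cell.\<close>
    have mass: "emeasure \<mu> (?T -` B1) = emeasure \<mu> ?D"
      unfolding split using z Ds
      by (intro emeasure_Un_null_set) (auto simp: null_sets_def radon_sets[OF \<mu>])
    have fin: "emeasure \<mu> ?D < \<infinity>"
      using emeasure_vimage_B1_finite[OF \<mu>, of "real m" c] m by (simp add: mass)
    have "?L = (\<integral>\<^sup>+x. \<Phi> c (?T x) * indicator ?D x \<partial>\<mu>)"
      by (intro nn_integral_cong) (auto split: split_indicator)
    also have "\<dots> = (\<integral>\<^sup>+x. \<Phi> c (?T x) * indicator B1 (?T x) \<partial>\<mu>)"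
    proof (rule nn_integral_cong_AE)
      have "AE x in \<mu>. x \<notin> ?T -` (B1 - half)"
        using z by (intro AE_not_in) (auto simp: null_sets_def radon_sets[OF \<mu>])
      then show "AE x in \<mu>. \<Phi> c (?T x) * indicator ?D x = \<Phi> c (?T x) * indicator B1 (?T x)"
        by eventually_elim (use half_subset_B1 in \<open>auto simp: D split: split_indicator\<close>)
    qed
    also have "\<dots> = emeasure \<mu> ?D * (1 / emeasure \<mu> ?D * (\<integral>\<^sup>+x. \<Phi> c (?T x) * indicator B1 (?T x) \<partial>\<mu>))"
    proof -
      have "emeasure \<mu> ?D * (1 / emeasure \<mu> ?D) = 1"
        using False fin by (simp add: ennreal_times_divide)
      then show ?thesis by (simp add: mult.assoc[symmetric])
    qed
    also have "1 / emeasure \<mu> ?D * (\<integral>\<^sup>+x. \<Phi> c (?T x) * indicator B1 (?T x) \<partial>\<mu>) =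
        (\<integral>\<^sup>+y. \<Phi> c y * indicator B1 y \<partial>aff (real m) c \<mu>)"
      by (subst nn_integral_aff[OF \<mu>]) (auto simp: mass)
    also have "emeasure \<mu> ?D * (\<integral>\<^sup>+y. \<Phi> c y * indicator B1 y \<partial>aff (real m) c \<mu>) =
        (\<integral>\<^sup>+x. (\<integral>\<^sup>+y. \<Phi> c y * indicator B1 y \<partial>aff (real m) c \<mu>) * indicator ?D x \<partial>\<mu>)"
      using Ds by (subst nn_integral_cmult_indicator) (auto simp: mult.commute)
    also have "\<dots> = ?R"
      by (intro nn_integral_cong) (auto split: split_indicator)
    finally show ?thesis .
  qed
qed


section \<open>The law of the extended process\<close>

lemma tendsto_fun_real:
  fixes f :: "nat \<Rightarrow> nat \<Rightarrow> real"
  assumes "\<And>k. (\<lambda>n. f n k) \<longlonglongrightarrow> l k"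
  shows "f \<longlonglongrightarrow> l"
proof -
  have "limitin (product_topology (\<lambda>_. euclidean) UNIV) f l sequentially"
    unfolding limitin_componentwise using assms by (auto simp: extensional_def)
  then show ?thesis
    by (simp add: euclidean_product_topology)
qed

context
  fixes b :: nat and \<nu> :: "(int \<Rightarrow> (real ^ 'n) measure \<times> (real ^ 'n)) \<Rightarrow> (real ^ 'n) measure" and \<omega>
  assumes b: "b \<ge> 1" and r: "regular b \<nu> \<omega>"
begin

text \<open>The cube of time \<open>- n\<close>, seen in the coordinates of time
  \<open>0\<close>.\<close>

definition blowup :: "nat \<Rightarrow> (real ^ 'n) set" where
  "blowup n = amap (real (b ^ n)) (ctr (b ^ n) (snd (\<omega> (- int n)))) ` B1"

lemma blowup_borel: "blowup n \<in> sets borel"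
proof -
  have "compact (blowup n)"
    unfolding blowup_def by (intro compact_continuous_image continuous_on_amap compact_B1)
  then show ?thesis
    by (simp add: compact_imp_closed)
qed

text \<open>The cube at time \<open>- n\<close> is the magnification of a closed cell contained in
  the cube one step earlier.\<close>

lemma blowup_Suc: "blowup n \<subseteq> blowup (Suc n)"
proof -
  note p = regular_path[OF b r]
  let ?x = "snd (\<omega> (- int (Suc n)))"
  let ?x' = "snd (\<omega> (- int n))"
  let ?S = "amap (real b) (ctr b ?x)"
  have x': "?x' = ?S ?x"
    using path_snd[OF b p, of "- int (Suc n)" 1] by simp
  have xh: "?x \<in> half"
    using p unfolding path_def by blast
  have T: "amap (real (b ^ n)) (ctr (b ^ n) ?x') (?S y) = amap (real (b ^ Suc n)) (ctr (b ^ Suc n) ?x) y" for y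
    unfolding x' using amap_ctr_mult[of "b ^ n" b ?x y] b by (simp add: mult.commute)
  have "B1 \<subseteq> ?S ` B1"
  proof
    fix y :: "real ^ 'n" assume y: "y \<in> B1"
    define z where "z = ctr b ?x + (1 / real b) *\<^sub>R y"
    have "?S z = y"
      using b by (simp add: z_def amap_def)
    then show "y \<in> ?S ` B1"
      using closed_cell_subset_B1[OF b xh] y by (intro image_eqI[of _ _ z]) auto
  qed
  then have "blowup n \<subseteq> (\<lambda>y. amap (real (b ^ n)) (ctr (b ^ n) ?x') (?S y)) ` B1"
    unfolding blowup_def by (auto simp: image_iff)
  then show ?thesis
    unfolding blowup_def T .
qed

text \<open>The limit measure at time \<open>0\<close> is the magnification of the limit measure at
  time \<open>- n\<close>, and the latter agrees with \<open>\<mu>\<close> on \<open>B1\<close>,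
  which contains the closed cell. Hence the normalisations coincide, and the vanishing of
  \<open>\<mu>\<close> outside \<open>B1\<close> produces the restriction.\<close>

lemma approximant_restrict:
  assumes A: "A \<in> sets borel"
  shows "emeasure (approximant b \<omega> n) A = emeasure (\<nu> \<omega>) (A \<inter> blowup n)"
proof -
  note p = regular_path[OF b r]
  let ?c = "ctr (b ^ n) (snd (\<omega> (- int n)))"
  let ?T = "amap (real (b ^ n)) ?c"
  define \<mu> where "\<mu> = fst (\<omega> (- int n))"
  define \<nu>' where "\<nu>' = \<nu> (shift_path (- int n) \<omega>)"
  have r': "regular b \<nu> (shift_path (- int n) \<omega>)"
    by (rule regular_shift[OF r])
  have on: "emeasure \<nu>' A = emeasure \<mu> A" if "A \<in> sets borel" "A \<subseteq> B1" for A
    using regular_on_B1[OF b r' that] by (simp add: \<mu>_def \<nu>'_def shift_path_def)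
  have \<nu>: "\<nu> \<omega> = aff (real (b ^ n)) ?c \<nu>'"
    using regular_steps[OF b r', of n] by (simp add: \<nu>'_def shift_path_add) (simp add: shift_path_def)
  have rad: "\<mu> \<in> radon" "\<nu>' \<in> radon"
    using path_radon[OF b p] regular_radon[OF b r'] by (auto simp: \<mu>_def \<nu>'_def)
  have "snd (\<omega> (- int n)) \<in> half"
    using p by (simp add: path_def)
  then have sub: "?T -` B1 \<subseteq> B1"
    using b by (intro closed_cell_subset_B1) auto
  have inj: "?T y = ?T z \<longleftrightarrow> y = z" for y z
    using b by (auto simp: amap_def)
  have vim: "?T -` (A \<inter> blowup n) = ?T -` A \<inter> B1"
    unfolding blowup_def using inj by auto
  have null: "- B1 \<in> null_sets \<mu>"
    using p rad(1) by (auto simp: path_def topspace_square null_sets_def radon_sets \<mu>_def)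
  have "emeasure \<mu> (?T -` A) = emeasure \<mu> (?T -` A \<inter> B1)"
    using emeasure_Diff_null_set[OF null, of "?T -` A"] A rad by (simp add: radon_sets Diff_eq)
  then show ?thesis
    using on[OF _ sub] on[of "?T -` A \<inter> B1"] A blowup_borel[of n]
    unfolding \<nu> emeasure_aff[OF rad(2) sets.Int[OF A blowup_borel]] vim
    by (simp add: approximant_eq[OF b] emeasure_aff[OF rad(1) A] flip: \<mu>_def)
qed

lemma approximant_density: "approximant b \<omega> n = density (\<nu> \<omega>) (indicator (blowup n))"
proof (rule measure_eqI)
  note rs = radon_sets[OF regular_radon[OF b r]]
  have sets: "sets (approximant b \<omega> n) = sets borel"
    by (simp add: approximant_eq[OF b] sets_aff)
  then show "sets (approximant b \<omega> n) = sets (density (\<nu> \<omega>) (indicator (blowup n)))"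
    by (simp add: rs)
  fix A assume "A \<in> sets (approximant b \<omega> n)"
  then show "emeasure (approximant b \<omega> n) A = emeasure (density (\<nu> \<omega>) (indicator (blowup n))) A"
    by (simp add: sets approximant_restrict emeasure_restricted blowup_borel rs Int_commute)
qed

text \<open>As restrictions of the limit measure to increasing sets that exhaust it, the
  approximants also converge weakly, by dominated convergence. This is the mode of convergence that
  continuous functions of a measure respect.\<close>

lemma emb_approximant: "(\<lambda>n. emb (approximant b \<omega> n)) \<longlonglongrightarrow> emb (\<nu> \<omega>)"
proof (rule tendsto_fun_real)
  fix k
  note [measurable_cong] = radon_sets[OF regular_radon[OF b r]]
  let ?g = "test_seq k :: real ^ 'n \<Rightarrow> real"
  have int: "integrable (\<nu> \<omega>) ?g"
    by (rule Cc_integrable[OF test_seq_Cc regular_radon[OF b r]])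
  note [measurable] = Cc_borel[OF test_seq_Cc[of k]] blowup_borel
  have "emb (approximant b \<omega> n) k = (\<integral>x. indicator (blowup n) x *\<^sub>R ?g x \<partial>\<nu> \<omega>)" for n
  proof -
    have "approximant b \<omega> n = density (\<nu> \<omega>) (\<lambda>x. ennreal (indicator (blowup n) x))"
      unfolding approximant_density by (simp add: ennreal_indicator)
    then show ?thesis
      unfolding emb_def by (simp only:) (rule integral_density; measurable; simp)
  qed
  moreover have "(\<lambda>n. \<integral>x. indicator (blowup n) x *\<^sub>R ?g x \<partial>\<nu> \<omega>) \<longlonglongrightarrow> (\<integral>x. ?g x \<partial>\<nu> \<omega>)"
  proof (rule integral_dominated_convergence[where w = "\<lambda>x. norm (?g x)"])
    show "AE x in \<nu> \<omega>. (\<lambda>n. indicator (blowup n) x *\<^sub>R ?g x) \<longlonglongrightarrow> ?g x"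
      using regular_union[OF b r]
    proof eventually_elim
      case (elim x)
      then obtain n where n: "x \<in> blowup n"
        by (auto simp: blowup_def)
      have "x \<in> blowup m" if "m \<ge> n" for m
        using lift_Suc_mono_le[of blowup n m] blowup_Suc n that by auto
      then have "eventually (\<lambda>m. indicator (blowup m) x *\<^sub>R ?g x = ?g x) sequentially"
        unfolding eventually_sequentially by (intro exI[of _ n]) simp
      then show ?case
        by (rule tendsto_eventually)
    qed
    show "AE x in \<nu> \<omega>. norm (indicator (blowup n) x *\<^sub>R ?g x) \<le> norm (?g x)" for n
      by (auto simp: indicator_def)
  qed (measurable, rule integrable_norm[OF int])
  ultimately show "(\<lambda>n. emb (approximant b \<omega> n) k) \<longlonglongrightarrow> emb (\<nu> \<omega>) k"
    by (simp add: emb_def)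
qed

end

lemma nn_integral_agree_on_B1:
  assumes "\<mu> \<in> radon" "\<nu> \<in> radon" and "\<And>A. A \<in> sets borel \<Longrightarrow> A \<subseteq> B1 \<Longrightarrow> emeasure \<mu> A = emeasure \<nu> A"
    and f: "f \<in> borel_measurable borel"
  shows "(\<integral>\<^sup>+x. f x * indicator B1 x \<partial>\<mu>) = (\<integral>\<^sup>+x. f x * indicator B1 x \<partial>\<nu>)"
proof -
  have "density \<mu> (indicator B1) = density \<nu> (indicator B1)"
    using assms by (intro measure_eqI) (auto simp: radon_sets emeasure_restricted)
  moreover have "(\<integral>\<^sup>+x. f x \<partial>density \<rho> (indicator B1)) = (\<integral>\<^sup>+x. f x * indicator B1 x \<partial>\<rho>)" if "\<rho> \<in> radon" for \<rho>
  proof -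
    note [measurable_cong] = radon_sets[OF that]
    note [measurable] = f
    show ?thesis
      by (subst nn_integral_density) (measurable, simp add: mult.commute)
  qed
  ultimately show ?thesis
    using assms by metis
qed

section \<open>Measurable dependence of affine images on their parameters\<close>

lemma pred_charged:
  fixes \<kappa> :: "'a \<Rightarrow> (real ^ 'n) measure"
  assumes \<kappa>: "radon_kernel M \<kappa>" and [measurable]: "a \<in> borel_measurable M" "z \<in> borel_measurable M"
  shows "{x \<in> space M. charged (a x) (z x) (\<kappa> x)} \<in> sets M"
proof -
  have "{p \<in> space (M \<Otimes>\<^sub>M borel). amap (a (fst p)) (z (fst p)) (snd p) \<in> B1} \<in> sets (M \<Otimes>\<^sub>M borel)"
    by measurable
  then have [measurable]: "(\<lambda>x. emeasure (\<kappa> x) {y. amap (a x) (z x) y \<in> B1}) \<in> borel_measurable M"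
    by (intro radon_kernel_emeasure[OF \<kappa>]) (simp add: space_pair_measure)
  have "{x \<in> space M. charged (a x) (z x) (\<kappa> x)} = {x \<in> space M. 0 < emeasure (\<kappa> x) {y. amap (a x) (z x) y \<in> B1}}"
    by (simp add: charged_def vimage_def)
  also have "\<dots> \<in> sets M"
    by measurable
  finally show ?thesis .
qed

lemma radon_kernel_restrict: "radon_kernel M \<kappa> \<Longrightarrow> radon_kernel (restrict_space M S) \<kappa>"
  by (auto simp: radon_kernel_def space_restrict_space intro: measurable_restrict_space1)

lemma radon_kernel_compose:
  assumes "radon_kernel N \<kappa>" "f \<in> M \<rightarrow>\<^sub>M N"
  shows "radon_kernel M (\<lambda>x. \<kappa> (f x))"
  using assms measurable_space[OF assms(2)] measurable_compose[OF assms(2)] by (auto simp: radon_kernel_def)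

text \<open>Off the charged set \<open>aff\<close> leaves the space of normalised measures, on which
  alone \<open>g\<close> is known to be measurable; the value \<open>0\<close> is put in its
  place.\<close>

lemma measurable_aff_If:
  fixes \<kappa> :: "'a \<Rightarrow> (real ^ 'n) measure"
  assumes \<kappa>: "radon_kernel M \<kappa>" and a: "a \<in> borel_measurable M" and z: "z \<in> borel_measurable M"
    and a0: "\<And>x. x \<in> space M \<Longrightarrow> a x \<noteq> 0"
    and g: "(\<lambda>p. g (fst p) (snd p)) \<in> borel_measurable (M \<Otimes>\<^sub>M star_borel)"
  shows "(\<lambda>x. if charged (a x) (z x) (\<kappa> x) then g x (aff (a x) (z x) (\<kappa> x)) else (0 :: ennreal)) \<in> borel_measurable M"
proof (subst measurable_If_restrict_space_iff[OF pred_charged[OF \<kappa> a z]], intro conjI)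
  let ?R = "restrict_space M {x. charged (a x) (z x) (\<kappa> x)}"
  have m: "(\<lambda>x. aff (a x) (z x) (\<kappa> x)) \<in> ?R \<rightarrow>\<^sub>M star_borel"
    using a z a0 by (intro measurable_aff radon_kernel_restrict[OF \<kappa>])
      (auto simp: space_restrict_space intro: measurable_restrict_space1)
  have "(\<lambda>x. (x, aff (a x) (z x) (\<kappa> x))) \<in> ?R \<rightarrow>\<^sub>M M \<Otimes>\<^sub>M star_borel"
    by (intro measurable_Pair measurable_restrict_space1 measurable_ident_sets m refl)
  from measurable_compose[OF this g]
  show "(\<lambda>x. g x (aff (a x) (z x) (\<kappa> x))) \<in> borel_measurable ?R"
    by simp
qed simp

section \<open>The stationary process and its almost sure limit\<close>

locale extended_process =
  fixes b :: nat and Q\<^sub>0 :: "((real ^ 'n) measure \<times> (real ^ 'n)) measure"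
    and \<Omega> :: "(int \<Rightarrow> (real ^ 'n) measure \<times> (real ^ 'n)) measure"
    and \<nu> :: "(int \<Rightarrow> (real ^ 'n) measure \<times> (real ^ 'n)) \<Rightarrow> (real ^ 'n) measure"
    and Q :: "((real ^ 'n) measure \<times> (real ^ 'n)) measure"
  assumes b2: "b \<ge> 2" and CP: "restricted_CP b Q\<^sub>0" and proc: "two_sided_process b Q\<^sub>0 \<Omega>"
    and \<nu>_m [measurable]: "\<nu> \<in> \<Omega> \<rightarrow>\<^sub>M star_borel"
    and lim: "AE \<omega> in \<Omega>. \<forall>A \<in> sets borel. (\<lambda>n. emeasure (approximant b \<omega> n) A) \<longlonglongrightarrow> emeasure (\<nu> \<omega>) A"
    and Q_def: "Q = distr \<Omega> star_pair_borel (\<lambda>\<omega>. (\<nu> \<omega>, snd (\<omega> 0)))"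
begin

lemma b1: "b \<ge> 1"
  using b2 by simp

lemma sets_\<Omega> [measurable_cong]: "sets \<Omega> = sets (\<Pi>\<^sub>M n\<in>UNIV. square_pair_borel)"
  using proc by (simp add: two_sided_process_def)

sublocale \<Omega>: prob_space \<Omega>
  using proc by (simp add: two_sided_process_def)

lemma space_\<Omega>: "space \<Omega> = UNIV \<rightarrow> topspace square_pair_topology"
  using sets_eq_imp_space_eq[OF sets_\<Omega>] by (auto simp: space_PiM)

lemma coord [measurable]: "(\<lambda>\<omega>. \<omega> n) \<in> \<Omega> \<rightarrow>\<^sub>M square_pair_borel"
  by (subst measurable_cong_sets[OF sets_\<Omega> refl]) (rule measurable_component_singleton, simp)

lemma shift_path_measurable [measurable]: "shift_path k \<in> \<Omega> \<rightarrow>\<^sub>M \<Omega>"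
proof -
  have "(\<lambda>\<omega> n. \<omega> (n + k)) \<in> \<Omega> \<rightarrow>\<^sub>M (\<Pi>\<^sub>M n\<in>UNIV. square_pair_borel)"
    by (rule measurable_PiM_single') (auto simp: space_\<Omega>)
  then show ?thesis
    by (simp add: shift_path_def[abs_def] measurable_cong_sets[OF refl sets_\<Omega>])
qed

lemma distr_shift: "distr \<Omega> \<Omega> (shift_path k) = \<Omega>"
proof -
  have "shift_path 0 = (\<lambda>\<omega>. \<omega> :: int \<Rightarrow> (real ^ 'n) measure \<times> (real ^ 'n))"
    by (simp add: shift_path_def fun_eq_iff)
  then have 0: "distr \<Omega> \<Omega> (shift_path 0) = \<Omega>"
    by (simp add: distr_id2)
  have 1: "distr \<Omega> \<Omega> (shift_path 1) = \<Omega>"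
    using proc by (simp add: two_sided_process_def shift_path_def[abs_def])
  have add: "distr \<Omega> \<Omega> (shift_path (k + l)) = distr (distr \<Omega> \<Omega> (shift_path l)) \<Omega> (shift_path k)" for k l
    by (subst distr_distr) (auto simp: comp_def shift_path_add)
  \<comment> \<open>Applying the inverse shift to the invariance under the forward shift gives
    invariance in the other direction.\<close>
  have m1: "distr \<Omega> \<Omega> (shift_path (- 1)) = \<Omega>"
  proof -
    have "distr \<Omega> \<Omega> (shift_path (- 1)) = distr \<Omega> \<Omega> (shift_path (- 1 + 1))"
      by (simp only: add 1)
    also have "\<dots> = \<Omega>"
      by (simp add: 0)
    finally show ?thesis .
  qed
  show ?thesis
  proof (induction k rule: int_induct[of _ 0])
    case base
    show ?case by (rule 0)
  next
    case (step1 i)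
    then show ?case using add[of 1 i] 1 by (simp add: add.commute)
  next
    case (step2 i)
    then show ?case using add[of "- 1" i] m1 by simp
  qed
qed

lemma AE_shift: "AE \<omega> in \<Omega>. P \<omega> \<Longrightarrow> AE \<omega> in \<Omega>. P (shift_path k \<omega>)"
  by (rule AE_distrD[OF shift_path_measurable[of k], unfolded distr_shift])

lemma distr_coord: "distr \<Omega> square_pair_borel (\<lambda>\<omega>. \<omega> n) = Q\<^sub>0"
proof -
  have "distr \<Omega> square_pair_borel (\<lambda>\<omega>. \<omega> n) = distr \<Omega> square_pair_borel ((\<lambda>\<omega>. \<omega> 0) \<circ> shift_path n)"
    by (simp add: comp_def shift_path_def)
  also have "\<dots> = distr (distr \<Omega> \<Omega> (shift_path n)) square_pair_borel (\<lambda>\<omega>. \<omega> 0)"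
    by (rule distr_distr[symmetric]) measurable
  finally show ?thesis
    using proc by (simp add: distr_shift two_sided_process_def)
qed

lemma nn_integral_coord:
  assumes "F \<in> borel_measurable square_pair_borel"
  shows "(\<integral>\<^sup>+\<omega>. F (\<omega> n) \<partial>\<Omega>) = (\<integral>\<^sup>+p. F p \<partial>Q\<^sub>0)"
  unfolding distr_coord[of n, symmetric] by (rule nn_integral_distr[OF coord, symmetric]) (simp add: assms)

lemma AE_path: "AE \<omega> in \<Omega>. path b \<omega>"
proof -
  have "AE \<omega> in \<Omega>. \<forall>n. \<omega> n \<in> cp_dom b \<and> \<omega> (n + 1) = cp_square b (\<omega> n)"
    using proc by (simp add: two_sided_process_def)
  then show ?thesis
    using AE_space
  proof eventually_elim
    case (elim \<omega>)
    \<comment> \<open>Each point is the image of its predecessor under the rescaling of the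
      predecessor's own cell; this is where the existence of a past is used.\<close>
    have "snd (\<omega> n) \<in> half" for n
    proof -
      have "\<omega> n = cp_square b (\<omega> (n - 1))"
        using elim(1)[rule_format, of "n - 1"] by simp
      then show ?thesis
        by (cases "\<omega> (n - 1)") (simp add: cp_square_eq[OF b1] amap_ctr_self[OF b1])
    qed
    moreover have "fst (\<omega> n) \<in> topspace square_topology" for n
      using elim(2) by (auto simp: space_\<Omega> Pi_iff topspace_square_pair mem_Times_iff)
    ultimately show ?case
      using elim(1) by (simp add: path_def)
  qed
qed

lemma AE_regular: "AE \<omega> in \<Omega>. regular b \<nu> \<omega>"
proof -
  have "AE \<omega> in \<Omega>. \<nu> \<omega> \<in> topspace star_topology"
    using AE_space by eventually_elim (use measurable_space[OF \<nu>_m] in auto)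
  with lim have *: "AE \<omega> in \<Omega>. \<nu> \<omega> \<in> topspace star_topology \<and>
      (\<forall>A \<in> sets borel. (\<lambda>n. emeasure (approximant b \<omega> n) A) \<longlonglongrightarrow> emeasure (\<nu> \<omega>) A)"
    by eventually_elim simp
  have "AE \<omega> in \<Omega>. \<forall>k. \<nu> (shift_path k \<omega>) \<in> topspace star_topology \<and>
      (\<forall>A \<in> sets borel. (\<lambda>n. emeasure (approximant b (shift_path k \<omega>) n) A) \<longlonglongrightarrow> emeasure (\<nu> (shift_path k \<omega>)) A)"
    unfolding AE_all_countable using AE_shift[OF *] by blast
  with AE_path show ?thesis
    by eventually_elim (simp add: regular_def)
qed

lemma pair_measurable [measurable]: "(\<lambda>\<omega>. (\<nu> \<omega>, snd (\<omega> 0))) \<in> \<Omega> \<rightarrow>\<^sub>M star_pair_borel"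
proof (rule measurable_into_star_pair)
  show "(\<lambda>\<omega>. snd (\<omega> 0)) \<in> \<Omega> \<rightarrow>\<^sub>M borel"
    by measurable
  show "snd (\<omega> 0) \<in> B1" if "\<omega> \<in> space \<Omega>" for \<omega>
    using that by (auto simp: space_\<Omega> Pi_iff topspace_square_pair mem_Times_iff)
qed measurable

lemma sets_Q [measurable_cong]: "sets Q = sets star_pair_borel"
  by (simp add: Q_def)

lemma space_Q: "space Q = topspace star_topology \<times> B1"
  by (simp add: Q_def topspace_star_pair)

sublocale Q: prob_space Q
  unfolding Q_def by (rule \<Omega>.prob_space_distr) measurable

lemma nn_integral_Q:
  assumes "F \<in> borel_measurable star_pair_borel"
  shows "(\<integral>\<^sup>+p. F p \<partial>Q) = (\<integral>\<^sup>+\<omega>. F (\<nu> \<omega>, snd (\<omega> 0)) \<partial>\<Omega>)"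
  unfolding Q_def by (rule nn_integral_distr[OF pair_measurable]) (simp add: assms)

text \<open>Points of the process are images under half-open cells, hence lie in \<^const>\<open>half\<close>; adaptedness transfers
  this to the measures.\<close>

lemma AE_upper_faces: "AE \<omega> in \<Omega>. emeasure (fst (\<omega> 0)) (B1 - half) = 0"
proof -
  have F: "(\<lambda>p. indicator (- half) (snd p) :: ennreal) \<in> borel_measurable square_pair_borel"
    by measurable
  have rk: "radon_kernel square_pair_borel fst"
    by (rule radon_kernel_measurable) measurable
  have "AE \<omega> in \<Omega>. indicator (- half) (snd (\<omega> 0)) = (0 :: ennreal)"
    using AE_path by eventually_elim (auto simp: path_def)
  then have "(\<integral>\<^sup>+\<omega>. indicator (- half) (snd (\<omega> 0)) \<partial>\<Omega>) = 0"
    by (subst nn_integral_0_iff_AE) measurable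
  then have "(\<integral>\<^sup>+p. (\<integral>\<^sup>+x. indicator (- half) x \<partial>fst p) \<partial>Q\<^sub>0) = 0"
    using nn_integral_coord[OF F, of 0] adapted_nn_integral[OF CP F] by simp
  moreover have m: "(\<lambda>p. \<integral>\<^sup>+x. indicator (- half) x \<partial>fst p) \<in> borel_measurable square_pair_borel"
    by (rule radon_kernel_nn_integral[OF rk]) measurable
  ultimately have "(\<integral>\<^sup>+\<omega>. (\<integral>\<^sup>+x. indicator (- half) x \<partial>fst (\<omega> 0)) \<partial>\<Omega>) = 0"
    using nn_integral_coord[OF m, of 0] by simp
  then have "AE \<omega> in \<Omega>. (\<integral>\<^sup>+x. indicator (- half) x \<partial>fst (\<omega> 0)) = 0"
    by (subst (asm) nn_integral_0_iff_AE) (rule measurable_compose[OF coord m])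
  then show ?thesis
    using AE_path
  proof eventually_elim
    case (elim \<omega>)
    have rad: "fst (\<omega> 0) \<in> radon"
      using elim(2) path_radon[OF b1] by blast
    have "emeasure (fst (\<omega> 0)) (B1 - half) \<le> emeasure (fst (\<omega> 0)) (- half)"
      by (intro emeasure_mono) (auto simp: radon_sets[OF rad])
    then show ?case
      using elim(1) by (simp add: radon_sets[OF rad])
  qed
qed

text \<open>The faces that the closed cell of the marked point adds at time \<open>- n\<close>
  become the upper faces of \<open>B1\<close> at time \<open>0\<close>, which are null by
  \<open>AE_upper_faces\<close>. Adaptedness then replaces the marked point by almost every point of
  the measure.\<close>

lemma faces:
  assumes m: "m = b ^ n"
  shows "AE p in Q\<^sub>0. AE x in fst p. emeasure (fst p) (amap (real m) (ctr m x) -` (B1 - half)) = 0"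
proof -
  let ?J = "\<lambda>p. emeasure (fst p) (amap (real m) (ctr m (snd p)) -` (B1 - half))"
  have rk: "radon_kernel square_pair_borel fst"
    by (rule radon_kernel_measurable) measurable
  have J: "?J \<in> borel_measurable square_pair_borel"
  proof -
    have "{q \<in> space (square_pair_borel \<Otimes>\<^sub>M borel). amap (real m) (ctr m (snd (fst q))) (snd q) \<in> B1 - half}
        \<in> sets (square_pair_borel \<Otimes>\<^sub>M borel)"
      by measurable
    then show ?thesis
      using radon_kernel_emeasure[OF rk, of "\<lambda>p y. amap (real m) (ctr m (snd p)) y \<in> B1 - half"]
      by (simp add: space_pair_measure vimage_def)
  qed
  have J2: "(\<lambda>q. emeasure (fst (fst q)) (amap (real m) (ctr m (snd q)) -` (B1 - half))) \<in> borel_measurable (Q\<^sub>0 \<Otimes>\<^sub>M borel)"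
  proof -
    have sQ0[measurable_cong]: "sets Q\<^sub>0 = sets square_pair_borel"
      using CP by (simp add: restricted_CP_def)
    have rk2: "radon_kernel (Q\<^sub>0 \<Otimes>\<^sub>M borel) (\<lambda>q. fst (fst q))"
      by (rule radon_kernel_measurable) measurable
    have "{q \<in> space ((Q\<^sub>0 \<Otimes>\<^sub>M borel) \<Otimes>\<^sub>M borel). amap (real m) (ctr m (snd (fst q))) (snd q) \<in> B1 - half}
        \<in> sets ((Q\<^sub>0 \<Otimes>\<^sub>M borel) \<Otimes>\<^sub>M borel)"
      by measurable
    then show ?thesis
      using radon_kernel_emeasure[OF rk2, of "\<lambda>q y. amap (real m) (ctr m (snd q)) y \<in> B1 - half"]
      by (simp add: space_pair_measure vimage_def)
  qed
  have "AE \<omega> in \<Omega>. ?J (\<omega> (- int n)) = 0"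
    using AE_path AE_upper_faces
  proof eventually_elim
    case (elim \<omega>)
    let ?p = "\<omega> (- int n)"
    have rad: "fst ?p \<in> radon"
      using elim(1) path_radon[OF b1] by blast
    have "emeasure (approximant b \<omega> n) (B1 - half) = 0"
      using approximant_on_B1[OF b1 elim(1), of "B1 - half"] elim(2) by simp
    moreover have "charged (real m) (ctr m (snd ?p)) (fst ?p)"
      using path_aff[OF b1 elim(1), of n "- int n"] by (simp add: m)
    then have "1 / emeasure (fst ?p) (amap (real m) (ctr m (snd ?p)) -` B1) \<noteq> 0"
      using amap_star_pos(1)[OF rad] b1 by (simp add: m)
    ultimately show ?case
      by (simp add: approximant_eq[OF b1] emeasure_aff[OF rad] flip: m)
  qed
  then have "(\<integral>\<^sup>+\<omega>. ?J (\<omega> (- int n)) \<partial>\<Omega>) = 0"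
    by (subst nn_integral_0_iff_AE[OF measurable_compose[OF coord J]])
  then have "(\<integral>\<^sup>+p. (\<integral>\<^sup>+x. emeasure (fst p) (amap (real m) (ctr m x) -` (B1 - half)) \<partial>fst p) \<partial>Q\<^sub>0) = 0"
    using nn_integral_coord[OF J, of "- int n"] adapted_nn_integral[OF CP J] by simp
  moreover have sQ0[measurable_cong]: "sets Q\<^sub>0 = sets square_pair_borel"
    using CP by (simp add: restricted_CP_def)
  have "(\<lambda>p. \<integral>\<^sup>+x. emeasure (fst p) (amap (real m) (ctr m x) -` (B1 - half)) \<partial>fst p) \<in> borel_measurable Q\<^sub>0"
    using rk J2 by (intro radon_kernel_nn_integral) (auto simp: case_prod_beta radon_kernel_def
        sets_eq_imp_space_eq[OF sQ0] measurable_cong_sets[OF sQ0 refl])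
  ultimately have "AE p in Q\<^sub>0. (\<integral>\<^sup>+x. emeasure (fst p) (amap (real m) (ctr m x) -` (B1 - half)) \<partial>fst p) = 0"
    by (simp add: nn_integral_0_iff_AE)
  then show ?thesis
    using AE_space
  proof eventually_elim
    case (elim p)
    have rad: "fst p \<in> radon"
      using elim(2) sets_eq_imp_space_eq[OF sQ0] by (auto simp: topspace_square_pair topspace_square)
    have "(\<lambda>x. emeasure (fst p) (amap (real m) (ctr m x) -` (B1 - half))) \<in> borel_measurable borel"
      using measurable_compose[OF measurable_Pair1'[OF elim(2)] J2] by simp
    then have "(\<lambda>x. emeasure (fst p) (amap (real m) (ctr m x) -` (B1 - half))) \<in> borel_measurable (fst p)"
      using measurable_cong_sets[OF radon_sets[OF rad] refl] by blast
    then show ?case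
      using elim(1) by (simp add: nn_integral_0_iff_AE)
  qed
qed

text \<open>Adaptedness of \<open>Q\<^sub>0\<close> at time \<open>- n\<close> and
  \<open>magnify_split\<close> allow the point to be redrawn from the magnified measure:
  \<open>U\<close> evaluates the test function at the actual point, \<open>V\<close> averages over
  the redrawn one. As \<open>n\<close> grows, the two integrals converge to the two sides of the
  claim.\<close>

lemma adapted_Q:
  fixes F :: "(real ^ 'n) measure \<times> (real ^ 'n) \<Rightarrow> ennreal"
  assumes F: "F \<in> borel_measurable star_pair_borel"
  shows "(\<integral>\<^sup>+p. F p \<partial>Q) = (\<integral>\<^sup>+p. (\<integral>\<^sup>+x. F (fst p, x) * indicator B1 x \<partial>fst p) \<partial>Q)"
proof (rule adapted_extend[OF pulled_back_star_pair topspace_star_pair order_refl Q.prob_space_axioms sets_Q _ F])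
  fix h :: "(nat \<Rightarrow> real) \<times> (real ^ 'n) \<Rightarrow> real"
  assume h: "continuous_on UNIV h" "\<And>x. 0 \<le> h x" "\<And>x. h x \<le> 1"
  have hm[measurable]: "h \<in> borel_measurable borel"
    by (rule borel_measurable_continuous_onI[OF h(1)])
  have sQ0[measurable_cong]: "sets Q\<^sub>0 = sets square_pair_borel"
    using CP by (simp add: restricted_CP_def)
  have rk: "radon_kernel square_pair_borel fst"
    by (rule radon_kernel_measurable) measurable
  \<comment> \<open>Uncharged centres get the value \<open>0\<close>; along a path this case does
    not occur.\<close>
  define H :: "nat \<Rightarrow> (real ^ 'n) measure \<Rightarrow> real ^ 'n \<Rightarrow> real ^ 'n \<Rightarrow> ennreal" where
    "H n \<mu> c y = (if charged (real (b ^ n)) c \<mu> then ennreal (h (emb (aff (real (b ^ n)) c \<mu>), y)) else 0)" for n \<mu> c y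
  have H1: "H n \<mu> c y \<le> 1" for n \<mu> c y
    using h by (simp add: H_def)
  have Hy: "H n \<mu> c \<in> borel_measurable borel" for n \<mu> c
    unfolding H_def by measurable
  have HM: "(\<lambda>q. H n (fst (fst q)) (ctr (b ^ n) (snd (fst q))) (snd q)) \<in> borel_measurable (square_pair_borel \<Otimes>\<^sub>M borel)" for n
  proof -
    have "radon_kernel (square_pair_borel \<Otimes>\<^sub>M borel) (\<lambda>q. fst (fst q))"
      by (rule radon_kernel_measurable) measurable
    moreover have "(\<lambda>p. ennreal (h (emb (snd p), snd (fst p)))) \<in> borel_measurable ((square_pair_borel \<Otimes>\<^sub>M borel) \<Otimes>\<^sub>M star_borel)"
      by measurable
    moreover have "(\<lambda>q. ctr (b ^ n) (snd (fst q))) \<in> borel_measurable (square_pair_borel \<Otimes>\<^sub>M borel)"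
      by measurable
    ultimately show ?thesis
      unfolding H_def using b1
      by (intro measurable_aff_If[where g = "\<lambda>q \<theta>. ennreal (h (emb \<theta>, snd q))"]) auto
  qed
  define U where "U n p = H n (fst p) (ctr (b ^ n) (snd p)) (amap (real (b ^ n)) (ctr (b ^ n) (snd p)) (snd p))" for n p
  define V where "V n p = (\<integral>\<^sup>+y. H n (fst p) (ctr (b ^ n) (snd p)) y * indicator B1 y \<partial>aff (real (b ^ n)) (ctr (b ^ n) (snd p)) (fst p))" for n p
  have Um: "U n \<in> borel_measurable square_pair_borel" for n
  proof -
    have "(\<lambda>p. (p, amap (real (b ^ n)) (ctr (b ^ n) (snd p)) (snd p))) \<in> square_pair_borel \<rightarrow>\<^sub>M square_pair_borel \<Otimes>\<^sub>M borel"
      by measurable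
    from measurable_compose[OF this HM[of n]] show ?thesis
      unfolding U_def[abs_def] by simp
  qed
  have Vm: "V n \<in> borel_measurable square_pair_borel" for n
  proof -
    define c where "c p = ctr (b ^ n) (snd p)" for p :: "(real ^ 'n) measure \<times> (real ^ 'n)"
    have [measurable]: "c \<in> borel_measurable square_pair_borel"
      unfolding c_def[abs_def] by measurable
    have "(\<lambda>q. (fst q, amap (real (b ^ n)) (c (fst q)) (snd q))) \<in> square_pair_borel \<Otimes>\<^sub>M borel \<rightarrow>\<^sub>M square_pair_borel \<Otimes>\<^sub>M borel"
      by measurable
    from measurable_compose[OF this HM[of n]]
    have [measurable]: "(\<lambda>q. H n (fst (fst q)) (c (fst q)) (amap (real (b ^ n)) (c (fst q)) (snd q)))
        \<in> borel_measurable (square_pair_borel \<Otimes>\<^sub>M borel)"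
      by (simp add: c_def)
    have [measurable]: "(\<lambda>p. emeasure (fst p) (amap (real (b ^ n)) (c p) -` B1)) \<in> borel_measurable square_pair_borel"
    proof -
      have "{q \<in> space (square_pair_borel \<Otimes>\<^sub>M borel). amap (real (b ^ n)) (c (fst q)) (snd q) \<in> B1}
          \<in> sets (square_pair_borel \<Otimes>\<^sub>M borel)"
        by measurable
      then show ?thesis
        using radon_kernel_emeasure[OF rk, of "\<lambda>p y. amap (real (b ^ n)) (c p) y \<in> B1"]
        by (simp add: space_pair_measure vimage_def)
    qed
    have [measurable]: "(\<lambda>p. \<integral>\<^sup>+y. H n (fst p) (c p) (amap (real (b ^ n)) (c p) y) * indicator B1 (amap (real (b ^ n)) (c p) y) \<partial>fst p)
        \<in> borel_measurable square_pair_borel"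
      by (rule radon_kernel_nn_integral[OF rk]) measurable
    have "(\<lambda>p. 1 / emeasure (fst p) (amap (real (b ^ n)) (c p) -` B1) *
        (\<integral>\<^sup>+y. H n (fst p) (c p) (amap (real (b ^ n)) (c p) y) * indicator B1 (amap (real (b ^ n)) (c p) y) \<partial>fst p))
        \<in> borel_measurable square_pair_borel"
      by measurable
    also have "?this \<longleftrightarrow> ?thesis"
    proof (rule measurable_cong)
      fix p :: "(real ^ 'n) measure \<times> (real ^ 'n)" assume "p \<in> space square_pair_borel"
      then have "fst p \<in> radon"
        by (auto simp: topspace_square_pair topspace_square)
      then show "1 / emeasure (fst p) (amap (real (b ^ n)) (c p) -` B1) *
        (\<integral>\<^sup>+y. H n (fst p) (c p) (amap (real (b ^ n)) (c p) y) * indicator B1 (amap (real (b ^ n)) (c p) y) \<partial>fst p) = V n p"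
        unfolding V_def c_def using Hy by (subst nn_integral_aff) auto
    qed
    finally show ?thesis .
  qed
  have UV: "(\<integral>\<^sup>+\<omega>. U n (\<omega> (- int n)) \<partial>\<Omega>) = (\<integral>\<^sup>+\<omega>. V n (\<omega> (- int n)) \<partial>\<Omega>)" for n
  proof -
    have "(\<integral>\<^sup>+\<omega>. U n (\<omega> (- int n)) \<partial>\<Omega>) = (\<integral>\<^sup>+p. (\<integral>\<^sup>+x. U n (fst p, x) \<partial>fst p) \<partial>Q\<^sub>0)"
      by (simp add: nn_integral_coord[OF Um] adapted_nn_integral[OF CP Um])
    also have "\<dots> = (\<integral>\<^sup>+p. (\<integral>\<^sup>+x. V n (fst p, x) \<partial>fst p) \<partial>Q\<^sub>0)"
    proof (rule nn_integral_cong_AE)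
      show "AE p in Q\<^sub>0. (\<integral>\<^sup>+x. U n (fst p, x) \<partial>fst p) = (\<integral>\<^sup>+x. V n (fst p, x) \<partial>fst p)"
        using faces[OF refl, of n] AE_space
      proof eventually_elim
        case (elim p)
        have rad: "fst p \<in> radon"
          using elim(2) sets_eq_imp_space_eq[OF sQ0] by (auto simp: topspace_square_pair topspace_square)
        show ?case
          unfolding U_def V_def fst_conv snd_conv using b1 elim(1)
          by (intro magnify_split[OF rad _ Hy]) auto
      qed
    qed
    also have "\<dots> = (\<integral>\<^sup>+\<omega>. V n (\<omega> (- int n)) \<partial>\<Omega>)"
      by (simp add: nn_integral_coord[OF Vm] adapted_nn_integral[OF CP Vm])
    finally show ?thesis .
  qed
  have hlim: "(\<lambda>n. ennreal (h (emb (approximant b \<omega> n), y))) \<longlonglongrightarrow> ennreal (h (emb (\<nu> \<omega>), y))" if "regular b \<nu> \<omega>" for \<omega> y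
  proof (intro tendsto_ennrealI)
    have "(\<lambda>n. (emb (approximant b \<omega> n), y)) \<longlonglongrightarrow> (emb (\<nu> \<omega>), y)"
      by (intro tendsto_Pair emb_approximant[OF b1 that] tendsto_const)
    then show "(\<lambda>n. h (emb (approximant b \<omega> n), y)) \<longlonglongrightarrow> h (emb (\<nu> \<omega>), y)"
      using continuous_on_tendsto_compose[OF h(1)] by auto
  qed
  have HA: "H n (fst (\<omega> (- int n))) (ctr (b ^ n) (snd (\<omega> (- int n)))) y = ennreal (h (emb (approximant b \<omega> n), y))"
    if "path b \<omega>" for n \<omega> y
    using path_aff[OF b1 that, of n "- int n"] by (simp add: H_def approximant_eq[OF b1])
  have Ulim: "(\<lambda>n. \<integral>\<^sup>+\<omega>. U n (\<omega> (- int n)) \<partial>\<Omega>) \<longlonglongrightarrow> (\<integral>\<^sup>+\<omega>. ennreal (h (emb (\<nu> \<omega>), snd (\<omega> 0))) \<partial>\<Omega>)"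
  proof (rule nn_integral_dominated_convergence[where w = "\<lambda>_. 1"])
    show "(\<lambda>\<omega>. U n (\<omega> (- int n))) \<in> borel_measurable \<Omega>" for n
      by (rule measurable_compose[OF coord Um])
    show "AE \<omega> in \<Omega>. (\<lambda>n. U n (\<omega> (- int n))) \<longlonglongrightarrow> ennreal (h (emb (\<nu> \<omega>), snd (\<omega> 0)))"
      using AE_regular
    proof eventually_elim
      case (elim \<omega>)
      note p = regular_path[OF b1 elim]
      have "U n (\<omega> (- int n)) = ennreal (h (emb (approximant b \<omega> n), snd (\<omega> 0)))" for n
        using path_snd[OF b1 p, of "- int n" n] by (simp add: U_def HA[OF p])
      then show ?case
        using hlim[OF elim] by simp
    qed
    show "AE \<omega> in \<Omega>. U n (\<omega> (- int n)) \<le> 1" for n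
      by (simp add: U_def H1)
  qed (auto simp: \<Omega>.emeasure_space_1)
  have Vlim: "(\<lambda>n. \<integral>\<^sup>+\<omega>. V n (\<omega> (- int n)) \<partial>\<Omega>) \<longlonglongrightarrow>
      (\<integral>\<^sup>+\<omega>. (\<integral>\<^sup>+x. ennreal (h (emb (\<nu> \<omega>), x)) * indicator B1 x \<partial>\<nu> \<omega>) \<partial>\<Omega>)"
  proof (rule nn_integral_dominated_convergence[where w = "\<lambda>_. 1"])
    show "(\<lambda>\<omega>. V n (\<omega> (- int n))) \<in> borel_measurable \<Omega>" for n
      by (rule measurable_compose[OF coord Vm])
    have "radon_kernel \<Omega> \<nu>"
      by (rule radon_kernel_measurable) measurable
    then show "(\<lambda>\<omega>. \<integral>\<^sup>+x. ennreal (h (emb (\<nu> \<omega>), x)) * indicator B1 x \<partial>\<nu> \<omega>) \<in> borel_measurable \<Omega>"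
      by (rule radon_kernel_nn_integral) measurable
    \<comment> \<open>Because of the indicator of \<open>B1\<close>, the integrating measure can be
      replaced by the fixed measure \<open>fst (\<omega> 0)\<close>. Only the integrand still
      depends on \<open>n\<close>, so dominated convergence applies.\<close>
    have eqV: "V n (\<omega> (- int n)) = (\<integral>\<^sup>+y. ennreal (h (emb (approximant b \<omega> n), y)) * indicator B1 y \<partial>fst (\<omega> 0))"
      if p: "path b \<omega>" for n \<omega>
    proof -
      have "approximant b \<omega> n \<in> radon"
        using aff_in_star[OF path_radon[OF b1 p], of "real (b ^ n)"] path_aff[OF b1 p, of n "- int n"] b1
        by (simp add: approximant_eq[OF b1] topspace_star)
      then have "(\<integral>\<^sup>+y. ennreal (h (emb (approximant b \<omega> n), y)) * indicator B1 y \<partial>approximant b \<omega> n) =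
          (\<integral>\<^sup>+y. ennreal (h (emb (approximant b \<omega> n), y)) * indicator B1 y \<partial>fst (\<omega> 0))"
        by (rule nn_integral_agree_on_B1[OF _ path_radon[OF b1 p]]) (auto simp: approximant_on_B1[OF b1 p])
      then show ?thesis
        unfolding V_def HA[OF p] approximant_eq[OF b1, symmetric] .
    qed
    show "AE \<omega> in \<Omega>. V n (\<omega> (- int n)) \<le> 1" for n
      using AE_path
    proof eventually_elim
      case (elim \<omega>)
      have "V n (\<omega> (- int n)) \<le> (\<integral>\<^sup>+y. indicator B1 y \<partial>fst (\<omega> 0))"
        unfolding eqV[OF elim] using h by (intro nn_integral_mono) (auto split: split_indicator)
      also have "\<dots> = 1"
        using elim path_radon[OF b1 elim, of 0] by (simp add: path_def topspace_square radon_sets)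
      finally show ?case .
    qed
    show "AE \<omega> in \<Omega>. (\<lambda>n. V n (\<omega> (- int n))) \<longlonglongrightarrow> (\<integral>\<^sup>+x. ennreal (h (emb (\<nu> \<omega>), x)) * indicator B1 x \<partial>\<nu> \<omega>)"
      using AE_regular
    proof eventually_elim
      case (elim \<omega>)
      note p = regular_path[OF b1 elim]
      note [measurable_cong] = radon_sets[OF path_radon[OF b1 p, of 0]]
      have "(\<lambda>n. V n (\<omega> (- int n))) \<longlonglongrightarrow> (\<integral>\<^sup>+x. ennreal (h (emb (\<nu> \<omega>), x)) * indicator B1 x \<partial>fst (\<omega> 0))"
        unfolding eqV[OF p]
      proof (rule nn_integral_dominated_convergence[where w = "indicator B1"])
        show "AE y in fst (\<omega> 0). (\<lambda>n. ennreal (h (emb (approximant b \<omega> n), y)) * indicator B1 y)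
            \<longlonglongrightarrow> ennreal (h (emb (\<nu> \<omega>), y)) * indicator B1 y"
          using hlim[OF elim] by (auto split: split_indicator)
        show "(\<integral>\<^sup>+y. indicator B1 y \<partial>fst (\<omega> 0)) < \<infinity>"
          using p by (simp add: path_def topspace_square)
      qed (measurable, use h in \<open>auto split: split_indicator\<close>)
      also have "(\<integral>\<^sup>+x. ennreal (h (emb (\<nu> \<omega>), x)) * indicator B1 x \<partial>fst (\<omega> 0)) =
          (\<integral>\<^sup>+x. ennreal (h (emb (\<nu> \<omega>), x)) * indicator B1 x \<partial>\<nu> \<omega>)"
        by (rule nn_integral_agree_on_B1[OF path_radon[OF b1 p] regular_radon[OF b1 elim]])
          (auto simp: regular_on_B1[OF b1 elim])
      finally show ?case .
    qed
  qed (auto simp: \<Omega>.emeasure_space_1)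
  have "(\<integral>\<^sup>+\<omega>. ennreal (h (emb (\<nu> \<omega>), snd (\<omega> 0))) \<partial>\<Omega>) =
      (\<integral>\<^sup>+\<omega>. (\<integral>\<^sup>+x. ennreal (h (emb (\<nu> \<omega>), x)) * indicator B1 x \<partial>\<nu> \<omega>) \<partial>\<Omega>)"
    using LIMSEQ_unique[OF Ulim Vlim[folded UV]] .
  moreover have "(\<lambda>p. \<integral>\<^sup>+x. ennreal (h (emb (fst p), x)) * indicator B1 x \<partial>fst p) \<in> borel_measurable star_pair_borel"
  proof (rule radon_kernel_nn_integral)
    show "radon_kernel star_pair_borel (fst :: (real ^ 'n) measure \<times> (real ^ 'n) \<Rightarrow> _)"
      by (rule radon_kernel_measurable) measurable
  qed measurable
  ultimately show "(\<integral>\<^sup>+p. ennreal (h (emb (fst p), snd p)) \<partial>Q) =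
      (\<integral>\<^sup>+p. (\<integral>\<^sup>+x. ennreal (h (emb (fst p), x)) * indicator B1 x \<partial>fst p) \<partial>Q)"
    by (simp add: nn_integral_Q)
qed

end


section \<open>The centered distribution\<close>

lemma nn_integral_push_on:
  assumes "D \<inter> space M \<in> sets M" "f \<in> restrict_space M D \<rightarrow>\<^sub>M N" "F \<in> borel_measurable N"
  shows "(\<integral>\<^sup>+y. F y \<partial>push_on D f M N) = (\<integral>\<^sup>+x. F (f x) * indicator D x \<partial>M)"
  unfolding push_on_def using assms by (subst nn_integral_distr) (auto simp: nn_integral_restrict_space)

lemma emeasure_push_on:
  assumes "D \<inter> space M \<in> sets M" "f \<in> restrict_space M D \<rightarrow>\<^sub>M N" "A \<in> sets N"
  shows "emeasure (push_on D f M N) A = (\<integral>\<^sup>+x. indicator A (f x) * indicator D x \<partial>M)"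
proof -
  have "emeasure (push_on D f M N) A = (\<integral>\<^sup>+y. indicator A y \<partial>push_on D f M N)"
    using assms(3) by (simp add: push_on_def)
  then show ?thesis
    using assms by (simp add: nn_integral_push_on)
qed

lemma measurable_on_indicator:
  fixes F :: "'b \<Rightarrow> ennreal"
  assumes "D \<inter> space M \<in> sets M" "f \<in> restrict_space M D \<rightarrow>\<^sub>M N" "F \<in> borel_measurable N"
  shows "(\<lambda>x. F (f x) * indicator D x) \<in> borel_measurable M"
  using measurable_compose[OF assms(2,3)] assms(1) by (simp add: borel_measurable_restrict_space_iff_ennreal)

lemma pred_msupp:
  fixes \<kappa> :: "'a \<Rightarrow> (real ^ 'n) measure"
  assumes \<kappa>: "radon_kernel M \<kappa>" and z: "z \<in> borel_measurable M"
  shows "{x \<in> space M. z x \<in> msupp (\<kappa> x)} \<in> sets M"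
proof -
  have "{x \<in> space M. z x \<in> msupp (\<kappa> x)} = {x \<in> space M. \<forall>k::nat. charged (real k + 1) (z x) (\<kappa> x)}"
    using \<kappa> msupp_iff_charged by (auto simp: radon_kernel_def)
  also have "\<dots> \<in> sets M"
    using pred_charged[OF \<kappa> _ z] by (intro sets.sets_Collect_countable_All) auto
  finally show ?thesis .
qed

lemma measurable_aff_msupp:
  fixes \<kappa> :: "'a \<Rightarrow> (real ^ 'n) measure"
  assumes \<kappa>: "radon_kernel M \<kappa>" and a: "a \<in> borel_measurable M" and z: "z \<in> borel_measurable M"
    and a0: "\<And>x. x \<in> space M \<Longrightarrow> a x \<noteq> 0"
    and D: "\<And>x. x \<in> space M \<Longrightarrow> x \<in> D \<Longrightarrow> z x \<in> msupp (\<kappa> x)"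
  shows "(\<lambda>x. aff (a x) (z x) (\<kappa> x)) \<in> restrict_space M D \<rightarrow>\<^sub>M star_borel"
proof (rule measurable_aff)
  fix x assume x: "x \<in> space (restrict_space M D)"
  then have "\<kappa> x \<in> radon" "z x \<in> msupp (\<kappa> x)"
    using \<kappa> D by (auto simp: space_restrict_space radon_kernel_def)
  then show "charged (a x) (z x) (\<kappa> x)"
    by (rule charged_msupp)
  show "a x \<noteq> 0"
    using x a0 by (auto simp: space_restrict_space)
qed (use \<kappa> a z in \<open>auto intro: radon_kernel_restrict measurable_restrict_space1\<close>)

lemma aff_notin_star:
  assumes "\<mu> \<in> radon" "\<not> charged a z \<mu>"
  shows "aff a z \<mu> \<notin> topspace star_topology"
  using assms by (auto simp: topspace_star emeasure_aff charged_def)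

lemma scale_star_measurable: "scale_star t \<in> restrict_space star_borel scale_dom \<rightarrow>\<^sub>M star_borel"
  unfolding scale_star_eq_aff[abs_def]
  by (rule measurable_aff_msupp) (auto simp: scale_dom_def intro!: radon_kernel_measurable)

lemma scale_dom_sets: "scale_dom \<inter> space star_borel \<in> sets star_borel"
proof -
  have "{\<mu> \<in> space star_borel. 0 \<in> msupp \<mu>} \<in> sets star_borel"
    by (rule pred_msupp) (auto intro!: radon_kernel_measurable)
  also have "{\<mu> \<in> space star_borel. 0 \<in> msupp \<mu>} = scale_dom \<inter> space star_borel"
    by (auto simp: scale_dom_def)
  finally show ?thesis .
qed

text \<open>The shift is reduced modulo \<open>c\<close>; the part of the window that then overhangs
  \<open>c\<close> is moved back by one period.\<close>

lemma nn_integral_periodic: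
  fixes k :: "real \<Rightarrow> ennreal"
  assumes [measurable]: "k \<in> borel_measurable borel" and c: "c > 0" and per: "\<And>s. k (s + c) = k s"
  shows "(\<integral>\<^sup>+r\<in>{0..<c}. k (t + r) \<partial>lborel) = (\<integral>\<^sup>+r\<in>{0..<c}. k r \<partial>lborel)"
proof -
  have shift: "(\<integral>\<^sup>+r. f r \<partial>lborel) = (\<integral>\<^sup>+r. f (u + r) \<partial>lborel)" if [measurable]: "f \<in> borel_measurable borel" for f :: "real \<Rightarrow> ennreal" and u
    using nn_integral_real_affine[of f 1 u] by simp
  have pern: "k (s + c * real n) = k s" for s n
  proof (induction n)
    case (Suc n)
    then show ?case using per[of "s + c * real n"] by (simp add: algebra_simps)
  qed simp
  have per_int: "k (s + c * of_int j) = k s" for s j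
  proof (cases "j \<ge> 0")
    case True
    then show ?thesis using pern[of s "nat j"] by simp
  next
    case False
    then show ?thesis using pern[of "s + c * of_int j" "nat (- j)"] by simp
  qed
  define t' where "t' = t - c * of_int \<lfloor>t / c\<rfloor>"
  have t': "0 \<le> t'" "t' < c"
  proof -
    have "of_int \<lfloor>t / c\<rfloor> \<le> t / c" "t / c < of_int \<lfloor>t / c\<rfloor> + 1"
      by linarith+
    then have "of_int \<lfloor>t / c\<rfloor> * c \<le> t" "t < (of_int \<lfloor>t / c\<rfloor> + 1) * c"
      using c by (simp_all only: pos_le_divide_eq pos_divide_less_eq)
    then show "0 \<le> t'" "t' < c"
      by (auto simp: t'_def algebra_simps)
  qed
  have "k (t + r) = k (t' + r)" for r
    using per_int[of "t' + r" "\<lfloor>t / c\<rfloor>"] by (simp add: t'_def algebra_simps)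
  then have "(\<integral>\<^sup>+r\<in>{0..<c}. k (t + r) \<partial>lborel) = (\<integral>\<^sup>+r. k (t' + r) * indicator {t'..<t' + c} (t' + r) \<partial>lborel)"
    by (intro nn_integral_cong) (auto split: split_indicator)
  also have "\<dots> = (\<integral>\<^sup>+s. k s * indicator {t'..<t' + c} s \<partial>lborel)"
    by (rule shift[symmetric]) measurable
  also have "\<dots> = (\<integral>\<^sup>+s. k s * indicator {t'..<c} s + k s * indicator {c..<t' + c} s \<partial>lborel)"
    using t' by (intro nn_integral_cong) (auto split: split_indicator)
  also have "\<dots> = (\<integral>\<^sup>+s. k s * indicator {t'..<c} s \<partial>lborel) + (\<integral>\<^sup>+s. k s * indicator {c..<t' + c} s \<partial>lborel)"
    by (rule nn_integral_add) measurable
  also have "(\<integral>\<^sup>+s. k s * indicator {c..<t' + c} s \<partial>lborel) = (\<integral>\<^sup>+s. k (c + s) * indicator {c..<t' + c} (c + s) \<partial>lborel)"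
    by (rule shift) measurable
  also have "\<dots> = (\<integral>\<^sup>+s. k s * indicator {0..<t'} s \<partial>lborel)"
    using per by (intro nn_integral_cong) (auto simp: add.commute split: split_indicator)
  also have "(\<integral>\<^sup>+s. k s * indicator {t'..<c} s \<partial>lborel) + (\<integral>\<^sup>+s. k s * indicator {0..<t'} s \<partial>lborel) =
      (\<integral>\<^sup>+s. k s * indicator {t'..<c} s + k s * indicator {0..<t'} s \<partial>lborel)"
    by (rule nn_integral_add[symmetric]) measurable
  also have "\<dots> = (\<integral>\<^sup>+r\<in>{0..<c}. k r \<partial>lborel)"
    using t' by (intro nn_integral_cong) (auto split: split_indicator)
  finally show ?thesis .
qed

section \<open>Centering and the magnification map\<close>

definition supp_dom :: "((real ^ 'n) measure \<times> (real ^ 'n)) set" where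
  "supp_dom = {(\<mu>, x). x \<in> msupp \<mu>}"

lemma cp_dom_sets: "b \<ge> 1 \<Longrightarrow> cp_dom b \<inter> space star_pair_borel \<in> sets star_pair_borel"
proof -
  assume b: "b \<ge> 1"
  have rk: "radon_kernel star_pair_borel fst"
    by (rule radon_kernel_measurable) measurable
  have "{q \<in> space (star_pair_borel \<Otimes>\<^sub>M borel). amap (real b) (ctr b (snd (fst q))) (snd q) \<in> half}
      \<in> sets (star_pair_borel \<Otimes>\<^sub>M borel)"
    by measurable
  then have [measurable]: "(\<lambda>p. emeasure (fst p) (amap (real b) (ctr b (snd p)) -` half)) \<in> borel_measurable star_pair_borel"
    using radon_kernel_emeasure[OF rk, of "\<lambda>p y. amap (real b) (ctr b (snd p)) y \<in> half"]
    by (simp add: space_pair_measure vimage_def)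
  have "cp_dom b \<inter> space star_pair_borel =
      {p \<in> space star_pair_borel. 0 < emeasure (fst p) (amap (real b) (ctr b (snd p)) -` half)}"
    by (auto simp: cp_dom_def cell_vimage[OF b])
  also have "\<dots> \<in> sets star_pair_borel"
    by measurable
  finally show ?thesis .
qed

lemma cp_star_fst_snd: "b \<ge> 1 \<Longrightarrow> cp_star b p = (aff (real b) (ctr b (snd p)) (fst p), amap (real b) (ctr b (snd p)) (snd p))"
  by (cases p) (simp add: cp_star_eq)

lemma cp_star_measurable:
  assumes b: "b \<ge> 1"
  shows "(cp_star b :: (real ^ 'n) measure \<times> (real ^ 'n) \<Rightarrow> _) \<in> restrict_space star_pair_borel (cp_dom b) \<rightarrow>\<^sub>M star_pair_borel"
  unfolding cp_star_fst_snd[OF b, abs_def]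
proof (rule measurable_into_star_pair)
  let ?R = "restrict_space (star_pair_borel :: ((real ^ 'n) measure \<times> (real ^ 'n)) measure) (cp_dom b)"
  have rk: "radon_kernel ?R fst"
    by (intro radon_kernel_restrict radon_kernel_measurable) measurable
  have [measurable]: "snd \<in> ?R \<rightarrow>\<^sub>M borel"
    by (rule measurable_restrict_space1) measurable
  show "(\<lambda>p. amap (real b) (ctr b (snd p)) (snd p)) \<in> borel_measurable ?R"
    by measurable
  show "(\<lambda>p. aff (real b) (ctr b (snd p)) (fst p)) \<in> ?R \<rightarrow>\<^sub>M star_borel"
  proof (rule measurable_aff[OF rk])
    fix p :: "(real ^ 'n) measure \<times> (real ^ 'n)" assume "p \<in> space ?R"
    then show "charged (real b) (ctr b (snd p)) (fst p)"
      by (intro charged_cell[OF _ b])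
        (auto simp: space_restrict_space cp_dom_def topspace_star_pair topspace_star)
  next
    show "(\<lambda>p. ctr b (snd p)) \<in> borel_measurable ?R"
      by measurable
  qed (use b in auto)
  show "amap (real b) (ctr b (snd p)) (snd p) \<in> B1" for p
    using amap_ctr_self[OF b] half_subset_B1 by auto
qed

text \<open>The new marked point is the image of the old one under the magnification, so centering
  there undoes the translation and only the factor \<open>b\<close> in the scale remains. Membership
  in the support is preserved for the same reason.\<close>

lemma cp_star_aff:
  assumes b: "b \<ge> 1" and p: "fst p \<in> radon" "p \<in> cp_dom b"
  shows "aff a (snd (cp_star b p)) (fst (cp_star b p)) = aff (a * real b) (snd p) (fst p)"
    and "cp_star b p \<in> supp_dom \<longleftrightarrow> p \<in> supp_dom"
proof -
  have ch: "charged (real b) (ctr b (snd p)) (fst p)"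
    using p by (intro charged_cell[OF _ b]) (auto simp: cp_dom_def)
  have *: "ctr b (snd p) + (1 / real b) *\<^sub>R amap (real b) (ctr b (snd p)) (snd p) = snd p"
    using b by (simp add: amap_def)
  show "aff a (snd (cp_star b p)) (fst (cp_star b p)) = aff (a * real b) (snd p) (fst p)"
    using aff_aff[OF p(1) _ ch, of a "amap (real b) (ctr b (snd p)) (snd p)"] b
    by (simp only: cp_star_fst_snd[OF b] fst_conv snd_conv * of_nat_0_eq_iff)
  show "cp_star b p \<in> supp_dom \<longleftrightarrow> p \<in> supp_dom"
    using msupp_aff[OF p(1) _ ch, of "amap (real b) (ctr b (snd p)) (snd p)"] b
    unfolding * by (simp add: cp_star_fst_snd[OF b] supp_dom_def case_prod_beta)
qed

lemma scale_aff:
  assumes "\<mu> \<in> radon" "x \<in> msupp \<mu>" "a > 0"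
  shows "scale_star t (aff a x \<mu>) = aff (exp t * a) x \<mu>" "aff a x \<mu> \<in> scale_dom"
    "aff a x \<mu> \<in> topspace star_topology"
  using assms aff_aff[OF assms(1) _ charged_msupp[OF assms(1,2)], of a "exp t" 0]
    msupp_aff[OF assms(1) _ charged_msupp[OF assms(1,2)], of a 0]
    aff_in_star[OF assms(1) _ charged_msupp[OF assms(1,2)], of a]
  by (auto simp: scale_star_eq_aff scale_dom_def)

context extended_process
begin

lemma radon_Q: "p \<in> space Q \<Longrightarrow> fst p \<in> radon"
  by (auto simp: space_Q topspace_star)

lemma measurable_Q_eq: "Q \<rightarrow>\<^sub>M N = star_pair_borel \<rightarrow>\<^sub>M N"
  by (rule measurable_cong_sets[OF sets_Q refl])

lemma cp_dom_Q: "cp_dom b \<inter> space Q \<in> sets Q"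
  using cp_dom_sets[OF b1] sets_eq_imp_space_eq[OF sets_Q] by (simp add: sets_Q)

lemma cp_star_Q: "cp_star b \<in> restrict_space Q (cp_dom b) \<rightarrow>\<^sub>M Q"
  using cp_star_measurable[OF b1] measurable_cong_sets[OF sets_restrict_space_cong[OF sets_Q] sets_Q] by blast

lemma AE_Q:
  assumes "{p \<in> space Q. P p} \<in> sets Q" "AE \<omega> in \<Omega>. P (\<nu> \<omega>, snd (\<omega> 0))"
  shows "AE p in Q. P p"
  using AE_distr_iff[OF pair_measurable, of P] assms unfolding Q_def by simp

lemma AE_cp_dom: "AE p in Q. p \<in> cp_dom b"
proof (rule AE_Q)
  show "{p \<in> space Q. p \<in> cp_dom b} \<in> sets Q"
    using cp_dom_Q by (simp add: Int_def conj_commute)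
  show "AE \<omega> in \<Omega>. (\<nu> \<omega>, snd (\<omega> 0)) \<in> cp_dom b"
    using AE_regular by eventually_elim (rule regular_cp_dom[OF b1])
qed

text \<open>Along a regular path \<open>cp_star\<close> acts as the shift by one, so invariance of
  \<open>Q\<close> is stationarity of the process.\<close>

lemma nn_integral_cp_star:
  assumes F: "F \<in> borel_measurable Q"
  shows "(\<integral>\<^sup>+p. F (cp_star b p) * indicator (cp_dom b) p \<partial>Q) = (\<integral>\<^sup>+p. F p \<partial>Q)"
proof -
  have F': "F \<in> borel_measurable star_pair_borel"
    using F by (simp add: measurable_Q_eq)
  have m: "(\<lambda>p. F (cp_star b p) * indicator (cp_dom b) p) \<in> borel_measurable star_pair_borel"
    using measurable_on_indicator[OF cp_dom_Q cp_star_Q F] by (simp add: measurable_Q_eq)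
  have "(\<integral>\<^sup>+p. F (cp_star b p) * indicator (cp_dom b) p \<partial>Q) =
      (\<integral>\<^sup>+\<omega>. F (cp_star b (\<nu> \<omega>, snd (\<omega> 0))) * indicator (cp_dom b) (\<nu> \<omega>, snd (\<omega> 0)) \<partial>\<Omega>)"
    by (rule nn_integral_Q[OF m])
  also have "\<dots> = (\<integral>\<^sup>+\<omega>. F (\<nu> (shift_path 1 \<omega>), snd (shift_path 1 \<omega> 0)) \<partial>\<Omega>)"
  proof (rule nn_integral_cong_AE)
    show "AE \<omega> in \<Omega>. F (cp_star b (\<nu> \<omega>, snd (\<omega> 0))) * indicator (cp_dom b) (\<nu> \<omega>, snd (\<omega> 0)) =
        F (\<nu> (shift_path 1 \<omega>), snd (shift_path 1 \<omega> 0))"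
      using AE_regular
    proof eventually_elim
      case (elim \<omega>)
      then show ?case
        using regular_step[OF b1 elim] regular_cp_dom[OF b1 elim] by (simp add: shift_path_def)
    qed
  qed
  also have "\<dots> = (\<integral>\<^sup>+\<omega>. F (\<nu> \<omega>, snd (\<omega> 0)) \<partial>distr \<Omega> \<Omega> (shift_path 1))"
    using measurable_compose[OF pair_measurable F'] by (subst nn_integral_distr[OF shift_path_measurable]) auto
  also have "\<dots> = (\<integral>\<^sup>+p. F p \<partial>Q)"
    by (simp add: distr_shift nn_integral_Q[OF F'])
  finally show ?thesis .
qed

lemma invariant_cp_star: "invariant_on Q (cp_dom b) (cp_star b)"
  unfolding invariant_on_def
proof (intro conjI cp_dom_Q AE_cp_dom cp_star_Q)
  show "push_on (cp_dom b) (cp_star b) Q Q = Q"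
  proof (rule measure_eqI)
    fix A assume "A \<in> sets (push_on (cp_dom b) (cp_star b) Q Q)"
    then have A: "A \<in> sets Q" by (simp add: push_on_def)
    have "emeasure (push_on (cp_dom b) (cp_star b) Q Q) A = (\<integral>\<^sup>+p. indicator A p \<partial>Q)"
      unfolding emeasure_push_on[OF cp_dom_Q cp_star_Q A] by (rule nn_integral_cp_star) (use A in simp)
    then show "emeasure (push_on (cp_dom b) (cp_star b) Q Q) A = emeasure Q A"
      using A by simp
  qed (simp add: push_on_def)
qed

lemma rk_Q: "radon_kernel Q fst"
  by (rule radon_kernel_measurable) measurable

lemma supp_dom_Q: "supp_dom \<inter> space Q \<in> sets Q"
proof -
  have "{p \<in> space Q. snd p \<in> msupp (fst p)} \<in> sets Q"
    by (rule pred_msupp[OF rk_Q]) measurable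
  also have "{p \<in> space Q. snd p \<in> msupp (fst p)} = supp_dom \<inter> space Q"
    by (auto simp: supp_dom_def)
  finally show ?thesis .
qed

text \<open>Adaptedness replaces the marked point by a point drawn from the measure, and almost
  every such point lies in the support.\<close>

lemma AE_supp_dom: "AE p in Q. p \<in> supp_dom"
proof -
  have S: "space Q - supp_dom \<in> sets Q"
    using sets.compl_sets[OF supp_dom_Q] by (simp add: Diff_Int)
  then have F: "indicator (space Q - supp_dom) \<in> borel_measurable star_pair_borel"
    by (simp flip: measurable_Q_eq)
  have "emeasure Q (space Q - supp_dom) = (\<integral>\<^sup>+p. indicator (space Q - supp_dom) p \<partial>Q)"
    using S by simp
  also have "\<dots> = (\<integral>\<^sup>+p. (\<integral>\<^sup>+x. indicator (space Q - supp_dom) (fst p, x) * indicator B1 x \<partial>fst p) \<partial>Q)"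
    by (rule adapted_Q[OF F])
  also have "\<dots> = (\<integral>\<^sup>+p. (\<integral>\<^sup>+x. 0 \<partial>fst p) \<partial>Q)"
  proof (rule nn_integral_cong, rule nn_integral_cong_AE)
    fix p assume "p \<in> space Q"
    show "AE x in fst p. indicator (space Q - supp_dom) (fst p, x) * indicator B1 x = (0 :: ennreal)"
      using AE_msupp[OF radon_Q[OF \<open>p \<in> space Q\<close>]]
      by eventually_elim (simp add: supp_dom_def split: split_indicator)
  qed
  finally have "space Q - supp_dom \<in> null_sets Q"
    using S by (simp add: null_sets_def)
  then show ?thesis
    by (rule AE_I') auto
qed

text \<open>For \<open>a = exp t\<close> this is the integral of \<open>G\<close> against
  \<open>cent0 Q\<close> scaled by \<open>t\<close>. The multiplicative parameter turns
  magnification into multiplication by \<open>b\<close>.\<close>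

definition cent_integral :: "((real ^ 'n) measure \<Rightarrow> ennreal) \<Rightarrow> real \<Rightarrow> ennreal" where
  "cent_integral G a = (\<integral>\<^sup>+p. G (aff a (snd p) (fst p)) * indicator supp_dom p \<partial>Q)"

lemma aff_Q: "a \<noteq> 0 \<Longrightarrow> (\<lambda>p. aff a (snd p) (fst p)) \<in> restrict_space Q supp_dom \<rightarrow>\<^sub>M star_borel"
  by (rule measurable_aff_msupp[OF rk_Q]) (auto simp: supp_dom_def)

lemma cent_integral_measurable:
  fixes G :: "(real ^ 'n) measure \<Rightarrow> ennreal"
  assumes G: "G \<in> borel_measurable star_borel"
  shows "(\<lambda>(r, p). G (aff (exp r) (snd p) (fst p)) * indicator supp_dom p) \<in> borel_measurable (borel \<Otimes>\<^sub>M Q)"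
proof -
  let ?M = "borel \<Otimes>\<^sub>M Q :: (real \<times> ((real ^ 'n) measure \<times> (real ^ 'n))) measure"
  have D: "(UNIV \<times> supp_dom) \<inter> space ?M \<in> sets ?M"
  proof -
    have "(UNIV \<times> supp_dom) \<inter> space ?M = UNIV \<times> (supp_dom \<inter> space Q)"
      by (auto simp: space_pair_measure)
    then show ?thesis
      using supp_dom_Q by simp
  qed
  have "(\<lambda>q. aff (exp (fst q)) (snd (snd q)) (fst (snd q))) \<in> restrict_space ?M (UNIV \<times> supp_dom) \<rightarrow>\<^sub>M star_borel"
    by (rule measurable_aff_msupp) (auto simp: supp_dom_def intro!: radon_kernel_compose[OF rk_Q])
  from measurable_on_indicator[OF D this G]
  have "(\<lambda>q. G (aff (exp (fst q)) (snd (snd q)) (fst (snd q))) * indicator (UNIV \<times> supp_dom) q) \<in> borel_measurable ?M" .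
  also have "(\<lambda>q. G (aff (exp (fst q)) (snd (snd q)) (fst (snd q))) * indicator (UNIV \<times> supp_dom) q) =
      (\<lambda>(r, p). G (aff (exp r) (snd p) (fst p)) * indicator supp_dom p)"
    by (auto simp: fun_eq_iff split: split_indicator)
  finally show ?thesis .
qed

lemma cent_integral_exp_measurable [measurable]:
  "G \<in> borel_measurable star_borel \<Longrightarrow> (\<lambda>r. cent_integral G (exp r)) \<in> borel_measurable borel"
  unfolding cent_integral_def by (rule Q.borel_measurable_nn_integral[OF cent_integral_measurable])

text \<open>Invariance under \<open>cp_star\<close> makes the integral periodic in the logarithm of
  the scale, with period \<open>ln b\<close>, the length of the averaging interval in
  \<open>cent\<close>.\<close>

lemma cent_integral_mult_b:
  assumes G: "G \<in> borel_measurable star_borel" and a: "a > 0"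
  shows "cent_integral G (a * real b) = cent_integral G a"
proof -
  let ?F = "\<lambda>p. G (aff a (snd p) (fst p)) * indicator supp_dom p"
  have F: "?F \<in> borel_measurable Q"
    using a by (intro measurable_on_indicator[OF supp_dom_Q aff_Q G]) simp
  have "cent_integral G a = (\<integral>\<^sup>+p. ?F (cp_star b p) * indicator (cp_dom b) p \<partial>Q)"
    unfolding cent_integral_def by (rule nn_integral_cp_star[OF F, symmetric])
  also have "\<dots> = cent_integral G (a * real b)"
    unfolding cent_integral_def
  proof (rule nn_integral_cong_AE)
    show "AE p in Q. ?F (cp_star b p) * indicator (cp_dom b) p =
        G (aff (a * real b) (snd p) (fst p)) * indicator supp_dom p"
      using AE_cp_dom AE_space
    proof eventually_elim
      case (elim p)
      have "fst p \<in> radon" using elim radon_Q by simp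
      then show ?case
        using cp_star_aff[OF b1 _ elim(1)] elim(1) by (auto split: split_indicator)
    qed
  qed
  finally show ?thesis ..
qed

abbreviation height :: real where
  "height \<equiv> ln (real b)"

lemma height_pos: "height > 0"
  using b2 by simp

lemma exp_height: "exp height = real b"
  using b2 by simp

lemma cent_integral_scale:
  assumes "a > 0"
  shows "cent_integral (\<lambda>\<theta>. G (scale_star t \<theta>) * indicator scale_dom \<theta>) a = cent_integral G (exp t * a)"
  unfolding cent_integral_def
proof (rule nn_integral_cong)
  fix p assume "p \<in> space Q"
  then have rad: "fst p \<in> radon" by (rule radon_Q)
  show "G (scale_star t (aff a (snd p) (fst p))) * indicator scale_dom (aff a (snd p) (fst p)) * indicator supp_dom p =
      G (aff (exp t * a) (snd p) (fst p)) * indicator supp_dom p"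
  proof (cases "p \<in> supp_dom")
    case True
    then have "snd p \<in> msupp (fst p)"
      by (auto simp: supp_dom_def)
    then show ?thesis
      using scale_aff[OF rad _ assms] by simp
  qed simp
qed

lemma sets_cent0: "sets (cent0 Q) = sets star_borel"
  by (simp add: cent0_def push_on_def)

lemma nn_integral_cent0:
  assumes "G \<in> borel_measurable star_borel"
  shows "(\<integral>\<^sup>+\<theta>. G \<theta> \<partial>cent0 Q) = cent_integral G 1"
proof -
  have *: "(\<lambda>(\<mu>, x). translate_star x \<mu>) = (\<lambda>p. aff 1 (snd p) (fst p))"
    by (auto simp: fun_eq_iff translate_star_eq_aff)
  show ?thesis
    unfolding cent0_def * supp_dom_def[symmetric] cent_integral_def
    by (rule nn_integral_push_on[OF supp_dom_Q aff_Q assms]) simp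
qed

lemma emeasure_scaled_cent0:
  assumes A: "A \<in> sets star_borel"
  shows "emeasure (push_on scale_dom (scale_star t) (cent0 Q) star_borel) A = cent_integral (indicator A) (exp t)"
proof -
  have sp: "space (cent0 Q) = space star_borel"
    using sets_eq_imp_space_eq[OF sets_cent0] .
  have D: "scale_dom \<inter> space (cent0 Q) \<in> sets (cent0 Q)"
    using scale_dom_sets by (simp add: sp sets_cent0)
  have f: "scale_star t \<in> restrict_space (cent0 Q) scale_dom \<rightarrow>\<^sub>M star_borel"
    using scale_star_measurable[of t] measurable_cong_sets[OF sets_restrict_space_cong[OF sets_cent0] refl] by blast
  have "(\<lambda>\<theta>. indicator A (scale_star t \<theta>) * indicator scale_dom \<theta> :: ennreal) \<in> borel_measurable star_borel"
    using A by (intro measurable_on_indicator[OF scale_dom_sets scale_star_measurable]) simp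
  then show ?thesis
    using cent_integral_scale[of 1 "indicator A" t] by (simp add: emeasure_push_on[OF D f A] nn_integral_cent0)
qed

abbreviation clock :: "real measure" where
  "clock \<equiv> uniform_measure (restrict_space lborel {0..<height}) {0..<height}"

lemma emeasure_clock_base: "emeasure (restrict_space lborel {0..<height}) {0..<height} = ennreal height"
  using height_pos by (subst emeasure_restrict_space) auto

sublocale clock: prob_space clock
  using height_pos by (intro prob_space_uniform_measure) (simp_all add: emeasure_clock_base)

lemma space_clock: "space clock = {0..<height}"
  by (simp add: space_restrict_space)

lemma sets_clock: "sets clock = sets (restrict_space borel {0..<height})"
  by (simp add: sets_restrict_space)

lemma clock_measurable: "f \<in> borel_measurable borel \<Longrightarrow> f \<in> borel_measurable clock"
  by (subst measurable_cong_sets[OF sets_clock refl]) (rule measurable_restrict_space1)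

lemma nn_integral_clock:
  assumes f: "f \<in> borel_measurable borel"
  shows "(\<integral>\<^sup>+r. f r \<partial>clock) = (\<integral>\<^sup>+r\<in>{0..<height}. f r \<partial>lborel) / ennreal height"
proof -
  have "f \<in> borel_measurable (restrict_space lborel {0..<height})"
    using f by (intro measurable_restrict_space1) simp
  then have "(\<integral>\<^sup>+r. f r \<partial>clock) = (\<integral>\<^sup>+r. f r * indicator {0..<height} r \<partial>restrict_space lborel {0..<height}) / ennreal height"
    using height_pos by (subst nn_integral_uniform_measure) (auto simp: emeasure_clock_base sets_restrict_space)
  also have "(\<integral>\<^sup>+r. f r * indicator {0..<height} r \<partial>restrict_space lborel {0..<height}) = (\<integral>\<^sup>+r\<in>{0..<height}. f r \<partial>lborel)"
    by (subst nn_integral_restrict_space) (auto intro!: nn_integral_cong split: split_indicator)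
  finally show ?thesis .
qed

abbreviation susp :: "((((real ^ 'n) measure) \<times> (real ^ 'n)) \<times> real) measure" where
  "susp \<equiv> suspension_measure height Q"

lemma susp_eq: "susp = Q \<Otimes>\<^sub>M clock"
  by (simp add: suspension_measure_def)

definition factor_map :: "(((real ^ 'n) measure) \<times> (real ^ 'n)) \<times> real \<Rightarrow> (real ^ 'n) measure" where
  "factor_map q = aff (exp (snd q)) (snd (fst q)) (fst (fst q))"

lemma snd_clock [measurable]: "snd \<in> borel_measurable (Q \<Otimes>\<^sub>M clock)"
proof -
  have "(\<lambda>r. r) \<in> borel_measurable clock"
    by (rule clock_measurable) simp
  then show ?thesis
    using measurable_compose[OF measurable_snd[of Q clock], of "\<lambda>r. r" borel] by simp
qed

lemma factor_map_measurable:
  assumes "E \<subseteq> supp_dom \<times> UNIV"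
  shows "factor_map \<in> restrict_space susp E \<rightarrow>\<^sub>M star_borel"
  unfolding factor_map_def[abs_def] susp_eq
  by (rule measurable_aff_msupp)
    (use assms in \<open>auto simp: supp_dom_def intro!: radon_kernel_compose[OF rk_Q]\<close>)

lemma supp_dom_susp: "(supp_dom \<times> UNIV) \<inter> space susp \<in> sets susp"
proof -
  have "(supp_dom \<times> UNIV) \<inter> space susp = (supp_dom \<inter> space Q) \<times> space clock"
    by (auto simp: space_pair_measure susp_eq)
  then show ?thesis
    using supp_dom_Q unfolding susp_eq by (simp only: pair_measureI sets.top)
qed

lemma nn_integral_factor_map:
  assumes G: "G \<in> borel_measurable star_borel"
  shows "(\<integral>\<^sup>+q. G (factor_map q) * indicator (supp_dom \<times> UNIV) q \<partial>susp) = (\<integral>\<^sup>+r\<in>{0..<height}. cent_integral G (exp r) \<partial>lborel) / ennreal height"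
proof -
  interpret pair_sigma_finite Q clock ..
  have "(\<lambda>q. G (factor_map q) * indicator (supp_dom \<times> UNIV) q) \<in> borel_measurable (Q \<Otimes>\<^sub>M clock)"
    using measurable_on_indicator[OF supp_dom_susp factor_map_measurable[OF order_refl] G] by (simp add: susp_eq)
  then have "(\<integral>\<^sup>+q. G (factor_map q) * indicator (supp_dom \<times> UNIV) q \<partial>susp) =
      (\<integral>\<^sup>+r. (\<integral>\<^sup>+p. G (factor_map (p, r)) * indicator (supp_dom \<times> UNIV) (p, r) \<partial>Q) \<partial>clock)"
    unfolding susp_eq by (subst nn_integral_snd[symmetric]) (auto simp: case_prod_beta)
  also have "\<dots> = (\<integral>\<^sup>+r. cent_integral G (exp r) \<partial>clock)"
    unfolding cent_integral_def factor_map_def by (intro nn_integral_cong) (auto split: split_indicator)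
  finally show ?thesis
    by (simp add: nn_integral_clock cent_integral_exp_measurable[OF G])
qed

text \<open>\<open>cent\<close> is built with \<open>measure_of\<close>, which returns the given
  values only for a countably additive set function. Identifying them with a push-forward settles
  additivity and exhibits the factor map at the same time.\<close>

lemma cent_eq: "cent b Q = push_on (supp_dom \<times> UNIV) factor_map susp star_borel"
proof -
  let ?P = "push_on (supp_dom \<times> UNIV) factor_map susp star_borel"
  have sp: "sets ?P = sets star_borel" "space ?P = topspace star_topology"
    by (simp_all add: push_on_def)
  have "cent b Q = measure_of (space ?P) (sets ?P) (emeasure ?P)"
    unfolding cent_def sp
  proof (rule measure_of_eq)
    show "sets star_borel \<subseteq> Pow (topspace star_topology)"
      using sets.space_closed[of star_borel] by simp
    fix A :: "(real ^ 'n) measure set" assume "A \<in> sigma_sets (topspace star_topology) (sets star_borel)"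
    then have A: "A \<in> sets star_borel"
      using sets.sigma_sets_eq[of "star_borel :: (real ^ 'n) measure measure"] by simp
    have "(\<integral>\<^sup>+t\<in>{0..height}. emeasure (push_on scale_dom (scale_star t) (cent0 Q) star_borel) A \<partial>lborel) =
        (\<integral>\<^sup>+t\<in>{0..height}. cent_integral (indicator A) (exp t) \<partial>lborel)"
      by (simp add: emeasure_scaled_cent0[OF A])
    also have "\<dots> = (\<integral>\<^sup>+t\<in>{0..<height}. cent_integral (indicator A) (exp t) \<partial>lborel)"
    proof (rule nn_integral_cong_AE)
      show "AE t in lborel. cent_integral (indicator A) (exp t) * indicator {0..height} t =
          cent_integral (indicator A) (exp t) * indicator {0..<height} t"
        using AE_lborel_singleton[of height] by eventually_elim (auto split: split_indicator)
    qed
    finally show "(\<integral>\<^sup>+t\<in>{0..height}. emeasure (push_on scale_dom (scale_star t) (cent0 Q) star_borel) A \<partial>lborel) / ennreal height =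
        emeasure ?P A"
      using A by (simp add: emeasure_push_on[OF supp_dom_susp factor_map_measurable[OF order_refl] A] nn_integral_factor_map)
  qed
  then show ?thesis
    by (simp add: measure_of_of_measure)
qed

lemma sets_cent: "sets (cent b Q) = sets star_borel"
  by (simp add: cent_eq push_on_def)

lemma space_cent: "space (cent b Q) = topspace star_topology"
  by (simp add: cent_eq push_on_def)

lemma nn_integral_cent:
  assumes "G \<in> borel_measurable star_borel"
  shows "(\<integral>\<^sup>+\<theta>. G \<theta> \<partial>cent b Q) = (\<integral>\<^sup>+r\<in>{0..<height}. cent_integral G (exp r) \<partial>lborel) / ennreal height"
  unfolding cent_eq nn_integral_push_on[OF supp_dom_susp factor_map_measurable[OF order_refl] assms]
  by (rule nn_integral_factor_map[OF assms])

lemma emeasure_cent: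
  assumes "A \<in> sets star_borel"
  shows "emeasure (cent b Q) A = (\<integral>\<^sup>+r\<in>{0..<height}. cent_integral (indicator A) (exp r) \<partial>lborel) / ennreal height"
proof -
  have "emeasure (cent b Q) A = (\<integral>\<^sup>+\<theta>. indicator A \<theta> \<partial>cent b Q)"
    using assms by (simp add: sets_cent)
  then show ?thesis
    using assms by (simp add: nn_integral_cent)
qed

text \<open>Used with the constants \<open>1\<close> and \<open>0\<close>: for the total mass of
  \<open>cent b Q\<close> and for the complement of \<open>scale_dom\<close>.\<close>

lemma cent_integral_const:
  assumes "\<And>\<theta>. \<theta> \<in> topspace star_topology \<Longrightarrow> \<theta> \<in> scale_dom \<Longrightarrow> G \<theta> = c" "a > 0"
  shows "cent_integral G a = c"
proof -
  have "cent_integral G a = (\<integral>\<^sup>+p. c \<partial>Q)"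
    unfolding cent_integral_def
  proof (rule nn_integral_cong_AE)
    show "AE p in Q. G (aff a (snd p) (fst p)) * indicator supp_dom p = c"
      using AE_supp_dom AE_space
    proof eventually_elim
      case (elim p)
      then show ?case
        using scale_aff(2,3)[OF radon_Q[OF elim(2)], of "snd p" a] assms by (simp add: supp_dom_def case_prod_beta)
    qed
  qed
  then show ?thesis
    by (simp add: Q.emeasure_space_1)
qed

lemma prob_space_cent: "prob_space (cent b Q)"
proof (rule prob_spaceI)
  have "emeasure (cent b Q) (topspace star_topology) = (\<integral>\<^sup>+r\<in>{0..<height}. 1 \<partial>lborel) / ennreal height"
    using sets.top[of star_borel] by (subst emeasure_cent) (auto simp: cent_integral_const[where c=1])
  also have "\<dots> = 1"
    using height_pos by (simp add: ennreal_divide_self)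
  finally show "emeasure (cent b Q) (space (cent b Q)) = 1"
    by (simp add: space_cent)
qed

text \<open>Scaling by \<open>t\<close> translates the averaging window, which covers exactly one
  period of the integrand.\<close>

lemma invariant_cent: "invariant_on (cent b Q) scale_dom (scale_star t)"
  unfolding invariant_on_def
proof (intro conjI)
  show D: "scale_dom \<inter> space (cent b Q) \<in> sets (cent b Q)"
    using scale_dom_sets by (simp add: sets_cent space_cent)
  show f: "scale_star t \<in> restrict_space (cent b Q) scale_dom \<rightarrow>\<^sub>M cent b Q"
    using scale_star_measurable[of t] measurable_cong_sets[OF sets_restrict_space_cong[OF sets_cent] sets_cent] by blast
  have N: "space (cent b Q) - scale_dom \<in> sets star_borel"
    using sets.compl_sets[OF D] by (simp add: Diff_Int sets_cent)
  have "emeasure (cent b Q) (space (cent b Q) - scale_dom) = 0"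
    unfolding emeasure_cent[OF N] by (simp add: cent_integral_const[where c=0])
  then have "space (cent b Q) - scale_dom \<in> null_sets (cent b Q)"
    using N by (simp add: null_sets_def sets_cent)
  then show "AE \<theta> in cent b Q. \<theta> \<in> scale_dom"
    by (rule AE_I') auto
  show "push_on scale_dom (scale_star t) (cent b Q) (cent b Q) = cent b Q"
  proof (rule measure_eqI)
    fix A assume "A \<in> sets (push_on scale_dom (scale_star t) (cent b Q) (cent b Q))"
    then have A: "A \<in> sets (cent b Q)" "A \<in> sets star_borel"
      by (simp_all add: push_on_def sets_cent)
    let ?G = "indicator A :: _ \<Rightarrow> ennreal"
    have G: "?G \<in> borel_measurable star_borel"
      using A by simp
    have m: "(\<lambda>\<theta>. ?G (scale_star t \<theta>) * indicator scale_dom \<theta>) \<in> borel_measurable star_borel"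
      by (rule measurable_on_indicator[OF scale_dom_sets scale_star_measurable G])
    have "cent_integral ?G (exp (s + height)) = cent_integral ?G (exp s)" for s
      using cent_integral_mult_b[OF G, of "exp s"] by (simp add: exp_add exp_height)
    note per = nn_integral_periodic[OF cent_integral_exp_measurable[OF G] height_pos this]
    have "emeasure (push_on scale_dom (scale_star t) (cent b Q) (cent b Q)) A =
        (\<integral>\<^sup>+r\<in>{0..<height}. cent_integral ?G (exp (t + r)) \<partial>lborel) / ennreal height"
      by (simp add: emeasure_push_on[OF D f A(1)] nn_integral_cent[OF m] cent_integral_scale exp_add)
    also have "\<dots> = emeasure (cent b Q) A"
      unfolding per emeasure_cent[OF A(2)] ..
    finally show "emeasure (push_on scale_dom (scale_star t) (cent b Q) (cent b Q)) A = emeasure (cent b Q) A" .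
  qed (simp add: push_on_def)
qed

section \<open>The factor map\<close>

text \<open>All forward iterates must stay in \<open>cp_dom b\<close>, since the suspension flow
  uses them at arbitrarily late times. This also makes the set forward invariant.\<close>

definition factor_dom :: "((real ^ 'n) measure \<times> (real ^ 'n)) set" where
  "factor_dom = {p \<in> space Q. (\<forall>k. (cp_star b ^^ k) p \<in> cp_dom b) \<and> p \<in> supp_dom}"

lemma factor_dom_sets: "factor_dom \<in> sets Q"
proof -
  \<comment> \<open>The map is partial, so measurability goes by induction on the horizon: the set
    for \<open>Suc k\<close> is the preimage, within \<open>cp_dom b\<close>, of the set for
    \<open>k\<close>.\<close>
  have S: "{p \<in> space Q. \<forall>j\<le>k. (cp_star b ^^ j) p \<in> cp_dom b} \<in> sets Q" for k
  proof (induction k)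
    case 0
    then show ?case
      using cp_dom_Q by (simp add: Int_def conj_commute)
  next
    case (Suc k)
    let ?S = "{p \<in> space Q. \<forall>j\<le>k. (cp_star b ^^ j) p \<in> cp_dom b}"
    have all_Suc: "(\<forall>j\<le>Suc k. (cp_star b ^^ j) p \<in> cp_dom b) \<longleftrightarrow>
        p \<in> cp_dom b \<and> (\<forall>j\<le>k. (cp_star b ^^ j) (cp_star b p) \<in> cp_dom b)" for p
    proof -
      have "(\<forall>j\<le>Suc k. R j) \<longleftrightarrow> R 0 \<and> (\<forall>j\<le>k. R (Suc j))" for R :: "nat \<Rightarrow> bool"
        by (metis Suc_le_mono le0 not0_implies_Suc)
      then show ?thesis
        by (simp add: funpow_Suc_right del: funpow.simps(2))
    qed
    have "cp_star b -` ?S \<inter> space (restrict_space Q (cp_dom b)) \<in> sets (restrict_space Q (cp_dom b))"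
      by (rule measurable_sets[OF cp_star_Q Suc.IH])
    then have "cp_star b -` ?S \<inter> space (restrict_space Q (cp_dom b)) \<in> sets Q"
      using cp_dom_Q by (simp add: sets_restrict_space_iff)
    also have "cp_star b -` ?S \<inter> space (restrict_space Q (cp_dom b)) =
        {p \<in> space Q. \<forall>j\<le>Suc k. (cp_star b ^^ j) p \<in> cp_dom b}"
      unfolding all_Suc using measurable_space[OF cp_star_Q] by (auto simp: space_restrict_space)
    finally show ?case .
  qed
  have "factor_dom = (\<Inter>k. {p \<in> space Q. \<forall>j\<le>k. (cp_star b ^^ j) p \<in> cp_dom b}) \<inter> (supp_dom \<inter> space Q)"
    by (auto simp: factor_dom_def)
  also have "\<dots> \<in> sets Q"
  proof (rule sets.Int[OF sets.countable_INT supp_dom_Q])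
    show "range (\<lambda>k. {p \<in> space Q. \<forall>j\<le>k. (cp_star b ^^ j) p \<in> cp_dom b}) \<subseteq> sets Q"
      using S by blast
  qed simp
  finally show ?thesis .
qed

lemma AE_factor_dom: "AE p in Q. p \<in> factor_dom"
proof (rule AE_Q)
  show "{p \<in> space Q. p \<in> factor_dom} \<in> sets Q"
    using factor_dom_sets sets.sets_into_space[OF factor_dom_sets] by (simp add: Int_absorb1 Collect_conj_eq)
  have "AE \<omega> in \<Omega>. (\<nu> \<omega>, snd (\<omega> 0)) \<in> supp_dom"
    by (rule AE_distrD[OF pair_measurable AE_supp_dom[unfolded Q_def]])
  with AE_regular AE_space show "AE \<omega> in \<Omega>. (\<nu> \<omega>, snd (\<omega> 0)) \<in> factor_dom"
  proof eventually_elim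
    case (elim \<omega>)
    have "(cp_star b ^^ k) (\<nu> \<omega>, snd (\<omega> 0)) = (\<nu> (shift_path (int k) \<omega>), snd (shift_path (int k) \<omega> 0))" for k
    proof (induction k)
      case (Suc k)
      have "cp_star b (\<nu> (shift_path (int k) \<omega>), snd (shift_path (int k) \<omega> 0)) = (\<nu> (shift_path 1 (shift_path (int k) \<omega>)), snd (shift_path (int k) \<omega> 1))"
        by (rule regular_step[OF b1 regular_shift[OF elim(1)]])
      then show ?case
        by (simp add: Suc shift_path_add) (simp add: shift_path_def)
    qed simp
    then have "(cp_star b ^^ k) (\<nu> \<omega>, snd (\<omega> 0)) \<in> cp_dom b" for k
      using regular_cp_dom[OF b1 regular_shift[OF elim(1), of "int k"]] by simp
    moreover have "(\<nu> \<omega>, snd (\<omega> 0)) \<in> space Q"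
      using measurable_space[OF pair_measurable elim(2)] by (simp add: space_Q topspace_star_pair)
    ultimately show ?case
      using elim(3) by (simp add: factor_dom_def)
  qed
qed

lemma factor_dom_step:
  assumes "p \<in> factor_dom"
  shows "cp_star b p \<in> factor_dom"
proof -
  have p: "p \<in> space Q" "p \<in> cp_dom b" "p \<in> supp_dom" "\<And>k. (cp_star b ^^ k) p \<in> cp_dom b"
    using assms by (auto simp: factor_dom_def dest: spec[of _ 0])
  have "cp_star b p \<in> space Q"
    using measurable_space[OF cp_star_Q, of p] p by (simp add: space_restrict_space)
  moreover have "(cp_star b ^^ k) (cp_star b p) \<in> cp_dom b" for k
    using p(4)[of "Suc k"] by (simp add: funpow_swap1)
  ultimately show ?thesis
    using cp_star_aff(2)[OF b1 radon_Q[OF p(1)] p(2)] p(3) by (simp add: factor_dom_def)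
qed

text \<open>Each application of \<open>cp_star b\<close> absorbs a factor \<open>b\<close> into the
  scale, which is why \<open>a\<close> varies in the induction.\<close>

lemma factor_dom_iter:
  assumes "p \<in> factor_dom"
  shows "(cp_star b ^^ k) p \<in> factor_dom \<and>
    aff a (snd ((cp_star b ^^ k) p)) (fst ((cp_star b ^^ k) p)) = aff (a * real b ^ k) (snd p) (fst p)"
proof (induction k arbitrary: a)
  case 0
  then show ?case using assms by simp
next
  case (Suc k)
  let ?q = "(cp_star b ^^ k) p"
  have q: "?q \<in> factor_dom"
    using Suc.IH by blast
  then have "?q \<in> space Q" "?q \<in> cp_dom b"
    using spec[of "\<lambda>j. (cp_star b ^^ j) ?q \<in> cp_dom b" 0] by (auto simp: factor_dom_def)
  then have "aff a (snd (cp_star b ?q)) (fst (cp_star b ?q)) = aff (a * real b) (snd ?q) (fst ?q)"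
    using cp_star_aff(1)[OF b1 radon_Q] by blast
  also have "\<dots> = aff (a * real b ^ Suc k) (snd p) (fst p)"
    using Suc.IH[of "a * real b"] by (simp add: mult.assoc)
  finally show ?case
    using factor_dom_step[OF q] by simp
qed

lemma factor: "is_factor (cent b Q) scale_dom scale_star susp (suspension_dom (cp_dom b) (cp_star b))
    (suspension_flow height (cp_star b))"
  unfolding is_factor_def
proof (intro exI conjI)
  let ?E = "factor_dom \<times> {0..<height}"
  have sub: "?E \<subseteq> supp_dom \<times> UNIV"
    by (auto simp: factor_dom_def)
  have "{0..<height} \<in> sets clock"
    using sets.top[of clock] by (simp add: space_clock)
  then show E: "?E \<in> sets susp"
    using factor_dom_sets by (auto simp: susp_eq)
  show "?E \<subseteq> suspension_dom (cp_dom b) (cp_star b)"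
    by (auto simp: suspension_dom_def factor_dom_def)
  interpret pair_sigma_finite Q clock ..
  show AE_E: "AE q in susp. q \<in> ?E"
    unfolding susp_eq
  proof (rule AE_pair_measure)
    show "{q \<in> space (Q \<Otimes>\<^sub>M clock). q \<in> ?E} \<in> sets (Q \<Otimes>\<^sub>M clock)"
      using E sets.sets_into_space[OF E] by (simp add: susp_eq Int_absorb1 Collect_conj_eq)
    show "AE p in Q. AE r in clock. (p, r) \<in> ?E"
      using AE_factor_dom
    proof eventually_elim
      case (elim p)
      show ?case
        using AE_space by eventually_elim (use elim in \<open>simp add: space_clock\<close>)
    qed
  qed
  show f: "factor_map \<in> restrict_space susp ?E \<rightarrow>\<^sub>M cent b Q"
    using factor_map_measurable[OF sub] measurable_cong_sets[OF refl sets_cent] by blast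
  show "push_on ?E factor_map susp (cent b Q) = cent b Q"
  proof (rule measure_eqI)
    fix A assume "A \<in> sets (push_on ?E factor_map susp (cent b Q))"
    then have A: "A \<in> sets (cent b Q)" "A \<in> sets star_borel"
      by (simp_all add: push_on_def sets_cent)
    have E': "?E \<inter> space susp \<in> sets susp"
      using E by auto
    have "emeasure (push_on ?E factor_map susp (cent b Q)) A = (\<integral>\<^sup>+q. indicator A (factor_map q) * indicator ?E q \<partial>susp)"
      by (rule emeasure_push_on[OF E' f A(1)])
    also have "\<dots> = (\<integral>\<^sup>+q. indicator A (factor_map q) * indicator (supp_dom \<times> UNIV) q \<partial>susp)"
    proof (rule nn_integral_cong_AE)
      show "AE q in susp. indicator A (factor_map q) * indicator ?E q =
          (indicator A (factor_map q) * indicator (supp_dom \<times> UNIV) q :: ennreal)"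
        using AE_E by eventually_elim (use sub in \<open>auto split: split_indicator\<close>)
    qed
    also have "\<dots> = emeasure (cent b Q) A"
      using A by (simp add: nn_integral_factor_map emeasure_cent)
    finally show "emeasure (push_on ?E factor_map susp (cent b Q)) A = emeasure (cent b Q) A" .
  qed (simp add: push_on_def)
  show "\<forall>q\<in>?E. factor_map q \<in> scale_dom \<and> (\<forall>t\<ge>0. suspension_flow height (cp_star b) t q \<in> ?E \<and>
      factor_map (suspension_flow height (cp_star b) t q) = scale_star t (factor_map q))"
  proof (intro ballI conjI allI impI)
    fix q assume q: "q \<in> ?E"
    obtain p r where qp: "q = (p, r)" by (cases q)
    have p: "p \<in> factor_dom" "fst p \<in> radon" "snd p \<in> msupp (fst p)" and r: "0 \<le> r" "r < height"
      using q by (auto simp: qp factor_dom_def supp_dom_def radon_Q)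
    show "factor_map q \<in> scale_dom"
      using scale_aff(2)[OF p(2,3), of "exp r"] by (simp add: factor_map_def qp)
    fix t :: real assume t: "t \<ge> 0"
    \<comment> \<open>\<open>k\<close> counts the returns to the base up to time \<open>t\<close>,
      and \<open>s\<close> is the height above the base at that time.\<close>
    define k where "k = nat \<lfloor>(r + t) / height\<rfloor>"
    define s where "s = r + t - height * real k"
    have "0 \<le> (r + t) / height"
      using r t height_pos by simp
    then have k: "real_of_int \<lfloor>(r + t) / height\<rfloor> = real k"
      by (simp add: k_def)
    then have flow: "suspension_flow height (cp_star b) t q = ((cp_star b ^^ k) p, s)"
      by (simp add: suspension_flow_def qp s_def flip: k_def)
    have "real k \<le> (r + t) / height" "(r + t) / height < real k + 1"
      unfolding k[symmetric] by linarith+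
    then have s: "0 \<le> s" "s < height"
      using height_pos by (auto simp: s_def field_simps)
    show "suspension_flow height (cp_star b) t q \<in> ?E"
      using factor_dom_iter[OF p(1), of k] s by (simp add: flow)
    \<comment> \<open>Each return lowers the clock by \<open>height\<close> and magnifies by
      \<open>b\<close>, which is the exponential of \<open>height\<close>; hence the total scale
      grows by \<open>exp t\<close> without jumps.\<close>
    have "exp (height * real k) = real b ^ k"
      using exp_of_nat2_mult[of height k] by (simp add: exp_height)
    then have "exp s * real b ^ k = exp (s + height * real k)"
      by (simp add: exp_add)
    then have "exp s * real b ^ k = exp t * exp r"
      by (simp add: s_def exp_add mult.commute)
    then show "factor_map (suspension_flow height (cp_star b) t q) = scale_star t (factor_map q)"
      using factor_dom_iter[OF p(1), of k "exp s"] scale_aff(1)[OF p(2,3), of "exp r" t]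
      by (simp add: flow factor_map_def) (simp add: qp)
  qed
qed

end


section \<open>The quasi-Palm property\<close>

text \<open>If the window carries no mass, neither does \<open>B1\<close> under
  \<open>aff a z \<mu>\<close>, which therefore lies outside every set of normalised measures. The
  default \<open>0\<close> of \<open>measurable_aff_If\<close> is then the true value.\<close>

lemma indicator_aff_charged:
  assumes "A \<in> sets star_borel" "\<mu> \<in> radon"
  shows "indicator A (aff a z \<mu>) = (if charged a z \<mu> then indicator A (aff a z \<mu>) else (0 :: ennreal))"
proof -
  have "A \<subseteq> topspace star_topology"
    using sets.sets_into_space[OF assms(1)] by simp
  then show ?thesis
    using aff_notin_star[OF assms(2)] by (auto split: split_indicator)
qed

lemma measurable_indicator_aff:
  fixes \<kappa> :: "'a \<Rightarrow> (real ^ 'n) measure"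
  assumes A: "A \<in> sets star_borel" and \<kappa>: "radon_kernel M \<kappa>" and z: "z \<in> borel_measurable M" and a: "a \<noteq> 0"
  shows "(\<lambda>x. indicator A (aff a (z x) (\<kappa> x)) :: ennreal) \<in> borel_measurable M"
proof -
  have "(\<lambda>x. if charged a (z x) (\<kappa> x) then indicator A (aff a (z x) (\<kappa> x)) else (0 :: ennreal)) \<in> borel_measurable M"
  proof (rule measurable_aff_If[OF \<kappa> _ z])
    have "(indicator A :: _ \<Rightarrow> ennreal) \<in> borel_measurable star_borel"
      using A by simp
    then show "(\<lambda>p. indicator A (snd p) :: ennreal) \<in> borel_measurable (M \<Otimes>\<^sub>M star_borel)"
      by (rule measurable_compose[OF measurable_snd])
  qed (use a in auto)
  also have "?this \<longleftrightarrow> ?thesis"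
    using \<kappa> by (intro measurable_cong) (subst indicator_aff_charged[OF A], auto simp: radon_kernel_def)
  finally show ?thesis .
qed

lemma radon_kernel_const: "\<mu> \<in> radon \<Longrightarrow> radon_kernel M (\<lambda>_. \<mu>)"
  by (simp add: radon_kernel_def)

lemma AE_aff:
  assumes \<mu>: "\<mu> \<in> radon" and P: "{w. P w} \<in> sets borel" and AE: "AE y in \<mu>. P (amap a z y)"
  shows "AE w in aff a z \<mu>. P w"
proof -
  have "{w. \<not> P w} = - {w. P w}" by auto
  then have N: "{w. \<not> P w} \<in> sets borel"
    using P by simp
  have "AE y in \<mu>. y \<notin> amap a z -` {w. \<not> P w}"
    using AE by eventually_elim simp
  then have "amap a z -` {w. \<not> P w} \<in> null_sets \<mu>"
    using vimage_amap_borel[OF N, of a z] by (subst AE_iff_null_sets) (simp_all add: radon_sets[OF \<mu>])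
  then have "emeasure \<mu> (amap a z -` {w. \<not> P w}) = 0"
    by (rule null_setsD1)
  then have "{w. \<not> P w} \<in> null_sets (aff a z \<mu>)"
    using N by (simp add: null_sets_def sets_aff emeasure_aff[OF \<mu>])
  then show ?thesis
    by (rule AE_I') auto
qed

text \<open>Countably many balls of radius \<open>\<delta> / 2\<close> cover the space, and each ball that charges \<open>B\<close> contains a good point,
  whose \<open>\<delta>\<close>-neighbourhood contains the ball.\<close>

lemma AE_local_to_global:
  fixes \<mu> :: "(real ^ 'n) measure"
  assumes \<mu>: "\<mu> \<in> radon" and \<delta>: "\<delta> > 0"
    and loc: "AE x in \<mu>. x \<in> B \<longrightarrow> (AE z in \<mu>. dist x z < \<delta> \<longrightarrow> P z)"
  shows "AE z in \<mu>. z \<in> B \<longrightarrow> P z"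
proof -
  let ?F = "range (\<lambda>x :: real ^ 'n. ball x (\<delta> / 2))"
  obtain F' where F': "F' \<subseteq> ?F" "countable F'" "\<Union>F' = \<Union>?F"
    by (rule Lindelof[of ?F]) auto
  have "AE z in \<mu>. z \<in> B \<and> z \<in> V \<longrightarrow> P z" if V: "V \<in> F'" for V
  proof (cases "\<exists>x\<in>V. x \<in> B \<and> (AE z in \<mu>. dist x z < \<delta> \<longrightarrow> P z)")
    case True
    then obtain x where x: "x \<in> V" "AE z in \<mu>. dist x z < \<delta> \<longrightarrow> P z"
      by blast
    obtain c where c: "V = ball c (\<delta> / 2)"
      using V F'(1) by blast
    show ?thesis
      using x(2)
    proof eventually_elim
      case (elim z)
      have "dist x z < \<delta>" if "z \<in> V"
        using x(1) that dist_triangle_half_r[of c x \<delta> z] by (simp add: c)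
      then show ?case using elim by simp
    qed
  next
    case False
    show ?thesis
      using loc by eventually_elim (use False in blast)
  qed
  then have "AE z in \<mu>. \<forall>V\<in>F'. z \<in> B \<and> z \<in> V \<longrightarrow> P z"
    by (subst AE_ball_countable[OF F'(2)]) blast
  then show ?thesis
  proof eventually_elim
    case (elim z)
    have "z \<in> \<Union>?F"
      using \<delta> by (auto intro!: exI[of _ z])
    then show ?case
      using elim F'(3) by blast
  qed
qed

section \<open>Comparison of null sets at a fixed scale\<close>

context extended_process
begin

context
  fixes A :: "(real ^ 'n) measure set" and U :: "(real ^ 'n) set"
  assumes A: "A \<in> sets star_borel" and U: "open U" "0 \<in> U"
begin

text \<open>Up to normalisation, the Palm average of the centered measure at scale \<open>a\<close>,
  written in the coordinates of the original measure: \<open>a\<close> enters through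
  \<open>aff\<close> and through the window \<open>U\<close>.\<close>

definition bad_mass :: "real \<Rightarrow> (real ^ 'n) measure \<times> (real ^ 'n) \<Rightarrow> ennreal" where
  "bad_mass a p = (\<integral>\<^sup>+z. indicator A (aff a z (fst p)) * indicator U (amap a (snd p) z) \<partial>fst p)"

definition palm_kernel :: "(real ^ 'n) measure \<Rightarrow> ennreal" where
  "palm_kernel \<theta> = (\<integral>\<^sup>+y. indicator A (translate_star y \<theta>) * indicator U y \<partial>\<theta>)"

lemma U_borel [measurable]: "U \<in> sets borel"
  using U by simp

lemma A_borel: "indicator A \<in> borel_measurable star_borel"
  using A by simp

lemma bad_section:
  assumes "\<mu> \<in> radon" "a \<noteq> 0"
  shows "(\<lambda>z. indicator A (aff a z \<mu>) :: ennreal) \<in> borel_measurable borel"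
  using assms by (intro measurable_indicator_aff[OF A radon_kernel_const]) auto

lemma bad_mass_measurable:
  assumes a: "a \<noteq> 0"
  shows "bad_mass a \<in> borel_measurable star_pair_borel"
proof -
  have rk: "radon_kernel star_pair_borel (fst :: (real ^ 'n) measure \<times> (real ^ 'n) \<Rightarrow> _)"
    by (rule radon_kernel_measurable) measurable
  have "radon_kernel (star_pair_borel \<Otimes>\<^sub>M borel) (\<lambda>q. fst (fst q) :: (real ^ 'n) measure)"
    by (rule radon_kernel_measurable) measurable
  from measurable_indicator_aff[OF A this measurable_snd a]
  have [measurable]: "(\<lambda>q. indicator A (aff a (snd q) (fst (fst q))) :: ennreal) \<in>
      borel_measurable ((star_pair_borel :: ((real ^ 'n) measure \<times> (real ^ 'n)) measure) \<Otimes>\<^sub>M borel)" .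
  show ?thesis
    unfolding bad_mass_def[abs_def] by (rule radon_kernel_nn_integral[OF rk]) measurable
qed

lemma palm_kernel_measurable: "palm_kernel \<in> borel_measurable star_borel"
proof -
  have rk: "radon_kernel star_borel (\<lambda>\<theta>. \<theta> :: (real ^ 'n) measure)"
    by (rule radon_kernel_measurable) measurable
  have "radon_kernel (star_borel \<Otimes>\<^sub>M borel) (\<lambda>q. fst q :: (real ^ 'n) measure)"
    by (rule radon_kernel_measurable) measurable
  from measurable_indicator_aff[OF A this measurable_snd, of 1]
  have [measurable]: "(\<lambda>q. indicator A (aff 1 (snd q) (fst q)) :: ennreal) \<in>
      borel_measurable ((star_borel :: (real ^ 'n) measure measure) \<Otimes>\<^sub>M borel)" by simp
  show ?thesis
    unfolding palm_kernel_def[abs_def] translate_star_eq_aff by (rule radon_kernel_nn_integral[OF rk]) measurable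
qed

lemma palm_mass_eq: "palm_mass P U A = (\<integral>\<^sup>+\<theta>. palm_kernel \<theta> \<partial>P)"
  by (simp add: palm_mass_def palm_kernel_def)

text \<open>Recentering a measure that is already centered and scaled amounts to centering the
  original one at the corresponding point, with the same scale. What remains is a nonzero
  normalising factor, so \<open>palm_kernel\<close> and \<open>bad_mass\<close> vanish
  together.\<close>

lemma palm_kernel_aff:
  assumes \<mu>: "\<mu> \<in> radon" and x: "x \<in> msupp \<mu>" and a: "a > 0"
  shows "palm_kernel (aff a x \<mu>) = 1 / emeasure \<mu> (amap a x -` B1) * bad_mass a (\<mu>, x)"
proof -
  have ch: "charged a x \<mu>"
    by (rule charged_msupp[OF \<mu> x])
  have "aff a x \<mu> \<in> radon"
    using aff_in_star[OF \<mu> _ ch] a by (simp add: topspace_star)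
  then have [measurable]: "(\<lambda>z. indicator A (aff 1 z (aff a x \<mu>)) :: ennreal) \<in> borel_measurable borel"
    by (rule bad_section) simp
  have "aff 1 (amap a x z) (aff a x \<mu>) = aff a z \<mu>" for z
    using a by (subst aff_aff[OF \<mu> _ ch]) (auto simp: amap_def)
  then show ?thesis
    unfolding palm_kernel_def translate_star_eq_aff bad_mass_def
    by (subst nn_integral_aff[OF \<mu>]) auto
qed

lemma cent_integral_palm_kernel:
  assumes a: "a > 0"
  shows "cent_integral palm_kernel a = 0 \<longleftrightarrow> (AE p in Q. bad_mass a p = 0)"
proof -
  have m: "(\<lambda>p. palm_kernel (aff a (snd p) (fst p)) * indicator supp_dom p) \<in> borel_measurable Q"
    using a by (intro measurable_on_indicator[OF supp_dom_Q aff_Q palm_kernel_measurable]) simp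
  have "AE p in Q. palm_kernel (aff a (snd p) (fst p)) * indicator supp_dom p = 0 \<longleftrightarrow> bad_mass a p = 0"
    using AE_supp_dom AE_space
  proof eventually_elim
    case (elim p)
    have \<mu>: "fst p \<in> radon" and x: "snd p \<in> msupp (fst p)"
      using elim radon_Q by (auto simp: supp_dom_def)
    have "1 / emeasure (fst p) (amap a (snd p) -` B1) \<noteq> 0"
      using amap_star_pos(1)[OF \<mu> _ charged_msupp[OF \<mu> x]] a by simp
    then show ?case
      using palm_kernel_aff[OF \<mu> x a] elim(1) by simp
  qed
  then show ?thesis
    unfolding cent_integral_def nn_integral_0_iff_AE[OF m] by (rule eventually_subst)
qed

text \<open>Adaptedness turns a condition on the marked point into one on almost every point of
  \<open>B1\<close>; both implications of the quasi-Palm property start or end there.\<close>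

lemma cent_integral_indicator:
  assumes a: "a > 0"
  shows "cent_integral (indicator A) a = 0 \<longleftrightarrow> (AE p in Q. AE z in fst p. z \<in> B1 \<longrightarrow> aff a z (fst p) \<notin> A)"
proof -
  have F: "(\<lambda>p. indicator A (aff a (snd p) (fst p)) :: ennreal) \<in> borel_measurable star_pair_borel"
    using a by (intro measurable_indicator_aff[OF A]) (auto intro!: radon_kernel_measurable)
  have rk: "radon_kernel Q fst"
    by (rule rk_Q)
  have "radon_kernel (Q \<Otimes>\<^sub>M borel) (\<lambda>q. fst (fst q))"
    by (rule radon_kernel_measurable) measurable
  from measurable_indicator_aff[OF A this measurable_snd, of a] a
  have [measurable]: "(\<lambda>q. indicator A (aff a (snd q) (fst (fst q))) :: ennreal) \<in> borel_measurable (Q \<Otimes>\<^sub>M borel)"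
    by simp
  have N: "(\<lambda>p. \<integral>\<^sup>+z. indicator A (aff a z (fst p)) * indicator B1 z \<partial>fst p) \<in> borel_measurable Q"
    by (rule radon_kernel_nn_integral[OF rk]) measurable
  have "cent_integral (indicator A) a = (\<integral>\<^sup>+p. indicator A (aff a (snd p) (fst p)) \<partial>Q)"
    unfolding cent_integral_def
  proof (rule nn_integral_cong_AE)
    show "AE p in Q. indicator A (aff a (snd p) (fst p)) * indicator supp_dom p =
        (indicator A (aff a (snd p) (fst p)) :: ennreal)"
      using AE_supp_dom by eventually_elim simp
  qed
  also have "\<dots> = (\<integral>\<^sup>+p. (\<integral>\<^sup>+z. indicator A (aff a z (fst p)) * indicator B1 z \<partial>fst p) \<partial>Q)"
    using adapted_Q[OF F] by simp
  finally have "cent_integral (indicator A) a = 0 \<longleftrightarrow>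
      (AE p in Q. (\<integral>\<^sup>+z. indicator A (aff a z (fst p)) * indicator B1 z \<partial>fst p) = 0)"
    by (simp add: nn_integral_0_iff_AE[OF N])
  also have "\<dots> \<longleftrightarrow> (AE p in Q. AE z in fst p. z \<in> B1 \<longrightarrow> aff a z (fst p) \<notin> A)"
  proof (rule AE_cong)
    fix p assume "p \<in> space Q"
    then have \<mu>: "fst p \<in> radon" by (rule radon_Q)
    note [measurable_cong] = radon_sets[OF \<mu>]
    have [measurable]: "(\<lambda>z. indicator A (aff a z (fst p)) :: ennreal) \<in> borel_measurable borel"
      using bad_section[OF \<mu>] a by simp
    have "(\<integral>\<^sup>+z. indicator A (aff a z (fst p)) * indicator B1 z \<partial>fst p) = 0 \<longleftrightarrow>
        (AE z in fst p. indicator A (aff a z (fst p)) * indicator B1 z = (0 :: ennreal))"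
      by (rule nn_integral_0_iff_AE) measurable
    also have "\<dots> \<longleftrightarrow> (AE z in fst p. z \<in> B1 \<longrightarrow> aff a z (fst p) \<notin> A)"
      by (rule AE_cong) (auto split: split_indicator)
    finally show "(\<integral>\<^sup>+z. indicator A (aff a z (fst p)) * indicator B1 z \<partial>fst p) = 0 \<longleftrightarrow>
        (AE z in fst p. z \<in> B1 \<longrightarrow> aff a z (fst p) \<notin> A)" .
  qed
  finally show ?thesis .
qed

lemma bad_mass_eq_0:
  assumes "\<mu> \<in> radon" "a \<noteq> 0"
  shows "bad_mass a (\<mu>, x) = 0 \<longleftrightarrow> (AE z in \<mu>. amap a x z \<in> U \<longrightarrow> aff a z \<mu> \<notin> A)"
proof -
  note [measurable_cong] = radon_sets[OF assms(1)]
  note [measurable] = bad_section[OF assms]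
  have "bad_mass a (\<mu>, x) = 0 \<longleftrightarrow> (AE z in \<mu>. indicator A (aff a z \<mu>) * indicator U (amap a x z) = (0 :: ennreal))"
    unfolding bad_mass_def fst_conv snd_conv by (rule nn_integral_0_iff_AE) measurable
  also have "\<dots> \<longleftrightarrow> (AE z in \<mu>. amap a x z \<in> U \<longrightarrow> aff a z \<mu> \<notin> A)"
    by (rule AE_cong) (auto split: split_indicator)
  finally show ?thesis .
qed

text \<open>Adaptedness applied to \<open>bad_mass\<close> shows that almost every \<open>x\<close>
  in \<open>B1\<close> has no bad points, up to a null set, within distance \<open>d / a\<close>.
  The radius does not depend on \<open>x\<close>, as \<open>AE_local_to_global\<close>
  requires.\<close>

lemma palm_imp_null:
  assumes a: "a > 0" and 0: "cent_integral palm_kernel a = 0"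
  shows "cent_integral (indicator A) a = 0"
proof -
  have Jm: "bad_mass a \<in> borel_measurable star_pair_borel"
    using a by (intro bad_mass_measurable) simp
  have N: "(\<lambda>p. \<integral>\<^sup>+x. bad_mass a (fst p, x) * indicator B1 x \<partial>fst p) \<in> borel_measurable Q"
  proof (rule radon_kernel_nn_integral[OF rk_Q])
    have rk2: "radon_kernel (Q \<Otimes>\<^sub>M borel) (\<lambda>q. fst (fst q))"
      by (rule radon_kernel_measurable) measurable
    have "radon_kernel ((Q \<Otimes>\<^sub>M borel) \<Otimes>\<^sub>M borel) (\<lambda>q. fst (fst (fst q)))"
      by (rule radon_kernel_measurable) measurable
    from measurable_indicator_aff[OF A this measurable_snd, of a] a
    have [measurable]: "(\<lambda>q. indicator A (aff a (snd q) (fst (fst (fst q)))) :: ennreal)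
        \<in> borel_measurable ((Q \<Otimes>\<^sub>M borel) \<Otimes>\<^sub>M borel)"
      by simp
    have [measurable]: "(\<lambda>q. bad_mass a (fst (fst q), snd q)) \<in> borel_measurable (Q \<Otimes>\<^sub>M borel)"
      unfolding bad_mass_def fst_conv snd_conv by (rule radon_kernel_nn_integral[OF rk2]) measurable
    show "(\<lambda>(p, x). bad_mass a (fst p, x) * indicator B1 x) \<in> borel_measurable (Q \<Otimes>\<^sub>M borel)"
      by measurable
  qed
  have "AE p in Q. bad_mass a p = 0"
    using 0 cent_integral_palm_kernel[OF a] by simp
  then have "(\<integral>\<^sup>+p. bad_mass a p \<partial>Q) = 0"
    using Jm by (subst nn_integral_0_iff_AE) (auto simp: measurable_Q_eq)
  then have "AE p in Q. (\<integral>\<^sup>+x. bad_mass a (fst p, x) * indicator B1 x \<partial>fst p) = 0"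
    unfolding adapted_Q[OF Jm] nn_integral_0_iff_AE[OF N] .
  then show ?thesis
    unfolding cent_integral_indicator[OF a] using AE_space
  proof eventually_elim
    case (elim p)
    have \<mu>: "fst p \<in> radon" by (rule radon_Q[OF elim(2)])
    note [measurable_cong] = radon_sets[OF \<mu>]
    have "(\<lambda>x. (fst p, x)) \<in> restrict_space borel B1 \<rightarrow>\<^sub>M star_pair_borel"
    proof (rule measurable_into_star_pair)
      show "(\<lambda>x. fst p) \<in> restrict_space borel B1 \<rightarrow>\<^sub>M star_borel"
        using elim(2) by (intro measurable_const) (auto simp: space_Q)
    qed (auto simp: space_restrict_space intro: measurable_restrict_space1)
    from measurable_on_indicator[OF _ this Jm]
    have [measurable]: "(\<lambda>x. bad_mass a (fst p, x) * indicator B1 x) \<in> borel_measurable borel"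
      by simp
    have "AE x in fst p. bad_mass a (fst p, x) * indicator B1 x = 0"
      using elim(1) by (subst (asm) nn_integral_0_iff_AE) measurable
    then have loc: "AE x in fst p. x \<in> B1 \<longrightarrow> (AE z in fst p. amap a x z \<in> U \<longrightarrow> aff a z (fst p) \<notin> A)"
      by eventually_elim (use bad_mass_eq_0[OF \<mu>] a in \<open>auto split: split_indicator_asm\<close>)
    obtain d where d: "d > 0" "ball 0 d \<subseteq> U"
      using U open_contains_ball by blast
    show ?case
    proof (rule AE_local_to_global[OF \<mu>])
      show "0 < d / a"
        using d a by simp
      have near: "amap a x z \<in> U" if "dist x z < d / a" for x z
      proof -
        have "norm (amap a x z) = a * dist x z"
          using a by (simp add: amap_def dist_norm norm_minus_commute)
        also have "\<dots> < d"
          using that a by (simp add: pos_less_divide_eq mult.commute)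
        finally show ?thesis
          using d(2) by auto
      qed
      show "AE x in fst p. x \<in> B1 \<longrightarrow> (AE z in fst p. dist x z < d / a \<longrightarrow> aff a z (fst p) \<notin> A)"
        using loc
      proof eventually_elim
        case (elim x)
        show ?case
        proof
          assume "x \<in> B1"
          with elim have "AE z in fst p. amap a x z \<in> U \<longrightarrow> aff a z (fst p) \<notin> A"
            by simp
          then show "AE z in fst p. dist x z < d / a \<longrightarrow> aff a z (fst p) \<notin> A"
            by eventually_elim (use near in blast)
        qed
      qed
    qed
  qed
qed

text \<open>By \<open>cent_integral_mult_b\<close>, almost no point of \<^const>\<open>B1\<close> is bad at the scales \<open>a * b ^ n\<close>. Looking at the measure \<open>n\<close>
  steps in the past, this says that almost no point of the \<open>n\<close>-th blown-up cube is bad at scale \<open>a\<close>, and these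
  cubes exhaust the measure.\<close>

lemma null_imp_palm:
  assumes a: "a > 0" and 0: "cent_integral (indicator A) a = 0"
  shows "cent_integral palm_kernel a = 0"
proof -
  have "cent_integral (indicator A) (a * real b ^ n) = 0" for n
  proof (induction n)
    case (Suc n)
    have "a * real b ^ n > 0"
      using a b1 by simp
    from cent_integral_mult_b[OF A_borel this] Suc show ?case
      by (simp add: ac_simps)
  qed (simp add: 0)
  then have "AE p in Q. AE z in fst p. z \<in> B1 \<longrightarrow> aff (a * real (b ^ n)) z (fst p) \<notin> A" for n
    using cent_integral_indicator[of "a * real (b ^ n)"] a b1 by simp
  note this[unfolded Q_def]
  from AE_distrD[OF pair_measurable this]
  have "AE \<omega> in \<Omega>. AE z in \<nu> \<omega>. z \<in> B1 \<longrightarrow> aff (a * real (b ^ n)) z (\<nu> \<omega>) \<notin> A" for n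
    unfolding fst_conv .
  then have "AE \<omega> in \<Omega>. AE z in \<nu> (shift_path (- int n) \<omega>). z \<in> B1 \<longrightarrow>
      aff (a * real (b ^ n)) z (\<nu> (shift_path (- int n) \<omega>)) \<notin> A" for n
    by (rule AE_shift)
  then have all: "AE \<omega> in \<Omega>. \<forall>n. AE z in \<nu> (shift_path (- int n) \<omega>). z \<in> B1 \<longrightarrow>
      aff (a * real (b ^ n)) z (\<nu> (shift_path (- int n) \<omega>)) \<notin> A"
    unfolding AE_all_countable by blast
  have "AE \<omega> in \<Omega>. bad_mass a (\<nu> \<omega>, snd (\<omega> 0)) = 0"
    using all AE_regular
  proof eventually_elim
    case (elim \<omega>)
    note r = elim(2)
    have rad: "\<nu> \<omega> \<in> radon"
      by (rule regular_radon[OF b1 r])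
    have "AE w in \<nu> \<omega>. w \<in> blowup b \<omega> n \<longrightarrow> aff a w (\<nu> \<omega>) \<notin> A" for n
    proof -
      define \<nu>' where "\<nu>' = \<nu> (shift_path (- int n) \<omega>)"
      define c where "c = ctr (b ^ n) (snd (\<omega> (- int n)))"
      have r': "regular b \<nu> (shift_path (- int n) \<omega>)"
        by (rule regular_shift[OF r])
      have rad': "\<nu>' \<in> radon"
        unfolding \<nu>'_def by (rule regular_radon[OF b1 r'])
      have ch: "charged (real (b ^ n)) c \<nu>'"
        using regular_charged[OF b1 r', of n] by (simp add: \<nu>'_def c_def shift_path_def)
      have eq: "aff (real (b ^ n)) c \<nu>' = \<nu> \<omega>"
        using regular_steps[OF b1 r', of n] unfolding shift_path_add by (simp add: \<nu>'_def c_def shift_path_def)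
      have bn: "real (b ^ n) \<noteq> 0"
        using b1 by simp
      have "AE w in aff (real (b ^ n)) c \<nu>'. w \<in> blowup b \<omega> n \<longrightarrow> aff a w (\<nu> \<omega>) \<notin> A"
      proof (rule AE_aff[OF rad'])
        have [measurable]: "(\<lambda>z. indicator A (aff a z (\<nu> \<omega>)) :: ennreal) \<in> borel_measurable borel"
          using bad_section[OF rad] a by simp
        have [measurable]: "blowup b \<omega> n \<in> sets borel"
          by (rule blowup_borel[OF b1 r])
        have "{w. w \<in> blowup b \<omega> n \<longrightarrow> indicator A (aff a w (\<nu> \<omega>)) = (0 :: ennreal)} \<in> sets borel"
          by measurable
        then show "{w. w \<in> blowup b \<omega> n \<longrightarrow> aff a w (\<nu> \<omega>) \<notin> A} \<in> sets borel"
          by (simp add: indicator_eq_0_iff)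
        have "AE z in \<nu>'. z \<in> B1 \<longrightarrow> aff (a * real (b ^ n)) z \<nu>' \<notin> A"
          unfolding \<nu>'_def by (rule spec[OF elim(1)])
        then show "AE z in \<nu>'. amap (real (b ^ n)) c z \<in> blowup b \<omega> n \<longrightarrow> aff a (amap (real (b ^ n)) c z) (\<nu> \<omega>) \<notin> A"
        proof eventually_elim
          case (elim z)
          have "aff a (amap (real (b ^ n)) c z) (\<nu> \<omega>) = aff (a * real (b ^ n)) z \<nu>'"
            unfolding eq[symmetric] using b1 by (subst aff_aff[OF rad' bn ch]) (simp add: amap_def)
          moreover have "z \<in> B1" if "amap (real (b ^ n)) c z \<in> blowup b \<omega> n"
            using that bn unfolding blowup_def[OF b1 r] c_def by (auto simp: amap_def)
          ultimately show ?case
            using elim by simp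
        qed
      qed
      then show ?thesis
        unfolding eq .
    qed
    then have "AE w in \<nu> \<omega>. \<forall>n. w \<in> blowup b \<omega> n \<longrightarrow> aff a w (\<nu> \<omega>) \<notin> A"
      unfolding AE_all_countable by blast
    with regular_union[OF b1 r] have "AE w in \<nu> \<omega>. aff a w (\<nu> \<omega>) \<notin> A"
      by eventually_elim (auto simp: blowup_def[OF b1 r])
    \<comment> \<open>Bad points are already excluded on the whole space, so the window around the
      marked point can be any set.\<close>
    then have "AE w in \<nu> \<omega>. amap a (snd (\<omega> 0)) w \<in> U \<longrightarrow> aff a w (\<nu> \<omega>) \<notin> A"
      by eventually_elim simp
    then show ?case
      using bad_mass_eq_0[OF rad] a by simp
  qed
  then have "AE p in Q. bad_mass a p = 0"
  proof (rule AE_Q[rotated])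
    have "bad_mass a \<in> borel_measurable Q"
      using a bad_mass_measurable by (simp add: measurable_Q_eq)
    then show "{p \<in> space Q. bad_mass a p = 0} \<in> sets Q"
      by measurable
  qed
  then show ?thesis
    using cent_integral_palm_kernel[OF a] by simp
qed

text \<open>Each average vanishes exactly if its integrand vanishes at almost every scale of one
  period, and at every single scale the two integrands vanish together.\<close>

lemma palm_null_iff: "emeasure (cent b Q) A = 0 \<longleftrightarrow> palm_mass (cent b Q) U A = 0"
proof -
  have zero: "(\<integral>\<^sup>+\<theta>. G \<theta> \<partial>cent b Q) = 0 \<longleftrightarrow> (AE r in lborel. r \<in> {0..<height} \<longrightarrow> cent_integral G (exp r) = 0)"
    if G: "G \<in> borel_measurable star_borel" for G
  proof -
    note [measurable] = cent_integral_exp_measurable[OF G]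
    have "(\<integral>\<^sup>+\<theta>. G \<theta> \<partial>cent b Q) = 0 \<longleftrightarrow> (\<integral>\<^sup>+r\<in>{0..<height}. cent_integral G (exp r) \<partial>lborel) = 0"
      by (simp add: nn_integral_cent[OF G] ennreal_divide_eq_0_iff)
    also have "\<dots> \<longleftrightarrow> (AE r in lborel. cent_integral G (exp r) * indicator {0..<height} r = 0)"
      by (rule nn_integral_0_iff_AE) measurable
    also have "\<dots> \<longleftrightarrow> (AE r in lborel. r \<in> {0..<height} \<longrightarrow> cent_integral G (exp r) = 0)"
      by (rule AE_cong) (auto split: split_indicator)
    finally show ?thesis .
  qed
  have "emeasure (cent b Q) A = (\<integral>\<^sup>+\<theta>. indicator A \<theta> \<partial>cent b Q)"
    using A by (simp add: sets_cent)
  moreover have "cent_integral (indicator A) (exp r) = 0 \<longleftrightarrow> cent_integral palm_kernel (exp r) = 0" for r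
    using palm_imp_null null_imp_palm by (meson exp_gt_zero)
  ultimately show ?thesis
    by (simp add: palm_mass_eq zero[OF A_borel] zero[OF palm_kernel_measurable])
qed

end

lemma fractal_distribution_cent: "fractal_distribution (cent b Q)"
  unfolding fractal_distribution_def quasi_palm_def
  using prob_space_cent sets_cent invariant_cent palm_null_iff by auto

end

theorem theorem1p14:
  fixes b :: nat and Q :: "((real ^ 'n) measure \<times> (real ^ 'n)) measure"
  assumes "b \<ge> 2" and "extended_CP b Q"
  shows "fractal_distribution (cent b Q) \<and>
    is_factor_of_suspension (cent b Q) scale_dom scale_star Q (cp_dom b) (cp_star b) (ln (real b))"
proof -
  obtain Q\<^sub>0 \<Omega> \<nu> where "restricted_CP b Q\<^sub>0" "two_sided_process b Q\<^sub>0 \<Omega>" "\<nu> \<in> \<Omega> \<rightarrow>\<^sub>M star_borel"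
    "AE \<omega> in \<Omega>. \<forall>A \<in> sets borel. (\<lambda>n. emeasure (approximant b \<omega> n) A) \<longlonglongrightarrow> emeasure (\<nu> \<omega>) A"
    "Q = distr \<Omega> star_pair_borel (\<lambda>\<omega>. (\<nu> \<omega>, snd (\<omega> 0)))"
    using assms(2) unfolding extended_CP_def is_extended_version_def by blast
  then interpret extended_process b Q\<^sub>0 \<Omega> \<nu> Q
    using assms(1) by unfold_locales
  show ?thesis
    unfolding is_factor_of_suspension_def
    using fractal_distribution_cent invariant_cp_star factor by blast
qed


end
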